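(* Let $\Omega$, $\mathcal T_h$, the patches $\Omega_1,\dots,\Omega_N$, the partition functions $\psi_1,\dots,\psi_N$, the local trial sets $V_i\subset H^1(\Omega_i)$ and the global set $V=\sum_{i=1}^N\psi_iV_i$ be as described in the context, and let $M\in\mathbb N$, $C_\infty>0$, $C_G>0$ be constants such that $$\operatorname{card}\{i\in\{1,\dots,N\} : x\in\Omega_i\}\le M\quad\text{for all }x\in\Omega,$$ $$\|\psi_i\|_{L^\infty(\Omega)}\le C_\infty,\qquad \|\nabla\psi_i\|_{L^\infty(\Omega)}\le \frac{C_G}{\operatorname{diam}(\Omega_i)},\qquad i=1,\dots,N.$$ Let $u\in H^1(\Omega)$. Assume that for each $i=1,\dots,N$ there are $v_i\in V_i$ and real numbers $\varepsilon_1(i),\varepsilon_2(i)\ge 0$ such that $$\|u-v_i\|_{L^2(\Omega_i\cap\Omega)}\le\varepsilon_1(i),\qquad \|\nabla(u-v_i)\|_{L^2(\Omega_i\cap\Omega)}\le\varepsilon_2(i).$$ Then the function $$u_{\rm NNh}=\sum_{i=1}^N\psi_iv_i\in V\subset H^1(\Omega)$$ satisfies $$\|u-u_{\rm NNh}\|_{L^2(\Omega)}\le\sqrt{M}\,C_\infty\left(\sum_{i=1}^N\varepsilon_1^2(i)\right)^{1/2},$$ $$\|\nabla(u-u_{\rm NNh})\|_{L^2(\Omega)}\le\sqrt{2M}\left(\sum_{i=1}^N\left(\left(\frac{C_G}{\operatorname{diam}(\Omega_i)}\right)^2\varepsilon_1^2(i)+C_\infty^2\,\varepsilon_2^2(i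)\right)\right)^{1/2}.$$
   Context: $\Omega\subset\mathbb R^2$ is a bounded polygonal Lipschitz domain, and $\mathcal T_h$ is a regular (conforming, shape-regular) triangulation of $\overline\Omega$ into closed triangles. $\mathcal N_h$ and $\mathcal E_h$ denote the sets of all vertices and of all edges of $\mathcal T_h$. On each triangle $K$, the barycentric coordinates are the affine functions on $K$ equal to $1$ at one vertex of $K$ and $0$ at the other two. Envelop functions (each is extended by zero to the rest of $\overline\Omega$): (i) for a vertex $Z\in\mathcal N_h$, $\varphi_Z|_K$ is the barycentric coordinate of $K$ associated with $Z$, for every $K\in\mathcal T_h$ having $Z$ as a vertex; (ii) for an edge $E\in\mathcal E_h$, $\varphi_E|_K$ is the product of the two barycentric coordinates of $K$ associated with the endpoints of $E$, for every $K\in\mathcal T_h$ having $E$ as an edge; (iii) for a triangle $K\in\mathcal T_h$, $\varphi_K=\lambda_1\lambda_2\lambda_3$ on $K$, the product of its three barycentric coordinates. Let $\varphi_1,\dots,\varphi_N$ be an enumeration of all these functions (over all vertices, edges and triangles). The patches are $\Omega_i:=\operatorname{supp}(\varphi_i)$, and $\operatorname{diam}(\Omega_i)$ is the diameter of $\Omega_i$. The partition functions are $$\psi_i(x)=\frac{\varphi_i(x)}{\sum_{j=1}^N\varphi_j(x)},\qquad i=1,\dots,N,$$ so that $\sum_{i=1}^N\psi_i=1$ on $\Omega$ and $\operatorname{supp}(\psi_i)\subseteq\Omega_i$. For each $i$, the local neural network trial set is $V_i=\{\phi_i(\cdot;\theta_i):\theta_i\in\Theta_i\}\subset H^1(\Omega_i)$,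 where $\phi_i(\cdot;\theta_i)$ is a neural network function with parameter $\theta_i$ in a parameter set $\Theta_i$. The global set is $V=\sum_{i=1}^N\psi_iV_i=\{\sum_{i=1}^N\psi_iv_i : v_i\in V_i\}$, where $\psi_iv_i$ is understood to be zero outside $\Omega_i$. *)

theory Defs
  imports "HOL-Analysis.Analysis" "HOL-Probability.Essential_Supremum"
begin

section \<open>Lebesgue and Sobolev spaces\<close>

text \<open>Functions on a set \<open>U\<close> are total functions of which only the values on \<open>U\<close> matter.
  The norms of vector fields are those of their pointwise euclidean norm.\<close>

definition support :: "('a::topological_space \<Rightarrow> real) \<Rightarrow> 'a set" where
  "support f = closure {x. f x \<noteq> 0}"

definition L2 :: "'a::euclidean_space set \<Rightarrow> ('a \<Rightarrow> 'b::euclidean_space) set" where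
  "L2 U = {f \<in> borel_measurable (lebesgue_on U). integrable (lebesgue_on U) (\<lambda>x. (norm (f x))\<^sup>2)}"

definition L2_norm :: "'a::euclidean_space set \<Rightarrow> ('a \<Rightarrow> 'b::euclidean_space) \<Rightarrow> real" where
  "L2_norm U f = sqrt (LINT x|lebesgue_on U. (norm (f x))\<^sup>2)"

definition Linf_norm :: "'a::euclidean_space set \<Rightarrow> ('a \<Rightarrow> 'b::euclidean_space) \<Rightarrow> ereal" where
  "Linf_norm U f = esssup (lebesgue_on U) (\<lambda>x. ereal (norm (f x)))"

primrec Ck :: "nat \<Rightarrow> ('a::euclidean_space \<Rightarrow> real) \<Rightarrow> bool" where
  "Ck 0 f \<longleftrightarrow> continuous_on UNIV f"
| "Ck (Suc k) f \<longleftrightarrow> (\<exists>g. (\<forall>x. GDERIV f x :> g x) \<and> (\<forall>b\<in>Basis. Ck k (\<lambda>x. g x \<bullet> b)))"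

definition test_functions :: "'a::euclidean_space set \<Rightarrow> ('a \<Rightarrow> real) set" where
  "test_functions U = {\<phi>. (\<forall>k. Ck k \<phi>) \<and> compact (support \<phi>) \<and> support \<phi> \<subseteq> U}"

definition has_weak_gradient ::
    "'a::euclidean_space set \<Rightarrow> ('a \<Rightarrow> real) \<Rightarrow> ('a \<Rightarrow> 'a) \<Rightarrow> bool" where
  "has_weak_gradient U f g \<longleftrightarrow>
     (\<forall>K. compact K \<and> K \<subseteq> U \<longrightarrow> f absolutely_integrable_on K \<and> g absolutely_integrable_on K) \<and>
     (\<forall>\<phi>\<in>test_functions U. \<forall>D\<phi>. (\<forall>x. GDERIV \<phi> x :> D\<phi> x) \<longrightarrow>
        (LINT x|lebesgue_on U. f x *\<^sub>R D\<phi> x) = - (LINT x|lebesgue_on U. \<phi> x *\<^sub>R g x))"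

text \<open>The weak gradient on an open set \<open>U\<close> is unique almost everywhere in \<open>U\<close>; the choice picks
  a representative.\<close>

definition weak_gradient :: "'a::euclidean_space set \<Rightarrow> ('a \<Rightarrow> real) \<Rightarrow> 'a \<Rightarrow> 'a" where
  "weak_gradient U f = (SOME g. has_weak_gradient U f g)"

definition H1 :: "'a::euclidean_space set \<Rightarrow> ('a \<Rightarrow> real) set" where
  "H1 U = {f \<in> L2 U. \<exists>g \<in> L2 U. has_weak_gradient U f g}"


section \<open>Polygonal Lipschitz domains and triangulations\<close>

type_synonym point = "real ^ 2"

text \<open>Near each boundary point \<open>p\<close> the domain is, in orthonormal coordinates \<open>(s, t)\<close> centred at
  \<open>p\<close> with axes \<open>e\<close> and \<open>n\<close>, the part of a rectangle lying above the graph of a Lipschitz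
  function \<open>g\<close>.\<close>

definition lipschitz_boundary :: "point set \<Rightarrow> bool" where
  "lipschitz_boundary \<Omega> \<longleftrightarrow>
     (\<forall>p\<in>frontier \<Omega>. \<exists>e n g L r h.
        norm e = 1 \<and> norm n = 1 \<and> e \<bullet> n = 0 \<and> r > 0 \<and> h > 0 \<and>
        L-lipschitz_on {-r<..<r} g \<and> g 0 = 0 \<and> (\<forall>s. \<bar>s\<bar> < r \<longrightarrow> \<bar>g s\<bar> < h) \<and>
        (\<forall>s t. \<bar>s\<bar> < r \<and> \<bar>t\<bar> < h \<longrightarrow> (p + s *\<^sub>R e + t *\<^sub>R n \<in> \<Omega> \<longleftrightarrow> g s < t)))"

definition polygonal_boundary :: "point set \<Rightarrow> bool" where
  "polygonal_boundary \<Omega> \<longleftrightarrow>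
     (\<exists>S. finite S \<and> frontier \<Omega> = (\<Union>(a, b)\<in>S. closed_segment a b))"

definition polygonal_lipschitz_domain :: "point set \<Rightarrow> bool" where
  "polygonal_lipschitz_domain \<Omega> \<longleftrightarrow>
     open \<Omega> \<and> connected \<Omega> \<and> \<Omega> \<noteq> {} \<and> bounded \<Omega> \<and> polygonal_boundary \<Omega> \<and> lipschitz_boundary \<Omega>"

definition incircle_diameter :: "point set \<Rightarrow> real" where
  "incircle_diameter K = Sup {diameter (cball c r) | c r. 0 \<le> r \<and> cball c r \<subseteq> K}"

text \<open>Conformity (two triangles meet in a common face, possibly empty) is part of
  \<^const>\<open>triangulation\<close>; \<open>\<kappa>\<close> is the shape-regularity constant.\<close>

definition regular_triangulation :: "real \<Rightarrow> point set \<Rightarrow> point set set \<Rightarrow> bool" where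
  "regular_triangulation \<kappa> \<Omega> \<T> \<longleftrightarrow>
     triangulation \<T> \<and> (\<forall>K\<in>\<T>. 2 simplex K) \<and> \<Union>\<T> = closure \<Omega> \<and>
     (\<forall>K\<in>\<T>. diameter K \<le> \<kappa> * incircle_diameter K)"

definition vertices :: "point set set \<Rightarrow> point set" where
  "vertices \<T> = {z. \<exists>K\<in>\<T>. z extreme_point_of K}"

definition edges :: "point set set \<Rightarrow> point set set" where
  "edges \<T> = {E. \<exists>K\<in>\<T>. E edge_of K}"


section \<open>Envelop functions, patches and the partition of unity\<close>

text \<open>On a nondegenerate triangle \<open>K\<close> the barycentric coordinate is an affine function on \<open>K\<close>; it is
  identified with its unique affine extension to the plane.\<close>

definition barycentric :: "point set \<Rightarrow> point \<Rightarrow> point \<Rightarrow> real" where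
  "barycentric K z = (THE l. (\<exists>a c. l = (\<lambda>x. a \<bullet> x + c)) \<and>
     (\<forall>w. w extreme_point_of K \<longrightarrow> l w = (if w = z then 1 else 0)))"

text \<open>The function equal to \<open>f K\<close> on each \<open>K \<in> \<K>\<close>, extended by zero. Where several members
  of \<open>\<K>\<close> overlap, the pieces used below agree by conformity, so the choice is immaterial.\<close>

definition glue :: "point set set \<Rightarrow> (point set \<Rightarrow> point \<Rightarrow> real) \<Rightarrow> point \<Rightarrow> real" where
  "glue \<K> f x = (if x \<in> \<Union>\<K> then f (SOME K. K \<in> \<K> \<and> x \<in> K) x else 0)"

definition vertex_envelop :: "point set set \<Rightarrow> point \<Rightarrow> point \<Rightarrow> real" where
  "vertex_envelop \<T> Z = glue {K \<in> \<T>. Z extreme_point_of K} (\<lambda>K. barycentric K Z)"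

definition edge_envelop :: "point set set \<Rightarrow> point set \<Rightarrow> point \<Rightarrow> real" where
  "edge_envelop \<T> E =
     glue {K \<in> \<T>. E edge_of K} (\<lambda>K x. \<Prod>z | z extreme_point_of E. barycentric K z x)"

definition triangle_envelop :: "point set \<Rightarrow> point \<Rightarrow> real" where
  "triangle_envelop K = glue {K} (\<lambda>K x. \<Prod>z | z extreme_point_of K. barycentric K z x)"

definition envelop_functions :: "point set set \<Rightarrow> (point \<Rightarrow> real) set" where
  "envelop_functions \<T> =
     vertex_envelop \<T> ` vertices \<T> \<union> edge_envelop \<T> ` edges \<T> \<union> triangle_envelop ` \<T>"

definition partition_fun :: "nat \<Rightarrow> (nat \<Rightarrow> point \<Rightarrow> real) \<Rightarrow> nat \<Rightarrow> point \<Rightarrow> real" where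
  "partition_fun N \<phi> i x = \<phi> i x / (\<Sum>j=1..N. \<phi> j x)"

definition local_sum ::
    "nat \<Rightarrow> (nat \<Rightarrow> point \<Rightarrow> real) \<Rightarrow> (nat \<Rightarrow> point \<Rightarrow> real) \<Rightarrow> point \<Rightarrow> real" where
  "local_sum N \<phi> v x =
     (\<Sum>i=1..N. if x \<in> support (\<phi> i) then partition_fun N \<phi> i x * v i x else 0)"

definition global_set ::
    "nat \<Rightarrow> (nat \<Rightarrow> point \<Rightarrow> real) \<Rightarrow> (nat \<Rightarrow> (point \<Rightarrow> real) set) \<Rightarrow> (point \<Rightarrow> real) set" where
  "global_set N \<phi> V = {local_sum N \<phi> v | v. \<forall>i\<in>{1..N}. v i \<in> V i}"

text \<open>The parametrised family \<open>net i \<theta>\<close>, \<open>\<theta> \<in> \<Theta> i\<close>, stands for the local network functions; no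
  architecture is prescribed.\<close>

definition trial_set ::
    "(nat \<Rightarrow> 'p \<Rightarrow> point \<Rightarrow> real) \<Rightarrow> (nat \<Rightarrow> 'p set) \<Rightarrow> nat \<Rightarrow> (point \<Rightarrow> real) set" where
  "trial_set net \<Theta> i = {net i \<theta> | \<theta>. \<theta> \<in> \<Theta> i}"

end

theory Submission
  imports Defs
begin

text \<open>On \<open>\<Omega>\<close> the partition functions \<open>\<psi> i\<close> sum to one, so the error is
\<open>u - u\<^sub>N = (\<Sum>i. \<psi> i * (u - v i))\<close>, a sum of pieces each of which lives on one patch. At most \<open>M\<close>
of the pieces are nonzero at any point, so by Cauchy-Schwarz the square of the sum is at most \<open>M\<close>
times the sum of the squares (\<open>norm_sum_squared_le_overlap\<close>). Integrating and using
\<open>\<bar>\<psi> i\<bar> \<le> C_inf\<close> gives the first estimate. For the second one the pieces have the gradients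
\<open>\<psi> i * \<nabla>w + w * \<nabla>(\<psi> i)\<close> with \<open>w = u - v i\<close>, and \<open>(a + b)\<^sup>2 \<le> 2 * a\<^sup>2 + 2 * b\<^sup>2\<close> is the source of
the additional factor 2 (\<open>localized_error_estimates\<close>).

The substance is that product rule on all of \<open>\<Omega>\<close> (\<open>has_weak_gradient_localized\<close>): \<open>w\<close> is a Sobolev
function only inside the patch, its values on the rest of \<open>\<Omega>\<close> are arbitrary, and yet the
extension of \<open>\<psi> i * w\<close> by zero must have a weak gradient without a contribution from the boundary of
the patch. The reason is that \<open>\<psi> i\<close> is continuous and vanishes outside the patch. For a test
function \<open>\<phi>\<close> on \<open>\<Omega>\<close>, cutting \<open>\<psi> i\<close> off softly near its zero set turns \<open>\<psi> i * \<phi>\<close> into a Lipschitz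
function with compact support inside the patch. Mollification shows that such a function may be used
as a test function for \<open>w\<close> (\<open>weak_gradient_lipschitz_test\<close>), and the cut-off is then removed by
dominated convergence. Where \<open>\<psi> i = 0\<close> nothing is lost in the limit: there \<open>\<psi> i\<close> has a minimum,
so its gradient vanishes too.

That the \<open>\<psi> i\<close> are regular enough comes from the conformity of the mesh. Barycentric coordinates of
two triangles agree on the common face, so each envelop function is on every triangle the product
of the barycentric coordinates at one and the same set of points (\<open>envelop_on_tiles\<close>). Hence it
is continuous and piecewise polynomial, and \<open>\<psi> i\<close> is continuous and piecewise rational. For such
functions, times a test function, the difference quotients have integral zero and converge
boundedly to the gradient taken triangle by triangle, which therefore is the weak gradient
(\<open>has_weak_gradient_piecewise\<close>).

The hypotheses and the conclusion speak about representatives of weak gradients picked by choice.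
Since weak gradients are unique almost everywhere (\<open>weak_gradient_unique\<close>), the bounds carry over
from the chosen representatives to the explicit ones and back.\<close>

section \<open>Smooth functions with compact support\<close>

lemma GDERIV_unique:
  assumes "GDERIV f x :> D" "GDERIV f x :> E"
  shows "D = E"
proof -
  have "(\<lambda>h. inner h D) = (\<lambda>h. inner h E)"
    using assms unfolding gderiv_def by (rule has_derivative_unique)
  then have "(D - E) \<bullet> D = (D - E) \<bullet> E"
    by (rule fun_cong)
  then have "(D - E) \<bullet> (D - E) = 0"
    by (simp only: inner_diff_right right_minus_eq)
  then show ?thesis
    by simp
qed

lemma GDERIV_imp_continuous: "(\<And>x. x \<in> S \<Longrightarrow> GDERIV f x :> D x) \<Longrightarrow> continuous_on S f"
  unfolding gderiv_def
  by (rule has_derivative_continuous_on[OF has_derivative_at_withinI])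

lemma GDERIV_inner_right: "GDERIV (\<lambda>x. x \<bullet> b) x :> b"
  unfolding gderiv_def by (auto intro!: derivative_eq_intros)

lemma GDERIV_transform_open:
  assumes "GDERIV f x :> D" "open S" "x \<in> S" "\<And>y. y \<in> S \<Longrightarrow> f y = g y"
  shows "GDERIV g x :> D"
  using assms has_derivative_transform_within_open[of f "\<lambda>h. inner h D" x UNIV S g]
  unfolding gderiv_def by auto

text \<open>The predicate \<open>Ck\<close> provides regularity of the gradient only component by component.\<close>

lemma continuous_on_from_components:
  fixes g :: "'b::topological_space \<Rightarrow> 'a::euclidean_space"
  assumes "\<And>b. b \<in> Basis \<Longrightarrow> continuous_on S (\<lambda>x. g x \<bullet> b)"
  shows "continuous_on S g"
proof -
  have "continuous_on S (\<lambda>x. \<Sum>b\<in>Basis. (g x \<bullet> b) *\<^sub>R b)"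
    by (intro continuous_on_sum continuous_on_scaleR assms continuous_on_const)
  then show ?thesis by (simp add: euclidean_representation)
qed

lemma Ck_imp_continuous: "Ck k f \<Longrightarrow> continuous_on UNIV f"
  by (cases k) (auto intro: GDERIV_imp_continuous)

lemma Ck_Suc_imp: "Ck (Suc k) f \<Longrightarrow> Ck k f"
proof (induction k arbitrary: f)
  case 0
  then show ?case using Ck_imp_continuous[OF 0] by simp
next
  case (Suc k)
  then obtain g where "\<forall>x. GDERIV f x :> g x" "\<forall>b\<in>Basis. Ck (Suc k) (\<lambda>x. g x \<bullet> b)"
    by auto
  then show ?case using Suc.IH by auto
qed

lemma Ck_const: "Ck k (\<lambda>x. c)"
proof (induction k arbitrary: c)
  case (Suc k)
  then show ?case by (auto intro!: exI[of _ "\<lambda>x. 0"] GDERIV_const)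
qed simp

lemma Ck_inner_right: "Ck k (\<lambda>x. x \<bullet> b)"
proof (cases k)
  case (Suc k)
  then show ?thesis by (auto intro!: exI[of _ "\<lambda>x. b"] GDERIV_inner_right Ck_const)
qed (auto intro!: continuous_intros)

lemma Ck_add: "Ck k f \<Longrightarrow> Ck k g \<Longrightarrow> Ck k (\<lambda>x. f x + g x)"
proof (induction k arbitrary: f g)
  case 0
  then show ?case by (auto intro: continuous_intros)
next
  case (Suc k)
  then obtain f' g' where "\<forall>x. GDERIV f x :> f' x" "\<forall>b\<in>Basis. Ck k (\<lambda>x. f' x \<bullet> b)"
      "\<forall>x. GDERIV g x :> g' x" "\<forall>b\<in>Basis. Ck k (\<lambda>x. g' x \<bullet> b)" by auto
  then show ?case using Suc.IH
    by (auto intro!: exI[of _ "\<lambda>x. f' x + g' x"] GDERIV_add simp: inner_add_left)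
qed

lemma Ck_mult: "Ck k f \<Longrightarrow> Ck k g \<Longrightarrow> Ck k (\<lambda>x. f x * g x)"
proof (induction k arbitrary: f g)
  case 0
  then show ?case by (auto intro: continuous_intros)
next
  case (Suc k)
  then obtain f' g' where *: "\<forall>x. GDERIV f x :> f' x" "\<forall>b\<in>Basis. Ck k (\<lambda>x. f' x \<bullet> b)"
      "\<forall>x. GDERIV g x :> g' x" "\<forall>b\<in>Basis. Ck k (\<lambda>x. g' x \<bullet> b)" by auto
  moreover have "Ck k f" "Ck k g" using Suc.prems Ck_Suc_imp by auto
  ultimately have "Ck k (\<lambda>x. f x * (g' x \<bullet> b) + g x * (f' x \<bullet> b))" if "b \<in> Basis" for b
    using Suc.IH that by (intro Ck_add) auto
  then show ?case using *
    by (auto intro!: exI[of _ "\<lambda>x. f x *\<^sub>R g' x + g x *\<^sub>R f' x"] GDERIV_mult simp: inner_add_left)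
qed

text \<open>The family is closed under differentiation, which makes it convenient for showing smoothness of
the classical bump function: \<open>flat_exp 0\<close> is \<open>exp (- 1 / t)\<close> extended by zero, and every derivative
of a member is a linear combination of members.\<close>

definition flat_exp :: "nat \<Rightarrow> real \<Rightarrow> real" where
  "flat_exp n t = (if t > 0 then exp (- 1 / t) / t ^ n else 0)"

lemma flat_exp_tendsto_0: "(flat_exp n \<longlongrightarrow> 0) (at_right 0)"
proof -
  have "((\<lambda>s::real. s ^ n / exp s) \<longlongrightarrow> 0) at_top"
    by (rule tendsto_power_div_exp_0)
  then have "((\<lambda>t::real. inverse t ^ n / exp (inverse t)) \<longlongrightarrow> 0) (at_right 0)"
    by (rule filterlim_compose[OF _ filterlim_inverse_at_top_right])
  moreover have "\<forall>\<^sub>F t::real in at_right 0. inverse t ^ n / exp (inverse t) = flat_exp n t"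
    using eventually_at_right_less[of "0::real"]
    by eventually_elim (simp add: flat_exp_def exp_minus inverse_eq_divide power_one_over)
  ultimately show ?thesis
    by (rule Lim_transform_eventually)
qed

text \<open>At \<open>t = 0\<close> the difference quotient of \<open>flat_exp n\<close> is \<open>flat_exp (n + 1)\<close>, which tends to zero
because the exponential beats every power.\<close>

lemma flat_exp_DERIV: "DERIV (flat_exp n) t :> flat_exp (n + 2) t - n * flat_exp (n + 1) t"
proof -
  consider "t < 0" | "t > 0" | "t = 0" by linarith
  then show ?thesis
  proof cases
    case 1
    have "((\<lambda>t. 0) has_field_derivative 0) (at t)" by simp
    then have "(flat_exp n has_field_derivative 0) (at t)"
      by (rule has_field_derivative_transform_within_open[of _ _ _ "{..<0}"])
         (use 1 in \<open>auto simp: flat_exp_def\<close>)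
    then show ?thesis using 1 by (simp add: flat_exp_def)
  next
    case 2
    have *: "exp (- 1 / t) / t ^ (n + 2) - n * (exp (- 1 / t) / t ^ (n + 1)) =
       (exp (- 1 / t) * (1 / t\<^sup>2) * t ^ n - exp (- 1 / t) * (real n * t ^ (n - 1))) / (t ^ n * t ^ n)"
      using 2 by (cases n) (auto simp: field_simps power2_eq_square)
    have "((\<lambda>t. exp (- 1 / t) / t ^ n) has_field_derivative
       (exp (- 1 / t) / t ^ (n + 2) - n * (exp (- 1 / t) / t ^ (n + 1)))) (at t)"
      unfolding * using 2 by (auto intro!: derivative_eq_intros simp: power2_eq_square)
    then have "(flat_exp n has_field_derivative
       (exp (- 1 / t) / t ^ (n + 2) - n * (exp (- 1 / t) / t ^ (n + 1)))) (at t)"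
      by (rule has_field_derivative_transform_within_open[of _ _ _ "{0<..}"])
         (use 2 in \<open>auto simp: flat_exp_def\<close>)
    then show ?thesis using 2 by (simp add: flat_exp_def)
  next
    case 3
    have "((\<lambda>h. flat_exp n h / h) \<longlongrightarrow> 0) (at_right 0)"
      using flat_exp_tendsto_0[of "Suc n"]
      by (rule tendsto_cong[THEN iffD1, rotated])
         (use eventually_at_right_less[of "0::real"] in \<open>eventually_elim, simp add: flat_exp_def\<close>)
    moreover have "((\<lambda>h. flat_exp n h / h) \<longlongrightarrow> 0) (at_left 0)"
      by (rule tendsto_cong[THEN iffD1, rotated, OF tendsto_const])
         (auto simp: flat_exp_def eventually_at_filter)
    ultimately have "((\<lambda>h. flat_exp n h / h) \<longlongrightarrow> 0) (at 0)"
      by (simp add: filterlim_split_at)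
    then show ?thesis using 3
      by (simp add: DERIV_def flat_exp_def)
  qed
qed

text \<open>The gradient of the composition with the quadratic polynomial is again built from members of the
family and from linear functions, so the induction runs over all \<open>n\<close> at once.\<close>

lemma Ck_flat_exp:
  fixes r :: real
  shows "Ck k (\<lambda>x::'a::euclidean_space. flat_exp n (r - x \<bullet> x))"
proof (induction k arbitrary: n)
  case 0
  have "continuous_on UNIV (flat_exp n)"
    by (meson DERIV_isCont flat_exp_DERIV continuous_at_imp_continuous_on)
  then show ?case
    by (auto intro!: continuous_on_compose2[of UNIV "flat_exp n"] continuous_intros)
next
  case (Suc k)
  define g :: "'a \<Rightarrow> 'a" where "g x = (flat_exp (n + 2) (r - x \<bullet> x) - n * flat_exp (n + 1) (r - x \<bullet> x)) *\<^sub>R (-2 *\<^sub>R x)" for x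
  have quad: "GDERIV (\<lambda>x. r - x \<bullet> x) x :> (-2) *\<^sub>R x" for x :: 'a
    unfolding gderiv_def by (auto intro!: derivative_eq_intros simp: inner_commute)
  have "GDERIV (\<lambda>x. flat_exp n (r - x \<bullet> x)) x :> g x" for x
    unfolding g_def by (rule GDERIV_DERIV_compose[OF quad flat_exp_DERIV])
  moreover have "Ck k (\<lambda>x. g x \<bullet> b)" for b
  proof -
    have "Ck k (\<lambda>x::'a. (flat_exp (n + 2) (r - x \<bullet> x) + (- real n) * flat_exp (n + 1) (r - x \<bullet> x)) * ((-2) * (x \<bullet> b)))"
      by (intro Ck_mult Ck_add Ck_const Ck_inner_right Suc.IH)
    then show ?thesis by (simp add: g_def algebra_simps)
  qed
  ultimately show ?case by auto
qed

lemma integrable_continuous_compact_support: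
  fixes f :: "'a::euclidean_space \<Rightarrow> 'b::{banach, second_countable_topology}"
  assumes "continuous_on UNIV f" "compact S" "\<And>x. x \<notin> S \<Longrightarrow> f x = 0"
  shows "integrable lborel f"
proof -
  have "integrable lborel (\<lambda>x. indicator S x *\<^sub>R f x)"
    using assms by (intro borel_integrable_compact) (auto intro: continuous_on_subset)
  moreover have "(\<lambda>x. indicator S x *\<^sub>R f x) = f"
    using assms by (auto simp: indicator_def)
  ultimately show ?thesis by simp
qed

definition mollifier :: "real \<Rightarrow> ('a::euclidean_space \<Rightarrow> real) \<Rightarrow> bool" where
  "mollifier \<delta> \<rho> \<longleftrightarrow> (\<forall>k. Ck k \<rho>) \<and> (\<forall>x. \<rho> x \<ge> 0) \<and> (\<forall>x. norm x \<ge> \<delta> \<longrightarrow> \<rho> x = 0)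
     \<and> integrable lborel \<rho> \<and> (LINT x|lborel. \<rho> x) = 1"

lemma mollifier_exists:
  assumes "\<delta> > 0"
  shows "\<exists>\<rho> :: 'a::euclidean_space \<Rightarrow> real. mollifier \<delta> \<rho>"
proof -
  define f :: "'a \<Rightarrow> real" where "f x = flat_exp 0 (\<delta>\<^sup>2 - x \<bullet> x)" for x
  have nonneg: "f x \<ge> 0" for x by (simp add: f_def flat_exp_def)
  have zero: "f x = 0" if "norm x \<ge> \<delta>" for x
    using that assms by (simp add: f_def flat_exp_def dot_square_norm power_mono not_less)
  have Ck: "Ck k f" for k unfolding f_def by (rule Ck_flat_exp)
  have cont: "continuous_on UNIV f" using Ck_imp_continuous[OF Ck] .
  have int: "integrable lborel f"
    by (rule integrable_continuous_compact_support[OF cont compact_cball[of 0 \<delta>]]) (auto simp: zero)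
  \<comment> \<open>If the integral vanished, then so would f almost everywhere, but f is positive on a ball.\<close>
  have "(LINT x|lborel. f x) \<noteq> 0"
  proof
    assume "(LINT x|lborel. f x) = 0"
    then have "AE x in lborel. f x = 0"
      using integral_nonneg_eq_0_iff_AE[OF int] nonneg by auto
    then have "AE x::'a in lborel. x \<notin> ball 0 \<delta>"
    proof eventually_elim
      fix x :: 'a assume "f x = 0"
      then have "\<delta>\<^sup>2 \<le> (norm x)\<^sup>2"
        by (auto simp: f_def flat_exp_def dot_square_norm split: if_splits)
      then show "x \<notin> ball 0 \<delta>"
        using power2_le_imp_le[of \<delta> "norm x"] by auto
    qed
    then have "emeasure lborel (ball 0 \<delta> :: 'a set) = 0"
      by (subst (asm) AE_iff_measurable[OF _ refl]) (auto simp: ball_def)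
    then have "negligible (ball 0 \<delta> :: 'a set)"
      by (simp add: negligible_iff_null_sets null_sets_completionI null_setsI)
    then show False
      using open_not_negligible[of "ball (0::'a) \<delta>"] assms by simp
  qed
  moreover have "(LINT x|lborel. f x) \<ge> 0" using nonneg by simp
  ultimately have pos: "(LINT x|lborel. f x) > 0" by linarith
  have "Ck k (\<lambda>x. (1 / (LINT x|lborel. f x)) * f x)" for k
    by (intro Ck_mult Ck_const Ck)
  then have "mollifier \<delta> (\<lambda>x. (1 / (LINT x|lborel. f x)) * f x)"
    using pos nonneg zero int by (auto simp: mollifier_def)
  then show ?thesis by blast
qed

section \<open>Mollification of continuous functions\<close>

text \<open>Smoothness is inherited from the second argument alone, so \<open>\<eta>\<close> may be merely continuous.\<close>

definition convolution :: "('a::euclidean_space \<Rightarrow> real) \<Rightarrow> ('a \<Rightarrow> real) \<Rightarrow> 'a \<Rightarrow> real" where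
  "convolution \<eta> \<rho> x = (LINT y|lborel. \<eta> y * \<rho> (x - y))"

lemma compact_support_lborel_integral_eq_cbox:
  fixes h :: "'a::euclidean_space \<Rightarrow> 'b::euclidean_space"
  assumes "continuous_on UNIV h" "\<And>y. y \<notin> cbox a b \<Longrightarrow> h y = 0"
  shows "(LINT y|lborel. h y) = integral (cbox a b) h"
proof -
  have "integrable lborel h"
    by (rule integrable_continuous_compact_support[OF assms(1) compact_cbox assms(2)])
  then have "(LINT y|lborel. h y) = integral UNIV h"
    by (simp add: integral_lborel)
  also have "\<dots> = integral UNIV (\<lambda>y. if y \<in> cbox a b then h y else 0)"
    using assms(2) by (intro arg_cong[where f="integral UNIV"]) auto
  also have "\<dots> = integral (cbox a b) h"
    by (rule Henstock_Kurzweil_Integration.integral_restrict_UNIV)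
  finally show ?thesis .
qed

text \<open>Since \<open>\<eta>\<close> has compact support the integral extends over a fixed box, and one may
differentiate under the integral sign.\<close>

lemma GDERIV_convolution:
  fixes \<eta> \<rho> :: "'a::euclidean_space \<Rightarrow> real"
  assumes \<eta>: "continuous_on UNIV \<eta>" "compact S" "\<And>x. x \<notin> S \<Longrightarrow> \<eta> x = 0"
    and \<rho>: "\<And>x. GDERIV \<rho> x :> D x" and D: "continuous_on UNIV D"
  shows "GDERIV (convolution \<eta> \<rho>) x :> (LINT y|lborel. \<eta> y *\<^sub>R D (x - y))"
proof -
  obtain a b where ab: "S \<subseteq> cbox a b"
    by (metis \<eta>(2) bounded_subset_cbox_symmetric compact_imp_bounded)
  have z: "\<eta> y = 0" if "y \<notin> cbox a b" for y using \<eta>(3) ab that by blast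
  have \<rho>c: "continuous_on UNIV \<rho>" by (rule GDERIV_imp_continuous[OF \<rho>])
  note [continuous_intros] = continuous_on_compose2[OF \<eta>(1)] continuous_on_compose2[OF \<rho>c] continuous_on_compose2[OF D]
  have conv: "convolution \<eta> \<rho> = (\<lambda>x. integral (cbox a b) (\<lambda>y. \<eta> y * \<rho> (x - y)))"
    unfolding convolution_def
    by (intro ext compact_support_lborel_integral_eq_cbox continuous_intros) (auto simp: z)
  have deriv: "((\<lambda>x. integral (cbox a b) (\<lambda>y. \<eta> y * \<rho> (x - y))) has_derivative
      blinfun_apply (integral (cbox a b) (\<lambda>y. \<eta> y *\<^sub>R blinfun_inner_left (D (x - y))))) (at x within UNIV)"
  proof (rule leibniz_rule)
    fix x y :: 'a
    have "((\<lambda>x. \<rho> (x - y)) has_derivative (\<lambda>h. h \<bullet> D (x - y))) (at x)"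
      using \<rho>[of "x - y"] unfolding gderiv_def
      by (auto intro!: derivative_eq_intros has_derivative_compose[where f="\<lambda>x. x - y" and g=\<rho>])
    then show "((\<lambda>x. \<eta> y * \<rho> (x - y)) has_derivative
        blinfun_apply (\<eta> y *\<^sub>R blinfun_inner_left (D (x - y)))) (at x within UNIV)"
      by (auto intro!: derivative_eq_intros simp: blinfun.scaleR_left)
  next
    show "(\<lambda>y. \<eta> y * \<rho> (x - y)) integrable_on cbox a b" for x
      by (intro integrable_continuous continuous_intros) auto
  next
    show "continuous_on (UNIV \<times> cbox a b) (\<lambda>(x, y). \<eta> y *\<^sub>R blinfun_inner_left (D (x - y)))"
      unfolding case_prod_beta
      by (intro continuous_intros bounded_linear.continuous_on[OF bounded_linear_blinfun_inner_left]) auto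
  qed auto
  have int: "(\<lambda>y. \<eta> y *\<^sub>R blinfun_inner_left (D (x - y))) integrable_on cbox a b"
    by (intro integrable_continuous continuous_intros bounded_linear.continuous_on[OF bounded_linear_blinfun_inner_left]) auto
  have int2: "(\<lambda>y. \<eta> y *\<^sub>R D (x - y)) integrable_on cbox a b"
    by (intro integrable_continuous continuous_intros) auto
  have "blinfun_apply (integral (cbox a b) (\<lambda>y. \<eta> y *\<^sub>R blinfun_inner_left (D (x - y)))) h =
      h \<bullet> (LINT y|lborel. \<eta> y *\<^sub>R D (x - y))" for h
  proof -
    have "blinfun_apply (integral (cbox a b) (\<lambda>y. \<eta> y *\<^sub>R blinfun_inner_left (D (x - y)))) h =
        integral (cbox a b) (\<lambda>y. h \<bullet> (\<eta> y *\<^sub>R D (x - y)))"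
      by (simp add: blinfun_apply_integral[OF int] blinfun.scaleR_left)
    also have "\<dots> = h \<bullet> integral (cbox a b) (\<lambda>y. \<eta> y *\<^sub>R D (x - y))"
      using integral_linear[OF int2 bounded_linear_inner_right[of h]] by (simp add: o_def)
    also have "integral (cbox a b) (\<lambda>y. \<eta> y *\<^sub>R D (x - y)) = (LINT y|lborel. \<eta> y *\<^sub>R D (x - y))"
      by (rule compact_support_lborel_integral_eq_cbox[symmetric]) (auto simp: z intro!: continuous_intros)
    finally show ?thesis .
  qed
  then have "blinfun_apply (integral (cbox a b) (\<lambda>y. \<eta> y *\<^sub>R blinfun_inner_left (D (x - y)))) =
      (\<lambda>h. h \<bullet> (LINT y|lborel. \<eta> y *\<^sub>R D (x - y)))"
    by (rule ext)
  with deriv show ?thesis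
    unfolding conv gderiv_def by metis
qed

lemma Ck_convolution:
  fixes \<eta> \<rho> :: "'a::euclidean_space \<Rightarrow> real"
  assumes \<eta>: "continuous_on UNIV \<eta>" "compact S" "\<And>x. x \<notin> S \<Longrightarrow> \<eta> x = 0" and "Ck k \<rho>"
  shows "Ck k (convolution \<eta> \<rho>)"
  using assms(4)
proof (induction k arbitrary: \<rho>)
  case 0
  obtain a b where ab: "S \<subseteq> cbox a b"
    by (metis \<eta>(2) bounded_subset_cbox_symmetric compact_imp_bounded)
  have z: "\<eta> y = 0" if "y \<notin> cbox a b" for y using \<eta>(3) ab that by blast
  have \<rho>: "continuous_on UNIV \<rho>" using 0 by simp
  note [continuous_intros] = continuous_on_compose2[OF \<eta>(1)] continuous_on_compose2[OF \<rho>]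
  have "convolution \<eta> \<rho> = (\<lambda>x. integral (cbox a b) (\<lambda>y. \<eta> y * \<rho> (x - y)))"
    unfolding convolution_def
    by (intro ext compact_support_lborel_integral_eq_cbox continuous_intros) (auto simp: z)
  moreover have "continuous_on UNIV (\<lambda>x. integral (cbox a b) (\<lambda>y. \<eta> y * \<rho> (x - y)))"
    by (intro integral_continuous_on_param, unfold case_prod_beta, intro continuous_intros) auto
  ultimately show ?case by simp
next
  case (Suc k)
  then obtain D where D: "\<And>x. GDERIV \<rho> x :> D x" "\<And>b. b \<in> Basis \<Longrightarrow> Ck k (\<lambda>x. D x \<bullet> b)" by auto
  have Dc: "continuous_on UNIV D"
    using D(2) Ck_imp_continuous by (blast intro: continuous_on_from_components)
  note [continuous_intros] = continuous_on_compose2[OF \<eta>(1)] continuous_on_compose2[OF Dc]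
  have "(LINT y|lborel. \<eta> y *\<^sub>R D (x - y)) \<bullet> b = convolution \<eta> (\<lambda>z. D z \<bullet> b) x" for x b
  proof -
    have "integrable lborel (\<lambda>y. \<eta> y *\<^sub>R D (x - y))"
      using \<eta> by (intro integrable_continuous_compact_support[OF _ \<eta>(2)] continuous_intros) auto
    then show ?thesis
      unfolding convolution_def by (subst integral_inner_left[symmetric]) auto
  qed
  then have "Ck k (\<lambda>x. (LINT y|lborel. \<eta> y *\<^sub>R D (x - y)) \<bullet> b)" if "b \<in> Basis" for b
    using Suc.IH[OF D(2)[OF that]] by simp
  then show ?case
    using GDERIV_convolution[OF \<eta> D(1) Dc] unfolding Ck.simps
    by (intro exI[of _ "\<lambda>x. LINT y|lborel. \<eta> y *\<^sub>R D (x - y)"]) blast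
qed

lemma lborel_distr_reflect: "distr lborel borel (\<lambda>y::'a::euclidean_space. x - y) = lborel"
  using lborel_affine[of "-1" x] by (simp add: density_1)

lemma lborel_integral_reflect:
  fixes f :: "'a::euclidean_space \<Rightarrow> 'b::{banach, second_countable_topology}"
  assumes [measurable]: "f \<in> borel_measurable borel"
  shows "(LINT y|lborel. f (x - y)) = (LINT y|lborel. f y)"
  by (subst lborel_distr_reflect[of x, symmetric], subst integral_distr) auto

lemma lborel_integrable_reflect:
  fixes f :: "'a::euclidean_space \<Rightarrow> 'b::{banach, second_countable_topology}"
  assumes "integrable lborel f"
  shows "integrable lborel (\<lambda>y. f (x - y))"
proof -
  have [measurable]: "f \<in> borel_measurable borel" using assms by auto
  have "integrable (distr lborel borel (\<lambda>y. x - y)) f"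
    using assms by (simp add: lborel_distr_reflect)
  then show ?thesis by (subst (asm) integrable_distr_eq) auto
qed

text \<open>A mollifier is a probability density concentrated near the origin; averages against it
are as close to \<open>c\<close> as the averaged values are. Used with \<open>c = F x\<close> for convergence and
with \<open>c = 0\<close> for uniform bounds.\<close>

lemma mollifier_average_close:
  fixes F :: "'a::euclidean_space \<Rightarrow> 'b::euclidean_space"
  assumes \<rho>: "mollifier \<delta> \<rho>" and [measurable]: "F \<in> borel_measurable borel"
    and e: "\<And>y. norm (x - y) < \<delta> \<Longrightarrow> norm (F y - c) \<le> e" "e \<ge> 0"
  shows "integrable lborel (\<lambda>y. \<rho> (x - y) *\<^sub>R F y)"
    and "norm ((LINT y|lborel. \<rho> (x - y) *\<^sub>R F y) - c) \<le> e"
proof -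
  have r: "integrable lborel (\<lambda>y. \<rho> (x - y))" "(LINT y|lborel. \<rho> (x - y)) = 1"
    using \<rho> by (auto simp: mollifier_def lborel_integrable_reflect lborel_integral_reflect)
  have [measurable]: "\<rho> \<in> borel_measurable borel" using \<rho> by (auto simp: mollifier_def)
  have b: "norm (\<rho> (x - y) *\<^sub>R (F y - c)) \<le> e * \<rho> (x - y)" for y
  proof (cases "norm (x - y) < \<delta>")
    case True
    then show ?thesis
      using mult_right_mono[OF e(1)[OF True], of "\<rho> (x - y)"] \<rho>
      by (auto simp: mollifier_def mult.commute)
  next
    case False
    then show ?thesis using \<rho> by (auto simp: mollifier_def not_less)
  qed
  have i: "integrable lborel (\<lambda>y. \<rho> (x - y) *\<^sub>R (F y - c))"
    by (rule Bochner_Integration.integrable_bound[where f="\<lambda>y. e * \<rho> (x - y)"])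
       (use r b e(2) \<rho> in \<open>auto simp: mollifier_def\<close>)
  have eq: "\<rho> (x - y) *\<^sub>R F y = \<rho> (x - y) *\<^sub>R (F y - c) + \<rho> (x - y) *\<^sub>R c" for y
    by (simp add: algebra_simps)
  show "integrable lborel (\<lambda>y. \<rho> (x - y) *\<^sub>R F y)"
    unfolding eq using i r by auto
  have "(LINT y|lborel. \<rho> (x - y) *\<^sub>R F y) = (LINT y|lborel. \<rho> (x - y) *\<^sub>R (F y - c)) + c"
    unfolding eq using i r by simp
  moreover have "norm (LINT y|lborel. \<rho> (x - y) *\<^sub>R (F y - c)) \<le> (LINT y|lborel. e * \<rho> (x - y))"
    by (rule order_trans[OF integral_norm_bound integral_mono])
       (use integrable_norm[OF i] r b in auto)
  ultimately show "norm ((LINT y|lborel. \<rho> (x - y) *\<^sub>R F y) - c) \<le> e"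
    using r by simp
qed

lemma convolution_close:
  assumes "mollifier \<delta> \<rho>" "L-lipschitz_on UNIV \<eta>" "\<delta> > 0"
  shows "\<bar>convolution \<eta> \<rho> x - \<eta> x\<bar> \<le> L * \<delta>"
proof -
  have m: "\<eta> \<in> borel_measurable borel"
    by (rule borel_measurable_continuous_onI[OF lipschitz_on_continuous_on[OF assms(2)]])
  have L: "L \<ge> 0" using assms(2) lipschitz_on_nonneg by blast
  have "norm (\<eta> y - \<eta> x) \<le> L * \<delta>" if "norm (x - y) < \<delta>" for y
  proof -
    have "norm (\<eta> y - \<eta> x) \<le> L * norm (x - y)"
      using lipschitz_onD[OF assms(2), of y x] by (simp add: dist_norm norm_minus_commute)
    also have "\<dots> \<le> L * \<delta>" using that L by (intro mult_left_mono) auto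
    finally show ?thesis .
  qed
  from mollifier_average_close(2)[OF assms(1) m this] show ?thesis
    using L assms(3) by (simp add: convolution_def mult.commute)
qed

lemma convolution_eq_0:
  assumes "mollifier \<delta> \<rho>" "\<And>y. y \<notin> S \<Longrightarrow> \<eta> y = 0" "x \<notin> (\<Union>y\<in>S. cball y e)" "\<delta> \<le> e"
  shows "convolution \<eta> \<rho> x = 0"
proof -
  have "\<eta> y * \<rho> (x - y) = 0" for y
  proof (cases "y \<in> S")
    case True
    then have "norm (x - y) \<ge> \<delta>"
      using assms(3,4) by (auto simp: dist_norm norm_minus_commute)
    then show ?thesis using assms(1) by (auto simp: mollifier_def)
  qed (use assms in auto)
  then have "(\<lambda>y. \<eta> y * \<rho> (x - y)) = (\<lambda>y. 0)" by (rule ext)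
  then show ?thesis unfolding convolution_def by simp
qed

text \<open>A compact subset of an open set keeps a positive distance from the complement, so mollifying on a
small scale stays inside the open set; all supports lie in one compact set \<open>S'\<close>, on which locally
integrable functions are integrable.\<close>

lemma mollifying_sequence:
  fixes \<eta> :: "'a::euclidean_space \<Rightarrow> real"
  assumes "continuous_on UNIV \<eta>" "compact S" "\<And>x. x \<notin> S \<Longrightarrow> \<eta> x = 0" "open U" "S \<subseteq> U"
  obtains S' \<delta> \<rho> where "compact S'" "S \<subseteq> S'" "S' \<subseteq> U"
    "\<forall>n::nat. mollifier (\<delta> n) (\<rho> n)" "\<forall>n. \<delta> n > 0" "\<delta> \<longlonglongrightarrow> 0"
    "\<forall>n x. x \<notin> S' \<longrightarrow> convolution \<eta> (\<rho> n) x = 0"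
    "\<forall>n. convolution \<eta> (\<rho> n) \<in> test_functions U"
proof -
  obtain e where e: "e > 0" "(\<Union>x\<in>S. cball x e) \<subseteq> U"
    using compact_subset_open_imp_cball_epsilon_subset[OF assms(2,4,5)] .
  define S' where "S' = (\<Union>x\<in>S. cball x e)"
  have S': "compact S'" unfolding S'_def by (rule compact_minkowski_sum_cball[OF assms(2)])
  define \<delta> where "\<delta> n = e / real (Suc n)" for n
  have \<delta>: "\<delta> n > 0" "\<delta> n \<le> e" for n
    using e by (auto simp: \<delta>_def field_simps)
  have "\<exists>\<rho> :: 'a \<Rightarrow> real. mollifier (\<delta> n) \<rho>" for n
    by (rule mollifier_exists[OF \<delta>(1)])
  then obtain \<rho> :: "nat \<Rightarrow> 'a \<Rightarrow> real" where \<rho>: "\<And>n. mollifier (\<delta> n) (\<rho> n)" by metis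
  have lim: "\<delta> \<longlonglongrightarrow> 0"
    using tendsto_mult_left[OF LIMSEQ_inverse_real_of_nat, of e] by (simp add: \<delta>_def[abs_def] divide_inverse)
  have z: "convolution \<eta> (\<rho> n) x = 0" if "x \<notin> S'" for n x
    using convolution_eq_0[OF \<rho> assms(3) _ \<delta>(2)] that by (simp add: S'_def)
  have "support (convolution \<eta> (\<rho> n)) \<subseteq> S'" for n
    unfolding support_def using z by (intro closure_minimal compact_imp_closed[OF S']) auto
  moreover from this have "compact (support (convolution \<eta> (\<rho> n)))" for n
    by (metis S' compact_Int_closed inf.absorb_iff2 closed_closure support_def)
  moreover have "S' \<subseteq> U" using e(2) by (simp add: S'_def)
  ultimately have t: "convolution \<eta> (\<rho> n) \<in> test_functions U" for n
    using \<rho>[of n] Ck_convolution[OF assms(1,2,3)]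
    by (auto simp: test_functions_def mollifier_def)
  show thesis
  proof (rule that[of S' \<delta> \<rho>])
    show "S \<subseteq> S'" using e(1) by (force simp: S'_def)
    show "S' \<subseteq> U" using e(2) by (simp add: S'_def)
  qed (use S' \<rho> \<delta>(1) lim z t in auto)
qed

section \<open>Gradients of Lipschitz functions integrate to zero\<close>

lemma GDERIV_difference_quotient:
  assumes "GDERIV f x :> D"
  shows "(\<lambda>n. real (Suc n) * (f (x + inverse (real (Suc n)) *\<^sub>R b) - f x)) \<longlonglongrightarrow> D \<bullet> b"
proof -
  have "((\<lambda>t. f (x + t *\<^sub>R b)) has_derivative (\<lambda>t. (t *\<^sub>R b) \<bullet> D)) (at 0)"
    using assms unfolding gderiv_def
    by (intro has_derivative_compose[of "\<lambda>t. x + t *\<^sub>R b" "\<lambda>t. t *\<^sub>R b" 0 UNIV f "\<lambda>h. h \<bullet> D"])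
       (auto intro!: derivative_eq_intros)
  then have "((\<lambda>t. f (x + t *\<^sub>R b)) has_field_derivative (D \<bullet> b)) (at 0)"
    by (simp add: has_field_derivative_def inner_commute mult_commute_abs)
  then have "((\<lambda>h. (f (x + h *\<^sub>R b) - f x) / h) \<longlongrightarrow> D \<bullet> b) (at 0)"
    by (simp add: DERIV_def)
  moreover have "filterlim (\<lambda>n. inverse (real (Suc n))) (at 0) sequentially"
    using LIMSEQ_inverse_real_of_nat by (auto simp: filterlim_at)
  ultimately have "(\<lambda>n. (f (x + inverse (real (Suc n)) *\<^sub>R b) - f x) / inverse (real (Suc n))) \<longlonglongrightarrow> D \<bullet> b"
    by (rule filterlim_compose)
  then show ?thesis by (simp add: mult.commute divide_inverse del: of_nat_Suc)
qed

lemma lipschitz_difference_quotient_bound: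
  fixes f :: "'a::euclidean_space \<Rightarrow> real"
  assumes "L-lipschitz_on UNIV f"
  shows "\<bar>real (Suc n) * (f (x + inverse (real (Suc n)) *\<^sub>R b) - f x)\<bar> \<le> L * norm b"
proof -
  have "\<bar>f (x + inverse (real (Suc n)) *\<^sub>R b) - f x\<bar> \<le> L * (inverse (real (Suc n)) * norm b)"
    using lipschitz_onD[OF assms, of "x + inverse (real (Suc n)) *\<^sub>R b" x] by (simp add: dist_norm)
  then have "real (Suc n) * \<bar>f (x + inverse (real (Suc n)) *\<^sub>R b) - f x\<bar> \<le>
      real (Suc n) * (L * (inverse (real (Suc n)) * norm b))"
    by (intro mult_left_mono) auto
  also have "\<dots> = L * norm b" by simp
  finally show ?thesis by (simp add: abs_mult)
qed

text \<open>The derivative in the direction of the gradient itself is the squared norm of the gradient.\<close>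

lemma GDERIV_lipschitz_bound:
  fixes f :: "'a::euclidean_space \<Rightarrow> real"
  assumes "L-lipschitz_on UNIV f" "GDERIV f x :> D"
  shows "norm D \<le> L"
proof -
  have "(\<lambda>n. \<bar>real (Suc n) * (f (x + inverse (real (Suc n)) *\<^sub>R D) - f x)\<bar>) \<longlonglongrightarrow> \<bar>D \<bullet> D\<bar>"
    by (intro tendsto_rabs GDERIV_difference_quotient[OF assms(2)])
  then have "\<bar>D \<bullet> D\<bar> \<le> L * norm D"
    by (rule LIMSEQ_le_const2) (use lipschitz_difference_quotient_bound[OF assms(1)] in auto)
  then have "norm D * norm D \<le> L * norm D"
    by (simp add: dot_square_norm power2_eq_square)
  moreover have "L \<ge> 0" using assms(1) lipschitz_on_nonneg by blast
  ultimately show ?thesis by (cases "D = 0") auto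
qed

lemma lborel_integral_translate:
  fixes f :: "'a::euclidean_space \<Rightarrow> 'b::{banach, second_countable_topology}"
  assumes [measurable]: "f \<in> borel_measurable borel"
  shows "(LINT y|lborel. f (y + c)) = (LINT y|lborel. f y)"
  by (subst lborel_distr_plus[of c, symmetric], subst integral_distr) (auto simp: add.commute)

lemma lborel_integrable_translate:
  fixes f :: "'a::euclidean_space \<Rightarrow> 'b::{banach, second_countable_topology}"
  assumes "integrable lborel f"
  shows "integrable lborel (\<lambda>y. f (y + c))"
proof -
  have [measurable]: "f \<in> borel_measurable borel" using assms by auto
  have "integrable (distr lborel borel ((+) c)) f"
    using assms by (simp add: lborel_distr_plus)
  then show ?thesis by (subst (asm) integrable_distr_eq) (auto simp: add.commute)
qed

text \<open>The integral of a difference quotient vanishes by translation invariance of Lebesgue measure. The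
quotients are bounded by the Lipschitz constant and supported in a fixed compact set, so dominated
convergence yields the claim. Applied to products this is integration by parts for Lipschitz
functions, without Fubini or the divergence theorem.\<close>

lemma integral_gradient_eq_0:
  fixes \<eta> :: "'a::euclidean_space \<Rightarrow> real"
  assumes lip: "L-lipschitz_on UNIV \<eta>" and S: "compact S" "\<And>x. x \<notin> S \<Longrightarrow> \<eta> x = 0"
    and D: "AE x in lborel. GDERIV \<eta> x :> D x" and [measurable]: "D \<in> borel_measurable borel"
  shows "integrable lborel D" "(LINT x|lborel. D x) = 0"
proof -
  have cont: "continuous_on UNIV \<eta>" by (rule lipschitz_on_continuous_on[OF lip])
  have [measurable]: "\<eta> \<in> borel_measurable borel"
    by (rule borel_measurable_continuous_onI[OF cont])
  have i\<eta>: "integrable lborel \<eta>" by (rule integrable_continuous_compact_support[OF cont S])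
  have L: "L \<ge> 0" using lip lipschitz_on_nonneg by blast
  \<comment> \<open>All difference quotients in direction b vanish outside this enlargement of S, as no step is longer than b.\<close>
  define K where "K b = (\<Union>x\<in>S. cball x (norm b))" for b :: 'a
  have K: "compact (K b)" for b unfolding K_def by (rule compact_minkowski_sum_cball[OF S(1)])
  have SK: "S \<subseteq> K b" for b unfolding K_def by force
  define s where "s b n x = real (Suc n) * (\<eta> (x + inverse (real (Suc n)) *\<^sub>R b) - \<eta> x)" for b n x
  have s0: "s b n x = 0" if "x \<notin> K b" for b n x
  proof -
    have "x + inverse (real (Suc n)) *\<^sub>R b \<notin> S"
    proof
      assume *: "x + inverse (real (Suc n)) *\<^sub>R b \<in> S"
      have "dist (x + inverse (real (Suc n)) *\<^sub>R b) x \<le> norm b"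
        using mult_right_mono[of "inverse (real (Suc n))" 1 "norm b"] by (simp add: dist_norm field_simps)
      then show False using * that unfolding K_def by auto
    qed
    moreover have "x \<notin> S" using that SK by blast
    ultimately show ?thesis using S(2) by (simp add: s_def)
  qed
  have ind: "integrable lborel (\<lambda>x. L * norm b * indicator (K b) x)" for b
    using K[of b] emeasure_compact_finite[OF K, of b]
    by (intro integrable_mult_right integrable_real_indicator) (auto simp: borel_compact less_top)
  have bound: "norm (s b n x) \<le> L * norm b * indicator (K b) x" for b n x
    using lipschitz_difference_quotient_bound[OF lip, of n x b] s0[of x b n]
    by (auto simp: s_def indicator_def)
  have int: "(LINT x|lborel. s b n x) = 0" for b n
  proof -
    have "integrable lborel (\<lambda>x. \<eta> (x + inverse (real (Suc n)) *\<^sub>R b))"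
      by (rule lborel_integrable_translate[OF i\<eta>])
    then show ?thesis
      unfolding s_def using i\<eta> lborel_integral_translate[of \<eta> "inverse (real (Suc n)) *\<^sub>R b"] by simp
  qed
  have lim: "AE x in lborel. (\<lambda>n. s b n x) \<longlonglongrightarrow> D x \<bullet> b" for b
    using D by eventually_elim (unfold s_def, rule GDERIV_difference_quotient)
  have "integrable lborel (\<lambda>x. D x \<bullet> b) \<and> (\<lambda>n. LINT x|lborel. s b n x) \<longlonglongrightarrow> (LINT x|lborel. D x \<bullet> b)" for b
  proof -
    have m: "s b n \<in> borel_measurable lborel" for n unfolding s_def[abs_def] by measurable
    show ?thesis
      by (intro conjI integrable_dominated_convergence[OF _ m ind lim AE_I2[OF bound]]
          integral_dominated_convergence[OF _ m ind lim AE_I2[OF bound]]) measurable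
  qed
  then have *: "integrable lborel (\<lambda>x. D x \<bullet> b)" "(LINT x|lborel. D x \<bullet> b) = 0" for b
    using int by (auto simp: LIMSEQ_const_iff)
  have "integrable lborel (\<lambda>x. \<Sum>b\<in>Basis. (D x \<bullet> b) *\<^sub>R b)"
    using * by auto
  then show i: "integrable lborel D" by (simp only: euclidean_representation)
  show "(LINT x|lborel. D x) = 0"
  proof (rule euclidean_eqI)
    fix b :: 'a
    show "(LINT x|lborel. D x) \<bullet> b = 0 \<bullet> b"
      using *(2)[of b] integral_inner_left[OF i, of b] by simp
  qed
qed

section \<open>Uniqueness of the weak gradient\<close>

text \<open>Functions on \<open>U\<close> are compared throughout by extending them by zero, so that all limits are
taken in one and the same measure space.\<close>

lemma integral_lebesgue_on_local:
  fixes h k :: "'a::euclidean_space \<Rightarrow> 'b::euclidean_space"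
  assumes "U \<in> sets lebesgue" "\<And>x. x \<in> U \<Longrightarrow> h x = k x" "\<And>x. x \<notin> U \<Longrightarrow> k x = 0"
  shows "(LINT x|lebesgue_on U. h x) = (LINT x|lebesgue. k x)"
proof -
  have "(\<lambda>x. indicator U x *\<^sub>R h x) = k"
    using assms(2,3) by (auto simp: indicator_def)
  then show ?thesis using assms(1) by (simp add: integral_restrict_space)
qed

lemma integrable_lebesgue_on_local:
  fixes h k :: "'a::euclidean_space \<Rightarrow> 'b::euclidean_space"
  assumes "U \<in> sets lebesgue" "\<And>x. x \<in> U \<Longrightarrow> h x = k x" "\<And>x. x \<notin> U \<Longrightarrow> k x = 0"
  shows "integrable (lebesgue_on U) h \<longleftrightarrow> integrable lebesgue k"
proof -
  have "(\<lambda>x. indicator U x *\<^sub>R h x) = k"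
    using assms(2,3) by (auto simp: indicator_def)
  then show ?thesis using assms(1) by (simp add: integrable_restrict_space)
qed

text \<open>Two forms of dominated convergence against a fixed integrable factor: scalar functions times a
vector field, and a scalar function times vector fields.\<close>

lemma tendsto_integral_bounded_convergence_scaleR:
  fixes F :: "'a::euclidean_space \<Rightarrow> 'b::euclidean_space"
  assumes F: "integrable lebesgue F" and m: "\<And>n. d n \<in> borel_measurable lebesgue" "D \<in> borel_measurable lebesgue"
    and b: "\<And>n x. \<bar>d n x\<bar> \<le> C" and l: "AE x in lebesgue. (\<lambda>n. d n x) \<longlonglongrightarrow> D x"
  shows "(\<lambda>n. LINT x|lebesgue. d n x *\<^sub>R F x) \<longlonglongrightarrow> (LINT x|lebesgue. D x *\<^sub>R F x)"
proof (rule integral_dominated_convergence)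
  show "integrable lebesgue (\<lambda>x. C * norm (F x))" using F by auto
  show "AE x in lebesgue. norm (d n x *\<^sub>R F x) \<le> C * norm (F x)" for n
    using b[of n] by (auto intro!: mult_right_mono)
  show "AE x in lebesgue. (\<lambda>n. d n x *\<^sub>R F x) \<longlonglongrightarrow> D x *\<^sub>R F x"
    using l by eventually_elim (intro tendsto_intros)
qed (use F m in auto)

lemma tendsto_integral_bounded_convergence_scaleR_right:
  fixes F :: "'a::euclidean_space \<Rightarrow> real" and D :: "'a \<Rightarrow> 'b::euclidean_space"
  assumes F: "integrable lebesgue F" and m: "\<And>n. d n \<in> borel_measurable lebesgue" "D \<in> borel_measurable lebesgue"
    and b: "\<And>n x. norm (d n x) \<le> C" and l: "AE x in lebesgue. (\<lambda>n. d n x) \<longlonglongrightarrow> D x"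
  shows "(\<lambda>n. LINT x|lebesgue. F x *\<^sub>R d n x) \<longlonglongrightarrow> (LINT x|lebesgue. F x *\<^sub>R D x)"
proof (rule integral_dominated_convergence)
  show "integrable lebesgue (\<lambda>x. C * norm (F x))" using F by auto
  show "AE x in lebesgue. norm (F x *\<^sub>R d n x) \<le> C * norm (F x)" for n
    using b[of n] by (intro AE_I2) (simp add: mult.commute[of C] mult_left_mono)
  show "AE x in lebesgue. (\<lambda>n. F x *\<^sub>R d n x) \<longlonglongrightarrow> F x *\<^sub>R D x"
    using l by eventually_elim (intro tendsto_intros)
qed (use F m in auto)

lemma test_function_props:
  assumes "\<phi> \<in> test_functions U"
  shows "continuous_on UNIV \<phi>" "\<exists>D. (\<forall>x. GDERIV \<phi> x :> D x) \<and> continuous_on UNIV D"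
    "compact (support \<phi>)" "support \<phi> \<subseteq> U" "\<And>x. x \<notin> support \<phi> \<Longrightarrow> \<phi> x = 0"
proof -
  have C: "Ck (Suc 0) \<phi>" using assms unfolding test_functions_def by blast
  show "continuous_on UNIV \<phi>" by (rule Ck_imp_continuous[OF C])
  show "\<exists>D. (\<forall>x. GDERIV \<phi> x :> D x) \<and> continuous_on UNIV D"
    using C by (auto intro: continuous_on_from_components)
  show "compact (support \<phi>)" "support \<phi> \<subseteq> U" "\<And>x. x \<notin> support \<phi> \<Longrightarrow> \<phi> x = 0"
    using assms by (auto simp: test_functions_def support_def intro: closure_subset[THEN subsetD])
qed

lemma GDERIV_eq_0_open:
  assumes "GDERIV f x :> D" "open S" "x \<in> S" "\<And>y. y \<in> S \<Longrightarrow> f y = 0"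
  shows "D = 0"
  using GDERIV_unique[OF GDERIV_transform_open[OF assms(1-3)] GDERIV_const[of 0]] assms(4) by simp

lemma integrable_indicator_scaleR_compact:
  fixes f :: "'a::euclidean_space \<Rightarrow> 'b::euclidean_space"
  assumes "f absolutely_integrable_on K"
  shows "integrable lebesgue (\<lambda>x. indicator K x *\<^sub>R f x)"
  using assms by (simp add: set_integrable_def)

text \<open>For a Lipschitz function the mollifications converge uniformly, hence are uniformly
bounded.\<close>

lemma lipschitz_mollifying_sequence:
  fixes \<eta> :: "'a::euclidean_space \<Rightarrow> real"
  assumes U: "open U" and \<eta>: "L-lipschitz_on UNIV \<eta>" "compact S" "\<And>x. x \<notin> S \<Longrightarrow> \<eta> x = 0" "S \<subseteq> U"
  obtains S' \<delta> \<rho> C where "compact S'" "S \<subseteq> S'" "S' \<subseteq> U"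
    "\<forall>n::nat. mollifier (\<delta> n) (\<rho> n)" "\<delta> \<longlonglongrightarrow> 0"
    "\<forall>n x. x \<notin> S' \<longrightarrow> convolution \<eta> (\<rho> n) x = 0"
    "\<forall>n. convolution \<eta> (\<rho> n) \<in> test_functions U"
    "\<forall>n x. \<bar>convolution \<eta> (\<rho> n) x\<bar> \<le> C"
    "\<forall>x. (\<lambda>n. convolution \<eta> (\<rho> n) x) \<longlonglongrightarrow> \<eta> x"
proof -
  have c\<eta>: "continuous_on UNIV \<eta>" by (rule lipschitz_on_continuous_on[OF \<eta>(1)])
  obtain S' \<delta> \<rho> where S': "compact S'" "S \<subseteq> S'" "S' \<subseteq> U"
    and \<rho>': "\<forall>n::nat. mollifier (\<delta> n) (\<rho> n)" "\<forall>n. \<delta> n > 0" and lim: "\<delta> \<longlonglongrightarrow> 0"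
    and z: "\<forall>n x. x \<notin> S' \<longrightarrow> convolution \<eta> (\<rho> n) x = 0"
    and t: "\<forall>n. convolution \<eta> (\<rho> n) \<in> test_functions U"
    by (rule mollifying_sequence[OF c\<eta> \<eta>(2,3) U \<eta>(4)])
  have \<rho>: "\<And>n. mollifier (\<delta> n) (\<rho> n)" "\<And>n. \<delta> n > 0"
    using \<rho>' by auto
  have cl: "\<bar>convolution \<eta> (\<rho> n) x - \<eta> x\<bar> \<le> L * \<delta> n" for n x
    by (rule convolution_close[OF \<rho>(1) \<eta>(1) \<rho>(2)])
  have "bounded (\<eta> ` S)"
    by (rule compact_imp_bounded[OF compact_continuous_image[OF continuous_on_subset[OF c\<eta>] \<eta>(2)]]) simp
  then obtain B where B: "\<And>x. x \<in> S \<Longrightarrow> \<bar>\<eta> x\<bar> \<le> B" by (auto simp: bounded_iff)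
  have "Bseq \<delta>" by (rule convergent_imp_Bseq[OF convergentI[OF lim]])
  then obtain B' where B': "\<And>n. norm (\<delta> n) \<le> B'" by (auto simp: Bseq_def)
  have L: "L \<ge> 0" using \<eta>(1) lipschitz_on_nonneg by blast
  have bE: "\<bar>convolution \<eta> (\<rho> n) x\<bar> \<le> max B 0 + L * B'" for n x
  proof -
    have "\<bar>\<eta> x\<bar> \<le> max B 0" using B[of x] \<eta>(3)[of x] by (cases "x \<in> S") (auto simp: max_def)
    moreover have "L * \<delta> n \<le> L * B'" using B'[of n] L by (intro mult_left_mono) auto
    ultimately show ?thesis using cl[of n x] by linarith
  qed
  have lE: "(\<lambda>n. convolution \<eta> (\<rho> n) x) \<longlonglongrightarrow> \<eta> x" for x
  proof (rule LIM_zero_cancel, rule Lim_null_comparison)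
    show "\<forall>\<^sub>F n in sequentially. norm (convolution \<eta> (\<rho> n) x - \<eta> x) \<le> L * \<delta> n" using cl by auto
    show "(\<lambda>n. L * \<delta> n) \<longlonglongrightarrow> 0" using tendsto_mult_left[OF lim, of L] by simp
  qed
  show thesis
    by (rule that[OF S' \<rho>'(1) lim z t, of "max B 0 + L * B'"]) (use bE lE in auto)
qed

text \<open>The two right-hand sides of the defining identity agree for every smooth test function, hence for
every Lipschitz function with compact support, the bounded limit of its mollifications.\<close>

lemma weak_gradient_difference_lipschitz:
  fixes \<eta> :: "'a::euclidean_space \<Rightarrow> real"
  assumes U: "open U" and g: "has_weak_gradient U f g1" "has_weak_gradient U f g2"
    and \<eta>: "L-lipschitz_on UNIV \<eta>" "compact S" "\<And>x. x \<notin> S \<Longrightarrow> \<eta> x = 0" "S \<subseteq> U"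
  shows "(LINT x|lebesgue. \<eta> x *\<^sub>R (indicator S x *\<^sub>R (g1 x - g2 x))) = 0"
proof -
  obtain S' \<delta> \<rho> C where S': "compact S'" "S \<subseteq> S'" "S' \<subseteq> U"
    and "\<forall>n::nat. mollifier (\<delta> n) (\<rho> n)" "\<delta> \<longlonglongrightarrow> 0"
    and z': "\<forall>n x. x \<notin> S' \<longrightarrow> convolution \<eta> (\<rho> n) x = 0"
    and t': "\<forall>n. convolution \<eta> (\<rho> n) \<in> test_functions U"
    and b': "\<forall>n x. \<bar>convolution \<eta> (\<rho> n) x\<bar> \<le> C"
    and l': "\<forall>x. (\<lambda>n. convolution \<eta> (\<rho> n) x) \<longlonglongrightarrow> \<eta> x"
    by (rule lipschitz_mollifying_sequence[OF U \<eta>])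
  define E where "E n = convolution \<eta> (\<rho> n)" for n
  have z: "\<And>n x. x \<notin> S' \<Longrightarrow> E n x = 0" and t: "\<And>n. E n \<in> test_functions U"
    and bE: "\<And>n x. \<bar>E n x\<bar> \<le> C" and lE: "\<And>x. (\<lambda>n. E n x) \<longlonglongrightarrow> \<eta> x"
    using z' t' b' l' by (auto simp: E_def)
  have Ul: "U \<in> sets lebesgue" using U by (simp add: borel_open)
  have a: "g1 absolutely_integrable_on S'" "g2 absolutely_integrable_on S'"
    using g S' unfolding has_weak_gradient_def by blast+
  define d where "d x = indicator S' x *\<^sub>R (g1 x - g2 x)" for x
  have di: "integrable lebesgue d"
    unfolding d_def scaleR_diff_right using a by (auto intro: integrable_indicator_scaleR_compact)
  have mE: "E n \<in> borel_measurable lebesgue" for n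
    using borel_measurable_continuous_onI[OF test_function_props(1)[OF t]] by (simp add: measurable_completion)
  have 0: "(LINT x|lebesgue. E n x *\<^sub>R d x) = 0" for n
  proof -
    obtain D where D: "\<forall>x. GDERIV (E n) x :> D x" using test_function_props(2)[OF t] by auto
    have eq: "(LINT x|lebesgue_on U. E n x *\<^sub>R g1 x) = (LINT x|lebesgue_on U. E n x *\<^sub>R g2 x)"
    proof -
      have "(LINT x|lebesgue_on U. f x *\<^sub>R D x) = - (LINT x|lebesgue_on U. E n x *\<^sub>R g x)"
        if "has_weak_gradient U f g" for g
        using that t[of n] D unfolding has_weak_gradient_def by blast
      from this[OF g(1)] this[OF g(2)] show ?thesis by simp
    qed
    have *: "(LINT x|lebesgue_on U. E n x *\<^sub>R g x) = (LINT x|lebesgue. E n x *\<^sub>R (indicator S' x *\<^sub>R g x))" for g :: "'a \<Rightarrow> 'a"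
      using z S' by (intro integral_lebesgue_on_local[OF Ul]) (auto simp: indicator_def)
    have i: "integrable lebesgue (\<lambda>x. E n x *\<^sub>R (indicator S' x *\<^sub>R g x))" if "g absolutely_integrable_on S'" for g :: "'a \<Rightarrow> 'a"
    proof (rule Bochner_Integration.integrable_bound)
      show "integrable lebesgue (\<lambda>x. C *\<^sub>R (indicator S' x *\<^sub>R g x))"
        by (intro integrable_scaleR_right integrable_indicator_scaleR_compact[OF that])
      show "(\<lambda>x. E n x *\<^sub>R indicator S' x *\<^sub>R g x) \<in> borel_measurable lebesgue"
        using integrable_indicator_scaleR_compact[OF that] by (intro borel_measurable_scaleR[OF mE borel_measurable_integrable])
      show "AE x in lebesgue. norm (E n x *\<^sub>R indicator S' x *\<^sub>R g x) \<le> norm (C *\<^sub>R indicator S' x *\<^sub>R g x)"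
        using order_trans[OF bE abs_ge_self] unfolding norm_scaleR by (intro AE_I2 mult_right_mono) auto
    qed
    show ?thesis
      using eq unfolding * d_def scaleR_diff_right using i a by simp
  qed
  have "(\<lambda>n. LINT x|lebesgue. E n x *\<^sub>R d x) \<longlonglongrightarrow> (LINT x|lebesgue. \<eta> x *\<^sub>R d x)"
    by (rule tendsto_integral_bounded_convergence_scaleR[OF di mE _ bE])
       (use lE borel_measurable_continuous_onI[OF lipschitz_on_continuous_on[OF \<eta>(1)]] in \<open>auto simp: measurable_completion\<close>)
  then have "(LINT x|lebesgue. \<eta> x *\<^sub>R d x) = 0" using 0 by (simp add: LIMSEQ_const_iff)
  moreover have "\<eta> x *\<^sub>R d x = \<eta> x *\<^sub>R (indicator S x *\<^sub>R (g1 x - g2 x))" for x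
    using \<eta>(3)[of x] S'(2) by (cases "x \<in> S") (auto simp: d_def indicator_def)
  ultimately show ?thesis by simp
qed

text \<open>The indicator function of a compact set is the bounded limit of Lipschitz functions of the distance
to the set.\<close>

lemma weak_gradient_difference_compact:
  fixes f :: "'a::euclidean_space \<Rightarrow> real"
  assumes U: "open U" and g: "has_weak_gradient U f g1" "has_weak_gradient U f g2"
    and K: "compact K" "K \<subseteq> U"
  shows "(LINT x|lebesgue. indicator K x *\<^sub>R (g1 x - g2 x)) = 0"
proof (cases "K = {}")
  case False
  obtain e where e: "e > 0" "(\<Union>x\<in>K. cball x e) \<subseteq> U"
    using compact_subset_open_imp_cball_epsilon_subset[OF K(1) U K(2)] .
  define S where "S = (\<Union>x\<in>K. cball x e)"
  have S: "compact S" unfolding S_def by (rule compact_minkowski_sum_cball[OF K(1)])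
  have KS: "K \<subseteq> S" using e(1) by (force simp: S_def)
  have SU: "S \<subseteq> U" using e(2) by (simp add: S_def)
  define \<eta> where "\<eta> m x = max 0 (1 - (real (Suc m) / e) * infdist x K)" for m x
  have lip: "(real (Suc m) / e)-lipschitz_on UNIV (\<eta> m)" for m
  proof (rule lipschitz_onI)
    fix x y :: 'a
    have "dist (\<eta> m x) (\<eta> m y) \<le> \<bar>(real (Suc m) / e) * infdist y K - (real (Suc m) / e) * infdist x K\<bar>"
      unfolding \<eta>_def dist_real_def by linarith
    also have "\<dots> = (real (Suc m) / e) * \<bar>infdist y K - infdist x K\<bar>"
      using e(1) by (simp only: right_diff_distrib[symmetric] abs_mult) simp
    also have "\<dots> \<le> (real (Suc m) / e) * dist x y"
      using infdist_triangle_abs[of y K x] e(1) by (intro mult_left_mono) (auto simp: dist_commute)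
    finally show "dist (\<eta> m x) (\<eta> m y) \<le> (real (Suc m) / e) * dist x y" .
  qed (use e(1) in auto)
  have zero: "\<eta> m x = 0" if "x \<notin> S" for m x
  proof -
    obtain y where y: "y \<in> K" "infdist x K = dist x y"
      using infdist_attains_inf[OF compact_imp_closed[OF K(1)] False] by blast
    then have "infdist x K > e" using that by (auto simp: S_def dist_commute)
    then have "1 \<le> (real (Suc m) / e) * infdist x K"
      using e(1) mult_mono[of 1 "real (Suc m)" e "infdist x K"] by (simp add: field_simps)
    then show ?thesis by (simp add: \<eta>_def)
  qed
  have b: "\<bar>\<eta> m x\<bar> \<le> 1" for m x
    using e(1) infdist_nonneg[of x K] by (auto simp: \<eta>_def)
  have lim: "(\<lambda>m. \<eta> m x) \<longlonglongrightarrow> indicator K x" for x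
  proof (cases "x \<in> K")
    case True
    then show ?thesis by (simp add: \<eta>_def)
  next
    case out: False
    then have pos: "infdist x K > 0"
      using in_closed_iff_infdist_zero[OF compact_imp_closed[OF K(1)] False] infdist_nonneg[of x K]
      by (metis less_eq_real_def)
    have "filterlim (\<lambda>m. (infdist x K / e) * real (Suc m)) at_top sequentially"
      using pos e(1) by (intro filterlim_tendsto_pos_mult_at_top[OF tendsto_const])
        (auto intro: filterlim_compose[OF filterlim_real_sequentially filterlim_Suc] simp del: of_nat_Suc)
    then have "\<forall>\<^sub>F m in sequentially. 1 \<le> (infdist x K / e) * real (Suc m)"
      by (simp add: filterlim_at_top)
    then have "\<forall>\<^sub>F m in sequentially. \<eta> m x = indicator K x"
      by eventually_elim (use out in \<open>simp add: \<eta>_def mult.commute\<close>)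
    then show ?thesis by (rule tendsto_eventually)
  qed
  define d where "d x = indicator S x *\<^sub>R (g1 x - g2 x)" for x
  have a: "g1 absolutely_integrable_on S" "g2 absolutely_integrable_on S"
    using g S SU unfolding has_weak_gradient_def by blast+
  have di: "integrable lebesgue d"
    unfolding d_def scaleR_diff_right using a by (auto intro: integrable_indicator_scaleR_compact)
  have m\<eta>: "\<eta> m \<in> borel_measurable lebesgue" for m
    using borel_measurable_continuous_onI[OF lipschitz_on_continuous_on[OF lip]] by (simp add: measurable_completion)
  have "(\<lambda>m. LINT x|lebesgue. \<eta> m x *\<^sub>R d x) \<longlonglongrightarrow> (LINT x|lebesgue. indicator K x *\<^sub>R d x)"
    by (rule tendsto_integral_bounded_convergence_scaleR[OF di m\<eta> _ b AE_I2[OF lim]])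
       (use K in \<open>simp add: borel_compact borel_measurable_indicator\<close>)
  moreover have "(LINT x|lebesgue. \<eta> m x *\<^sub>R d x) = 0" for m
    unfolding d_def by (rule weak_gradient_difference_lipschitz[OF U g lip S zero SU])
  moreover have "indicator K x *\<^sub>R d x = indicator K x *\<^sub>R (g1 x - g2 x)" for x
    using KS by (auto simp: d_def indicator_def)
  ultimately show ?thesis by (simp add: LIMSEQ_const_iff)
qed simp

text \<open>The set where \<open>h\<close> is positive is, up to a null set, a countable union of compact sets. The
integral of \<open>h\<close> over each of them is zero although \<open>h\<close> is positive there, so each is a null set.\<close>

lemma positive_part_null:
  fixes h :: "'a::euclidean_space \<Rightarrow> real"
  assumes h: "integrable lebesgue h" and "compact K0" "\<And>x. x \<notin> K0 \<Longrightarrow> h x = 0"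
    and zero: "\<And>K. compact K \<Longrightarrow> K \<subseteq> K0 \<Longrightarrow> (LINT x|lebesgue. indicator K x * h x) = 0"
  shows "AE x in lebesgue. h x \<le> 0"
proof -
  define A where "A = {x. h x > 0}"
  have "A \<in> sets lebesgue"
    using borel_measurable_integrable[OF h] unfolding A_def borel_measurable_iff_greater by simp
  then obtain C T where CT: "fsigma C" "T \<in> null_sets lebesgue" "C \<union> T = A"
    by (rule lebesgue_set_almost_fsigma)
  obtain F :: "nat \<Rightarrow> 'a set" where F: "\<And>n. closed (F n)" "C = (\<Union>n. F n)"
    using CT(1) by (auto elim: fsigma.cases)
  have "F n \<in> null_sets lebesgue" for n
  proof -
    have FA: "F n \<subseteq> A" using F CT by auto
    then have FK: "F n \<subseteq> K0" using assms(3) by (force simp: A_def)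
    then have c: "compact (F n)"
      using assms(2) F(1) compact_Int_closed[of K0 "F n"] by (simp add: inf.absorb2)
    have i: "integrable lebesgue (\<lambda>x. indicator (F n) x * h x)"
      using integrable_mult_indicator[OF _ h, of "F n"] F(1) by (simp add: borel_closed)
    have "AE x in lebesgue. indicator (F n) x * h x = 0"
      using integral_nonneg_eq_0_iff_AE[OF i] zero[OF c FK] FA by (auto simp: A_def indicator_def less_imp_le subset_iff)
    then have "AE x in lebesgue. x \<notin> F n"
      by eventually_elim (use FA in \<open>auto simp: A_def\<close>)
    then show ?thesis
      using F(1) by (subst AE_iff_null_sets) (auto simp: borel_closed)
  qed
  then have "C \<in> null_sets lebesgue" unfolding F(2) by (rule null_sets_UN)
  then have "A \<in> null_sets lebesgue" using CT by auto
  then have "AE x in lebesgue. x \<notin> A" by (rule AE_not_in)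
  then show ?thesis by eventually_elim (auto simp: A_def)
qed

text \<open>The fundamental lemma of the calculus of variations: the difference of two weak gradients integrates
to zero over all compact sets, and therefore each of its components has neither a positive nor
a negative part.\<close>

theorem weak_gradient_unique:
  fixes f :: "'a::euclidean_space \<Rightarrow> real"
  assumes U: "open U" and g: "has_weak_gradient U f g1" "has_weak_gradient U f g2"
  shows "AE x in lebesgue_on U. g1 x = g2 x"
proof -
  obtain C where C: "\<And>n::nat. compact (C n)" "\<And>n. C n \<subseteq> U" "\<Union>(range C) = U"
    by (rule open_Union_compact_subsets[OF U]) blast
  have "AE x in lebesgue. x \<in> K \<longrightarrow> g1 x = g2 x" if K: "compact K" "K \<subseteq> U" for K
  proof -
    define h where "h b x = indicator K x * ((g1 x - g2 x) \<bullet> b)" for b x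
    have a: "g1 absolutely_integrable_on K" "g2 absolutely_integrable_on K"
      using g K unfolding has_weak_gradient_def by blast+
    have di: "integrable lebesgue (\<lambda>x. indicator K x *\<^sub>R (g1 x - g2 x))"
      unfolding scaleR_diff_right using a by (auto intro: integrable_indicator_scaleR_compact)
    have hi: "integrable lebesgue (h b)" for b
      using integrable_inner_left[OF di, of b] by (simp add: h_def[abs_def])
    have h0: "(LINT x|lebesgue. indicator K' x * h b x) = 0" if K': "compact K'" "K' \<subseteq> K" for K' b
    proof -
      have "K' \<subseteq> U" using that K by blast
      have a: "g1 absolutely_integrable_on K'" "g2 absolutely_integrable_on K'"
        using g K' \<open>K' \<subseteq> U\<close> unfolding has_weak_gradient_def by blast+
      have di: "integrable lebesgue (\<lambda>x. indicator K' x *\<^sub>R (g1 x - g2 x))"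
        unfolding scaleR_diff_right using a by (auto intro: integrable_indicator_scaleR_compact)
      have "indicator K' x * h b x = (indicator K' x *\<^sub>R (g1 x - g2 x)) \<bullet> b" for x
        using K' by (auto simp: h_def indicator_def)
      then have "(LINT x|lebesgue. indicator K' x * h b x) =
          (LINT x|lebesgue. (indicator K' x *\<^sub>R (g1 x - g2 x)) \<bullet> b)" by (simp only:)
      also have "\<dots> = (LINT x|lebesgue. (indicator K' x *\<^sub>R (g1 x - g2 x))) \<bullet> b"
        by (rule integral_inner_left[OF di])
      also have "\<dots> = 0"
        using weak_gradient_difference_compact[OF U g K'(1) \<open>K' \<subseteq> U\<close>] by simp
      finally show ?thesis .
    qed
    have le: "AE x in lebesgue. h b x \<le> 0" for b
      by (rule positive_part_null[OF hi K(1) _ h0]) (auto simp: h_def)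
    have "AE x in lebesgue. \<forall>b\<in>Basis. h b x = 0"
    proof (rule AE_finite_allI[OF finite_Basis])
      fix b :: 'a assume "b \<in> Basis"
      have "h (-b) x = - h b x" for x by (simp add: h_def)
      then show "AE x in lebesgue. h b x = 0"
        using le[of b] le[of "-b"] by auto
    qed
    then show ?thesis
      by eventually_elim (auto simp: h_def intro!: euclidean_eqI[where 'a='a] simp: inner_diff_left)
  qed
  then have "AE x in lebesgue. \<forall>n. x \<in> C n \<longrightarrow> g1 x = g2 x"
    using C by (subst AE_all_countable) auto
  then have "AE x in lebesgue. x \<in> U \<longrightarrow> g1 x = g2 x"
    by eventually_elim (use C(3) in auto)
  then show ?thesis
    using U by (subst AE_restrict_space_iff) (auto simp: borel_open)
qed

section \<open>Lipschitz test functions\<close>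

text \<open>The class in which test functions are needed: globally Lipschitz, and continuously differentiable
off a closed null set \<open>N\<close>. Setting the gradient to zero on \<open>N\<close> makes it Borel measurable.\<close>

definition lipschitz_C1_off :: "'a::euclidean_space set \<Rightarrow> ('a \<Rightarrow> real) \<Rightarrow> ('a \<Rightarrow> 'a) \<Rightarrow> bool" where
  "lipschitz_C1_off N \<eta> D \<longleftrightarrow> closed N \<and> negligible N \<and> (\<exists>L. L-lipschitz_on UNIV \<eta>) \<and>
     (\<forall>x. x \<notin> N \<longrightarrow> GDERIV \<eta> x :> D x) \<and> continuous_on (-N) D \<and> (\<forall>x\<in>N. D x = 0)"

lemma lipschitz_C1_off_measurable:
  fixes \<eta> :: "'a::euclidean_space \<Rightarrow> real"
  assumes "lipschitz_C1_off N \<eta> D"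
  shows "D \<in> borel_measurable borel"
proof -
  have "(\<lambda>x. indicator (-N) x *\<^sub>R D x) \<in> borel_measurable borel"
    using assms by (intro borel_measurable_continuous_on_indicator) (auto simp: lipschitz_C1_off_def borel_open)
  moreover have "(\<lambda>x. indicator (-N) x *\<^sub>R D x) = D"
    using assms by (auto simp: lipschitz_C1_off_def indicator_def)
  ultimately show ?thesis by simp
qed

lemma lipschitz_C1_off_null: "lipschitz_C1_off N \<eta> D \<Longrightarrow> AE x in lborel. x \<notin> N"
  for N :: "'a::euclidean_space set"
  unfolding lipschitz_C1_off_def
  by (metis AE_completion_iff AE_not_in negligible_iff_null_sets)

lemma lipschitz_C1_off_bound:
  fixes \<eta> :: "'a::euclidean_space \<Rightarrow> real"
  assumes "lipschitz_C1_off N \<eta> D" "L-lipschitz_on UNIV \<eta>"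
  shows "norm (D x) \<le> L"
  using assms GDERIV_lipschitz_bound[OF assms(2), of x "D x"] lipschitz_on_nonneg[OF assms(2)]
  by (cases "x \<in> N") (auto simp: lipschitz_C1_off_def)

lemma lipschitz_C1_off_eq_0:
  assumes "lipschitz_C1_off N \<eta> D" "closed S" "\<And>y. y \<notin> S \<Longrightarrow> \<eta> y = 0" "x \<notin> S"
  shows "D x = 0"
proof (cases "x \<in> N")
  case False
  then show ?thesis
    using assms GDERIV_eq_0_open[of \<eta> x "D x" "-S"] by (auto simp: lipschitz_C1_off_def)
qed (use assms in \<open>auto simp: lipschitz_C1_off_def\<close>)

lemma lipschitz_on_mult_bounded:
  fixes f g :: "'a::metric_space \<Rightarrow> real"
  assumes "L-lipschitz_on X f" "L'-lipschitz_on X g" "\<And>x. x \<in> X \<Longrightarrow> \<bar>f x\<bar> \<le> B" "\<And>x. x \<in> X \<Longrightarrow> \<bar>g x\<bar> \<le> B'" "B \<ge> 0" "B' \<ge> 0"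
  shows "(B * L' + B' * L)-lipschitz_on X (\<lambda>x. f x * g x)"
proof (rule lipschitz_onI)
  have L: "L \<ge> 0" "L' \<ge> 0" using assms lipschitz_on_nonneg by blast+
  then show "B * L' + B' * L \<ge> 0" using assms by simp
  fix x y assume xy: "x \<in> X" "y \<in> X"
  have "dist (f x * g x) (f y * g y) = \<bar>f x * (g x - g y) + g y * (f x - f y)\<bar>"
    by (simp add: dist_real_def algebra_simps)
  also have "\<dots> \<le> \<bar>f x\<bar> * \<bar>g x - g y\<bar> + \<bar>g y\<bar> * \<bar>f x - f y\<bar>"
    by (metis abs_mult abs_triangle_ineq)
  also have "\<dots> \<le> B * (L' * dist x y) + B' * (L * dist x y)"
    using assms(3)[OF xy(1)] assms(4)[OF xy(2)] lipschitz_onD[OF assms(1) xy] lipschitz_onD[OF assms(2) xy] assms(5,6)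
    by (intro add_mono mult_mono) (auto simp: dist_real_def)
  finally show "dist (f x * g x) (f y * g y) \<le> (B * L' + B' * L) * dist x y"
    by (simp add: algebra_simps)
qed

lemma GDERIV_bounded_imp_lipschitz:
  fixes f :: "'a::euclidean_space \<Rightarrow> real"
  assumes "\<And>x. x \<in> X \<Longrightarrow> GDERIV f x :> D x" "convex X" "\<And>x. x \<in> X \<Longrightarrow> norm (D x) \<le> C" "C \<ge> 0"
  shows "C-lipschitz_on X f"
proof (rule bounded_derivative_imp_lipschitz[OF _ assms(2) _ assms(4)])
  show "(f has_derivative (\<lambda>h. h \<bullet> D x)) (at x within X)" if "x \<in> X" for x
    using assms(1)[OF that] unfolding gderiv_def by (rule has_derivative_at_withinI)
  show "onorm (\<lambda>h. h \<bullet> D x) \<le> C" if "x \<in> X" for x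
  proof (rule onorm_le)
    fix h :: 'a
    have "norm (h \<bullet> D x) \<le> norm h * norm (D x)" by (simp add: Cauchy_Schwarz_ineq2)
    also have "\<dots> \<le> C * norm h" using mult_left_mono[OF assms(3)[OF that], of "norm h"] by (simp add: mult.commute)
    finally show "norm (h \<bullet> D x) \<le> C * norm h" .
  qed
qed

lemma continuous_zero_outside_compact_bounded:
  fixes f :: "'a::metric_space \<Rightarrow> 'b::real_normed_vector"
  assumes "continuous_on UNIV f" "compact S" "\<And>x. x \<notin> S \<Longrightarrow> f x = 0"
  obtains B where "B \<ge> 0" "\<forall>x. norm (f x) \<le> B"
proof -
  have "bounded (f ` S)"
    by (rule compact_imp_bounded[OF compact_continuous_image[OF continuous_on_subset[OF assms(1)] assms(2)]]) simp
  then obtain B where "\<And>x. x \<in> S \<Longrightarrow> norm (f x) \<le> B" by (auto simp: bounded_iff)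
  then have "norm (f x) \<le> max B 0" for x
    using assms(3)[of x] max.coboundedI1[of "norm (f x)" B 0] by (cases "x \<in> S") auto
  then show thesis by (intro that[of "max B 0"]) auto
qed

lemma C1_compact_support_lipschitz:
  fixes f :: "'a::euclidean_space \<Rightarrow> real"
  assumes "\<And>x. GDERIV f x :> D x" "continuous_on UNIV D" "compact S" "\<And>x. x \<notin> S \<Longrightarrow> f x = 0"
  obtains L where "L-lipschitz_on UNIV f"
proof -
  have "D x = 0" if "x \<notin> S" for x
    by (rule GDERIV_eq_0_open[OF assms(1), of "-S"]) (use assms(3,4) that in \<open>auto simp: compact_imp_closed\<close>)
  then obtain B where "B \<ge> 0" "\<forall>x. norm (D x) \<le> B"
    by (rule continuous_zero_outside_compact_bounded[OF assms(2,3)])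
  then show thesis
    using GDERIV_bounded_imp_lipschitz[of UNIV f D B] assms(1) that by auto
qed

text \<open>Integration by parts moves the derivative from the mollifier to \<open>\<eta>\<close>. For fixed \<open>x\<close> the gradient of
\<open>y \<mapsto> \<eta> y * \<rho> (x - y)\<close> has integral zero, and the chain rule brings in a minus sign.\<close>

lemma gradient_of_convolution:
  fixes \<eta> :: "'a::euclidean_space \<Rightarrow> real"
  assumes \<eta>: "lipschitz_C1_off N \<eta> D" "compact S" "\<And>x. x \<notin> S \<Longrightarrow> \<eta> x = 0" and \<rho>: "mollifier \<delta> \<rho>"
  shows "GDERIV (convolution \<eta> \<rho>) x :> (LINT y|lborel. \<rho> (x - y) *\<^sub>R D y)"
proof -
  obtain L where L: "L-lipschitz_on UNIV \<eta>" using \<eta>(1) by (auto simp: lipschitz_C1_off_def)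
  have c\<eta>: "continuous_on UNIV \<eta>" by (rule lipschitz_on_continuous_on[OF L])
  have "Ck (Suc 0) \<rho>" using \<rho> unfolding mollifier_def by blast
  then obtain R where R: "\<And>x. GDERIV \<rho> x :> R x" "continuous_on UNIV R"
    by (auto intro: continuous_on_from_components)
  have c\<rho>: "continuous_on UNIV \<rho>" by (rule GDERIV_imp_continuous[OF R(1)])
  have z\<rho>: "\<rho> z = 0" if "z \<notin> cball 0 \<delta>" for z using \<rho> that by (simp add: mollifier_def)
  obtain L' where L': "L'-lipschitz_on UNIV \<rho>"
    by (rule C1_compact_support_lipschitz[OF R compact_cball z\<rho>])
  obtain B' where B': "B' \<ge> 0" "\<forall>x. norm (\<rho> x) \<le> B'"
    by (rule continuous_zero_outside_compact_bounded[OF c\<rho> compact_cball z\<rho>])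
  obtain B where B: "B \<ge> 0" "\<forall>x. norm (\<eta> x) \<le> B"
    by (rule continuous_zero_outside_compact_bounded[OF c\<eta> \<eta>(2,3)])
  have L'': "L'-lipschitz_on UNIV (\<lambda>y. \<rho> (x - y))"
    using L' by (intro lipschitz_onI) (auto dest!: lipschitz_onD[of L' _ _ "x - _" "x - _"] simp: dist_norm norm_minus_commute lipschitz_on_nonneg)
  define T where "T y = \<eta> y *\<^sub>R (- R (x - y)) + \<rho> (x - y) *\<^sub>R D y" for y
  have lip: "(B * L' + B' * L)-lipschitz_on UNIV (\<lambda>y. \<eta> y * \<rho> (x - y))"
    by (rule lipschitz_on_mult_bounded[OF L L'']) (use B B' in auto)
  have [measurable]: "D \<in> borel_measurable borel" by (rule lipschitz_C1_off_measurable[OF \<eta>(1)])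
  have [measurable]: "\<eta> \<in> borel_measurable borel" "\<rho> \<in> borel_measurable borel" "R \<in> borel_measurable borel"
    using borel_measurable_continuous_onI c\<eta> c\<rho> R(2) by auto
  have T: "AE y in lborel. GDERIV (\<lambda>y. \<eta> y * \<rho> (x - y)) y :> T y"
    using lipschitz_C1_off_null[OF \<eta>(1)]
  proof eventually_elim
    fix y assume "y \<notin> N"
    then have "GDERIV \<eta> y :> D y" using \<eta>(1) by (auto simp: lipschitz_C1_off_def)
    moreover have "GDERIV (\<lambda>y. \<rho> (x - y)) y :> - R (x - y)"
    proof -
      have "((\<lambda>y. \<rho> (x - y)) has_derivative (\<lambda>h. (- h) \<bullet> R (x - y))) (at y)"
        using R(1)[of "x - y"] unfolding gderiv_def
        by (intro has_derivative_compose[of "\<lambda>y. x - y" "\<lambda>h. - h" y UNIV \<rho> "\<lambda>h. h \<bullet> R (x - y)"])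
           (auto intro!: derivative_eq_intros)
      then show ?thesis by (simp add: gderiv_def)
    qed
    ultimately show "GDERIV (\<lambda>y. \<eta> y * \<rho> (x - y)) y :> T y"
      unfolding T_def by (rule GDERIV_mult)
  qed
  have Tm: "T \<in> borel_measurable borel" unfolding T_def[abs_def] by measurable
  have Ti: "integrable lborel T" and T0: "(LINT y|lborel. T y) = 0"
    by (rule integral_gradient_eq_0[OF lip \<eta>(2) _ T Tm]; simp add: \<eta>(3))+
  have "continuous_on UNIV (\<lambda>y. \<eta> y *\<^sub>R R (x - y))"
    by (intro continuous_intros continuous_on_compose2[OF c\<eta>] continuous_on_compose2[OF R(2)]) auto
  then have i: "integrable lborel (\<lambda>y. \<eta> y *\<^sub>R R (x - y))"
    by (rule integrable_continuous_compact_support[OF _ \<eta>(2)]) (simp add: \<eta>(3))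
  \<comment> \<open>T is a gradient with compact support and so contributes nothing to the integral.\<close>
  have eq: "(\<lambda>y. \<rho> (x - y) *\<^sub>R D y) = (\<lambda>y. T y + \<eta> y *\<^sub>R R (x - y))"
    by (simp add: T_def)
  have "(LINT y|lborel. \<rho> (x - y) *\<^sub>R D y) = (LINT y|lborel. \<eta> y *\<^sub>R R (x - y))"
    unfolding eq using Ti T0 i by simp
  then show ?thesis
    using GDERIV_convolution[OF c\<eta> \<eta>(2,3) R] by simp
qed

text \<open>By \<open>gradient_of_convolution\<close> the gradients of the mollifications are averages of \<open>D\<close>. They are
bounded by the Lipschitz constant and converge to \<open>D\<close> wherever \<open>D\<close> is continuous, that is, almost
everywhere, so the defining identity passes to the limit.\<close>

theorem weak_gradient_lipschitz_test:
  fixes \<eta> :: "'a::euclidean_space \<Rightarrow> real"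
  assumes U: "open U" and g: "has_weak_gradient U f g"
    and \<eta>: "lipschitz_C1_off N \<eta> D" "compact S" "\<And>x. x \<notin> S \<Longrightarrow> \<eta> x = 0" "S \<subseteq> U"
  shows "(LINT x|lebesgue_on U. f x *\<^sub>R D x) = - (LINT x|lebesgue_on U. \<eta> x *\<^sub>R g x)"
proof -
  obtain L where L: "L-lipschitz_on UNIV \<eta>" using \<eta>(1) by (auto simp: lipschitz_C1_off_def)
  obtain S' \<delta> \<rho> C where S': "compact S'" "S \<subseteq> S'" "S' \<subseteq> U"
    and \<rho>': "\<forall>n::nat. mollifier (\<delta> n) (\<rho> n)" and lim: "\<delta> \<longlonglongrightarrow> 0"
    and z': "\<forall>n x. x \<notin> S' \<longrightarrow> convolution \<eta> (\<rho> n) x = 0"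
    and t': "\<forall>n. convolution \<eta> (\<rho> n) \<in> test_functions U"
    and b': "\<forall>n x. \<bar>convolution \<eta> (\<rho> n) x\<bar> \<le> C"
    and l': "\<forall>x. (\<lambda>n. convolution \<eta> (\<rho> n) x) \<longlonglongrightarrow> \<eta> x"
    by (rule lipschitz_mollifying_sequence[OF U L \<eta>(2-4)])
  define E where "E n = convolution \<eta> (\<rho> n)" for n
  define G where "G n x = (LINT y|lborel. \<rho> n (x - y) *\<^sub>R D y)" for n x
  have z: "\<And>n x. x \<notin> S' \<Longrightarrow> E n x = 0" and t: "\<And>n. E n \<in> test_functions U"
    and bE: "\<And>n x. \<bar>E n x\<bar> \<le> C" and lE: "\<And>x. (\<lambda>n. E n x) \<longlonglongrightarrow> \<eta> x"
    using z' t' b' l' by (auto simp: E_def)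
  have \<rho>: "mollifier (\<delta> n) (\<rho> n)" for n using \<rho>' by simp
  have EG: "GDERIV (E n) x :> G n x" for n x
    unfolding E_def G_def by (rule gradient_of_convolution[OF \<eta>(1-3) \<rho>])
  have cG: "continuous_on UNIV (G n)" for n
  proof -
    obtain D' where D': "\<forall>x. GDERIV (E n) x :> D' x" "continuous_on UNIV D'"
      using test_function_props(2)[OF t] by blast
    have "G n = D'" using GDERIV_unique[OF EG] D'(1) by blast
    then show ?thesis using D'(2) by simp
  qed
  have Dm: "D \<in> borel_measurable borel" by (rule lipschitz_C1_off_measurable[OF \<eta>(1)])
  have bG: "norm (G n x) \<le> L" for n x
    using mollifier_average_close(2)[OF \<rho> Dm, of x n 0 L] lipschitz_C1_off_bound[OF \<eta>(1) L] lipschitz_on_nonneg[OF L]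
    by (simp add: G_def)
  have lG: "(\<lambda>n. G n x) \<longlonglongrightarrow> D x" if "x \<notin> N" for x
  proof (rule metric_LIMSEQ_I)
    fix r :: real assume r: "r > 0"
    have "open (-N)" "continuous_on (-N) D" using \<eta>(1) by (auto simp: lipschitz_C1_off_def)
    then have "isCont D x" using that by (simp add: continuous_on_eq_continuous_at)
    then obtain d where d: "d > 0" "\<And>y. dist y x < d \<Longrightarrow> dist (D y) (D x) < r / 2"
      unfolding continuous_at_eps_delta using r by (meson half_gt_zero)
    have "\<forall>\<^sub>F n in sequentially. \<delta> n < d" using lim d(1) by (rule order_tendstoD)
    then obtain M where M: "\<And>n. n \<ge> M \<Longrightarrow> \<delta> n < d" by (auto simp: eventually_sequentially)
    have "dist (G n x) (D x) < r" if "n \<ge> M" for n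
    proof -
      have "norm (D y - D x) \<le> r / 2" if "norm (x - y) < \<delta> n" for y
        using d(2)[of y] that M[OF \<open>n \<ge> M\<close>] by (simp add: dist_norm norm_minus_commute)
      then have "norm (G n x - D x) \<le> r / 2"
        unfolding G_def using r by (intro mollifier_average_close(2)[OF \<rho> Dm]) auto
      then show ?thesis using r by (simp add: dist_norm)
    qed
    then show "\<exists>M. \<forall>n\<ge>M. dist (G n x) (D x) < r" by blast
  qed
  have zG: "G n x = 0" if "x \<notin> S'" for n x
    by (rule GDERIV_eq_0_open[OF EG, of "-S'"]) (use S'(1) z that in \<open>auto simp: compact_imp_closed\<close>)
  have zD: "D x = 0" if "x \<notin> S'" for x
    using lipschitz_C1_off_eq_0[OF \<eta>(1) compact_imp_closed[OF \<eta>(2)] \<eta>(3)] that S'(2) by blast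
  have Ul: "U \<in> sets lebesgue" using U by (simp add: borel_open)
  have a: "f absolutely_integrable_on S'" "g absolutely_integrable_on S'"
    using g S' unfolding has_weak_gradient_def by blast+
  define F where "F x = indicator S' x *\<^sub>R f x" for x
  define H where "H x = indicator S' x *\<^sub>R g x" for x
  have Fi: "integrable lebesgue F" and Hi: "integrable lebesgue H"
    unfolding F_def[abs_def] H_def[abs_def] by (rule integrable_indicator_scaleR_compact[OF a(1)], rule integrable_indicator_scaleR_compact[OF a(2)])
  have mE: "E n \<in> borel_measurable lebesgue" for n
    using borel_measurable_continuous_onI[OF test_function_props(1)[OF t]] by (simp add: measurable_completion)
  have mG: "G n \<in> borel_measurable lebesgue" for n
    using borel_measurable_continuous_onI[OF cG] by (simp add: measurable_completion)
  have locf: "(LINT x|lebesgue_on U. f x *\<^sub>R h x) = (LINT x|lebesgue. F x *\<^sub>R h x)"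
    if "\<And>x. x \<notin> S' \<Longrightarrow> h x = 0" for h :: "'a \<Rightarrow> 'a"
    using that S' by (intro integral_lebesgue_on_local[OF Ul]) (auto simp: F_def indicator_def)
  have locg: "(LINT x|lebesgue_on U. h x *\<^sub>R g x) = (LINT x|lebesgue. h x *\<^sub>R H x)"
    if "\<And>x. x \<notin> S' \<Longrightarrow> h x = 0" for h :: "'a \<Rightarrow> real"
    using that S' by (intro integral_lebesgue_on_local[OF Ul]) (auto simp: H_def indicator_def)
  have eq: "(LINT x|lebesgue. F x *\<^sub>R G n x) = - (LINT x|lebesgue. E n x *\<^sub>R H x)" for n
  proof -
    have "(LINT x|lebesgue_on U. f x *\<^sub>R G n x) = - (LINT x|lebesgue_on U. E n x *\<^sub>R g x)"
      using g t[of n] EG[of n] unfolding has_weak_gradient_def by blast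
    then show ?thesis using locf[OF zG] locg[OF z] by simp
  qed
  have 1: "(\<lambda>n. LINT x|lebesgue. F x *\<^sub>R G n x) \<longlonglongrightarrow> (LINT x|lebesgue. F x *\<^sub>R D x)"
  proof (rule tendsto_integral_bounded_convergence_scaleR_right[OF Fi mG _ bG])
    show "D \<in> borel_measurable lebesgue" using Dm by (simp add: measurable_completion)
    have "AE x in lebesgue. x \<notin> N"
      using lipschitz_C1_off_null[OF \<eta>(1)] by (rule AE_completion)
    then show "AE x in lebesgue. (\<lambda>n. G n x) \<longlonglongrightarrow> D x"
      by eventually_elim (rule lG)
  qed
  have "(\<lambda>n. LINT x|lebesgue. E n x *\<^sub>R H x) \<longlonglongrightarrow> (LINT x|lebesgue. \<eta> x *\<^sub>R H x)"
    by (rule tendsto_integral_bounded_convergence_scaleR[OF Hi mE _ bE AE_I2[OF lE]])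
       (use borel_measurable_continuous_onI[OF lipschitz_on_continuous_on[OF L]] in \<open>simp add: measurable_completion\<close>)
  then have "(\<lambda>n. LINT x|lebesgue. F x *\<^sub>R G n x) \<longlonglongrightarrow> - (LINT x|lebesgue. \<eta> x *\<^sub>R H x)"
    unfolding eq by (rule tendsto_minus)
  with 1 have "(LINT x|lebesgue. F x *\<^sub>R D x) = - (LINT x|lebesgue. \<eta> x *\<^sub>R H x)"
    by (rule LIMSEQ_unique)
  moreover have "(LINT x|lebesgue_on U. \<eta> x *\<^sub>R g x) = (LINT x|lebesgue. \<eta> x *\<^sub>R H x)"
    using \<eta>(3) S'(2) by (intro locg) auto
  ultimately show ?thesis using locf[OF zD] by simp
qed

section \<open>Piecewise continuously differentiable functions on a tiling\<close>

text \<open>The value is meaningful at points of differentiability only.\<close>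

definition gradient :: "('a::euclidean_space \<Rightarrow> real) \<Rightarrow> 'a \<Rightarrow> 'a" where
  "gradient f x = (THE D. GDERIV f x :> D)"

lemma gradient_eq: "GDERIV f x :> D \<Longrightarrow> gradient f x = D"
  unfolding gradient_def using GDERIV_unique by blast

text \<open>On the closed piece \<open>K\<close>, \<open>f\<close> coincides with a function \<open>P\<close> that has a full derivative at every point of
\<open>K\<close>, including the boundary points. This one-sided notion applies to functions given by different formulas on
adjacent pieces, and it is stable under the operations that build the partition functions.\<close>

definition C1_piece :: "'a::euclidean_space set \<Rightarrow> ('a \<Rightarrow> real) \<Rightarrow> bool" where
  "C1_piece K f \<longleftrightarrow> (\<exists>P Q. (\<forall>x\<in>K. f x = P x \<and> GDERIV P x :> Q x) \<and> continuous_on K Q)"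

lemma C1_pieceI:
  assumes "\<And>x. x \<in> K \<Longrightarrow> f x = P x" "\<And>x. x \<in> K \<Longrightarrow> GDERIV P x :> Q x" "continuous_on K Q"
  shows "C1_piece K f"
  using assms unfolding C1_piece_def by blast

lemma C1_piece_continuous: "C1_piece K f \<Longrightarrow> continuous_on K f"
  unfolding C1_piece_def by (metis GDERIV_imp_continuous continuous_on_cong)

lemma C1_piece_const: "C1_piece K (\<lambda>x. c)"
  by (rule C1_pieceI[where P="\<lambda>x. c" and Q="\<lambda>x. 0"]) (auto simp del: gderiv_deriv intro: GDERIV_const)

lemma C1_piece_add:
  assumes "C1_piece K f" "C1_piece K g"
  shows "C1_piece K (\<lambda>x. f x + g x)"
proof -
  obtain P Q P' Q' where *: "\<And>x. x \<in> K \<Longrightarrow> f x = P x" "\<And>x. x \<in> K \<Longrightarrow> GDERIV P x :> Q x" "continuous_on K Q"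
    "\<And>x. x \<in> K \<Longrightarrow> g x = P' x" "\<And>x. x \<in> K \<Longrightarrow> GDERIV P' x :> Q' x" "continuous_on K Q'"
    using assms unfolding C1_piece_def by metis
  show ?thesis
    by (rule C1_pieceI[where P="\<lambda>x. P x + P' x" and Q="\<lambda>x. Q x + Q' x"])
       (use * in \<open>auto intro: GDERIV_add continuous_intros\<close>)
qed

lemma C1_piece_mult:
  assumes "C1_piece K f" "C1_piece K g"
  shows "C1_piece K (\<lambda>x. f x * g x)"
proof -
  obtain P Q P' Q' where *: "\<And>x. x \<in> K \<Longrightarrow> f x = P x" "\<And>x. x \<in> K \<Longrightarrow> GDERIV P x :> Q x" "continuous_on K Q"
    "\<And>x. x \<in> K \<Longrightarrow> g x = P' x" "\<And>x. x \<in> K \<Longrightarrow> GDERIV P' x :> Q' x" "continuous_on K Q'"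
    using assms unfolding C1_piece_def by metis
  have "continuous_on K P" "continuous_on K P'"
    using *(2,5) by (auto intro: GDERIV_imp_continuous)
  then have c: "continuous_on K (\<lambda>x. P x *\<^sub>R Q' x + P' x *\<^sub>R Q x)"
    using *(3,6) by (intro continuous_intros)
  show ?thesis
    by (rule C1_pieceI[OF _ _ c, where P="\<lambda>x. P x * P' x"]) (use * in \<open>auto intro: GDERIV_mult\<close>)
qed

lemma C1_piece_compose:
  assumes "C1_piece K f" and h: "\<And>x. x \<in> K \<Longrightarrow> DERIV h (f x) :> h' (f x)" "continuous_on (f ` K) h'"
  shows "C1_piece K (\<lambda>x. h (f x))"
proof -
  obtain P Q where *: "\<And>x. x \<in> K \<Longrightarrow> f x = P x" "\<And>x. x \<in> K \<Longrightarrow> GDERIV P x :> Q x" "continuous_on K Q"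
    using assms(1) unfolding C1_piece_def by metis
  have "continuous_on K (\<lambda>x. h' (f x))"
    by (rule continuous_on_compose2[OF h(2) C1_piece_continuous[OF assms(1)]]) auto
  then have "continuous_on K (\<lambda>x. h' (P x))"
    using *(1) by (simp cong: continuous_on_cong)
  then have c: "continuous_on K (\<lambda>x. h' (P x) *\<^sub>R Q x)"
    using *(3) by (intro continuous_intros)
  show ?thesis
  proof (rule C1_pieceI[OF _ _ c, where P="\<lambda>x. h (P x)"])
    fix x assume x: "x \<in> K"
    show "h (f x) = h (P x)" using *(1)[OF x] by simp
    show "GDERIV (\<lambda>x. h (P x)) x :> h' (P x) *\<^sub>R Q x"
      by (rule GDERIV_DERIV_compose[OF *(2)[OF x]]) (use h(1)[OF x] *(1)[OF x] in simp)
  qed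
qed

lemma C1_piece_divide:
  assumes "C1_piece K f" "C1_piece K g" "\<And>x. x \<in> K \<Longrightarrow> g x \<noteq> 0"
  shows "C1_piece K (\<lambda>x. f x / g x)"
proof -
  have "C1_piece K (\<lambda>x. inverse (g x))"
    by (rule C1_piece_compose[OF assms(2), where h'="\<lambda>t. - (inverse t)\<^sup>2"])
       (use assms(3) in \<open>auto intro!: derivative_eq_intros continuous_intros simp: power2_eq_square\<close>)
  from C1_piece_mult[OF assms(1) this] show ?thesis by (simp add: divide_inverse)
qed

lemma C1_piece_sum: "(\<And>i. i \<in> I \<Longrightarrow> C1_piece K (f i)) \<Longrightarrow> C1_piece K (\<lambda>x. \<Sum>i\<in>I. f i x)"
  by (induction I rule: infinite_finite_induct) (auto intro: C1_piece_const C1_piece_add)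

lemma C1_piece_prod: "(\<And>i. i \<in> I \<Longrightarrow> C1_piece K (f i)) \<Longrightarrow> C1_piece K (\<lambda>x. \<Prod>i\<in>I. f i x)"
  by (induction I rule: infinite_finite_induct) (auto intro: C1_piece_const C1_piece_mult)

lemma C1_piece_cong: "(\<And>x. x \<in> K \<Longrightarrow> f x = g x) \<Longrightarrow> C1_piece K f \<Longrightarrow> C1_piece K g"
  unfolding C1_piece_def by metis

lemma C1_piece_lipschitz:
  assumes "C1_piece K f" "compact K" "convex K"
  obtains L where "L-lipschitz_on K f"
proof -
  obtain P Q where *: "\<And>x. x \<in> K \<Longrightarrow> f x = P x" "\<And>x. x \<in> K \<Longrightarrow> GDERIV P x :> Q x" "continuous_on K Q"
    using assms(1) unfolding C1_piece_def by metis
  have "bounded (Q ` K)" by (rule compact_imp_bounded[OF compact_continuous_image[OF *(3) assms(2)]])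
  then obtain B where B: "\<And>x. x \<in> K \<Longrightarrow> norm (Q x) \<le> B" by (auto simp: bounded_iff)
  have "(max B 0)-lipschitz_on K P"
    by (rule GDERIV_bounded_imp_lipschitz[OF *(2) assms(3)]) (use B in \<open>auto intro: max.coboundedI1\<close>)
  then show thesis
    using *(1) by (intro that[of "max B 0"] lipschitz_onI) (auto dest: lipschitz_onD)
qed

text \<open>In the interior of the piece the gradient of the extension is that of \<open>f\<close>. The bound comes from the
closed piece, where the gradient of the extension is continuous.\<close>

lemma C1_piece_interior:
  assumes "C1_piece K f"
  shows "x \<in> interior K \<Longrightarrow> GDERIV f x :> gradient f x" and "continuous_on (interior K) (gradient f)"
    and "compact K \<Longrightarrow> \<exists>B\<ge>0. \<forall>x\<in>interior K. norm (gradient f x) \<le> B"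
proof -
  obtain P Q where *: "\<And>x. x \<in> K \<Longrightarrow> f x = P x" "\<And>x. x \<in> K \<Longrightarrow> GDERIV P x :> Q x" "continuous_on K Q"
    using assms(1) unfolding C1_piece_def by metis
  have G: "GDERIV f x :> Q x" if "x \<in> interior K" for x
    by (rule GDERIV_transform_open[OF *(2) open_interior that]) (use that interior_subset[of K] *(1) in auto)
  then have eq: "gradient f x = Q x" if "x \<in> interior K" for x
    using that by (intro gradient_eq)
  show "x \<in> interior K \<Longrightarrow> GDERIV f x :> gradient f x" using G eq by simp
  show "continuous_on (interior K) (gradient f)"
    using continuous_on_subset[OF *(3) interior_subset] eq by (simp cong: continuous_on_cong)
  assume "compact K"
  have "bounded (Q ` K)" by (rule compact_imp_bounded[OF compact_continuous_image[OF *(3) \<open>compact K\<close>]])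
  then obtain B where B: "\<And>x. x \<in> K \<Longrightarrow> norm (Q x) \<le> B" by (auto simp: bounded_iff)
  then show "\<exists>B\<ge>0. \<forall>x\<in>interior K. norm (gradient f x) \<le> B"
    using eq interior_subset[of K] by (intro exI[of _ "max B 0"]) (auto intro!: max.coboundedI1)
qed

text \<open>What the analysis uses of a triangulation: finitely many compact convex pieces whose union is
the closure of the domain. How the pieces meet enters only through the functions considered, which are
defined on the whole union.\<close>

locale tiling =
  fixes \<Omega> :: "'a::euclidean_space set" and \<T> :: "'a set set"
  assumes finite_tiles: "finite \<T>"
    and compact_tile: "K \<in> \<T> \<Longrightarrow> compact K"
    and convex_tile: "K \<in> \<T> \<Longrightarrow> convex K"
    and open_domain: "open \<Omega>"
    and covering: "\<Union>\<T> = closure \<Omega>"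
begin

definition skeleton :: "'a set" where
  "skeleton = (\<Union>K\<in>\<T>. frontier K)"

text \<open>The null set \<open>skeleton\<close> contains all points where a piecewise smooth function may fail to be
differentiable; the value zero there makes the gradient measurable.\<close>

definition piecewise_gradient :: "('a \<Rightarrow> real) \<Rightarrow> 'a \<Rightarrow> 'a" where
  "piecewise_gradient f x = (if x \<in> skeleton then 0 else gradient f x)"

definition piecewise_C1 :: "('a \<Rightarrow> real) \<Rightarrow> bool" where
  "piecewise_C1 f \<longleftrightarrow> (\<forall>K\<in>\<T>. C1_piece K f)"

lemma skeleton: "closed skeleton" "negligible skeleton"
  unfolding skeleton_def using finite_tiles convex_tile
  by (auto intro!: closed_UN frontier_closed negligible_Union simp: negligible_convex_frontier)

lemma domain_subset: "\<Omega> \<subseteq> \<Union>\<T>"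
  using covering closure_subset by blast

lemma compact_closure_domain: "compact (closure \<Omega>)"
  unfolding covering[symmetric] using finite_tiles compact_tile by (intro compact_Union)

lemma in_interior_tile: "x \<in> closure \<Omega> \<Longrightarrow> x \<notin> skeleton \<Longrightarrow> \<exists>K\<in>\<T>. x \<in> interior K"
proof -
  assume x: "x \<in> closure \<Omega>" "x \<notin> skeleton"
  then obtain K where K: "K \<in> \<T>" "x \<in> K" using covering by blast
  then have "x \<in> interior K"
    using x(2) closure_subset[of K] by (auto simp: skeleton_def frontier_def)
  then show ?thesis using K by blast
qed

lemma piecewise_C1_continuous: "piecewise_C1 f \<Longrightarrow> continuous_on (closure \<Omega>) f"
  unfolding covering[symmetric] piecewise_C1_def
  using continuous_on_closed_Union[of \<T> "\<lambda>K. K" f] finite_tiles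
  by (auto simp: compact_tile compact_imp_closed C1_piece_continuous)

lemma piecewise_C1_bounded: "piecewise_C1 f \<Longrightarrow> \<exists>B\<ge>0. \<forall>x\<in>closure \<Omega>. \<bar>f x\<bar> \<le> B"
proof -
  assume "piecewise_C1 f"
  then have "bounded (f ` closure \<Omega>)"
    by (intro compact_imp_bounded compact_continuous_image piecewise_C1_continuous compact_closure_domain)
  then obtain B where "\<And>x. x \<in> closure \<Omega> \<Longrightarrow> \<bar>f x\<bar> \<le> B" by (auto simp: bounded_iff)
  then show ?thesis by (intro exI[of _ "max B 0"]) (auto intro!: max.coboundedI1)
qed

lemma piecewise_C1_GDERIV:
  assumes "piecewise_C1 f" "x \<in> closure \<Omega>" "x \<notin> skeleton"
  shows "GDERIV f x :> piecewise_gradient f x"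
  using in_interior_tile[OF assms(2,3)] assms(1,3) C1_piece_interior(1)
  by (auto simp: piecewise_C1_def piecewise_gradient_def)

lemma piecewise_gradient_bounded:
  assumes "piecewise_C1 f"
  shows "\<exists>B\<ge>0. \<forall>x\<in>closure \<Omega>. norm (piecewise_gradient f x) \<le> B"
proof -
  have "\<forall>K\<in>\<T>. \<exists>B\<ge>0. \<forall>x\<in>interior K. norm (gradient f x) \<le> B"
    using assms compact_tile C1_piece_interior(3) unfolding piecewise_C1_def by blast
  then obtain B where B: "\<And>K. K \<in> \<T> \<Longrightarrow> B K \<ge> 0" "\<And>K x. K \<in> \<T> \<Longrightarrow> x \<in> interior K \<Longrightarrow> norm (gradient f x) \<le> B K"
    by metis
  have "norm (piecewise_gradient f x) \<le> (\<Sum>K\<in>\<T>. B K)" if x: "x \<in> closure \<Omega>" for x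
  proof (cases "x \<in> skeleton")
    case True
    then show ?thesis using B(1) by (simp add: piecewise_gradient_def sum_nonneg)
  next
    case False
    then obtain K where K: "K \<in> \<T>" "x \<in> interior K" using in_interior_tile[OF x] by blast
    then have "norm (gradient f x) \<le> B K" using B(2) by blast
    also have "\<dots> \<le> (\<Sum>K\<in>\<T>. B K)" using B(1) K(1) finite_tiles by (intro member_le_sum) auto
    finally show ?thesis using False by (simp add: piecewise_gradient_def)
  qed
  then show ?thesis using B(1) by (intro exI[of _ "\<Sum>K\<in>\<T>. B K"]) (auto intro: sum_nonneg)
qed

lemma continuous_on_piecewise_gradient:
  assumes "piecewise_C1 f"
  shows "continuous_on (\<Omega> - skeleton) (piecewise_gradient f)"
proof -
  have o: "open (\<Omega> - skeleton)" using open_domain skeleton by auto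
  show ?thesis
    unfolding continuous_on_eq_continuous_at[OF o]
  proof
    fix x assume x: "x \<in> \<Omega> - skeleton"
    then obtain K where K: "K \<in> \<T>" "x \<in> interior K"
      using in_interior_tile closure_subset by (metis Diff_iff subsetD)
    have o': "open (interior K - skeleton)" using skeleton by auto
    have "continuous_on (interior K - skeleton) (gradient f)"
      using C1_piece_interior(2) assms K(1) unfolding piecewise_C1_def
      by (blast intro: continuous_on_subset)
    then have "continuous_on (interior K - skeleton) (piecewise_gradient f)"
      by (rule continuous_on_eq) (simp add: piecewise_gradient_def)
    then show "isCont (piecewise_gradient f) x"
      using K(2) x by (simp add: continuous_on_eq_continuous_at[OF o'])
  qed
qed

text \<open>A segment between two points is covered by finitely many closed sets, its intersections with the tiles
and with the complement of the domain, and \<open>f\<close> is Lipschitz on each of them with the same constant.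
Continuity across the tiles is implicit, because \<open>f\<close> is one function on overlapping closed
tiles.\<close>

lemma piecewise_C1_lipschitz:
  assumes "piecewise_C1 f" and zero: "\<And>x. x \<notin> \<Omega> \<Longrightarrow> f x = 0"
  shows "\<exists>L. L-lipschitz_on UNIV f"
proof -
  have "\<forall>K\<in>\<T>. \<exists>L. L-lipschitz_on K f"
    using assms(1) compact_tile convex_tile unfolding piecewise_C1_def by (metis C1_piece_lipschitz)
  then obtain l where l: "\<And>K. K \<in> \<T> \<Longrightarrow> (l K)-lipschitz_on K f" by metis
  have l0: "l K \<ge> 0" if "K \<in> \<T>" for K using l[OF that] lipschitz_on_nonneg by blast
  \<comment> \<open>The sum is a common Lipschitz constant that needs no case distinction on an empty mesh.\<close>
  define L where "L = (\<Sum>K\<in>\<T>. l K)"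
  have L0: "L \<ge> 0" unfolding L_def using l0 by (intro sum_nonneg)
  have L: "L-lipschitz_on S f" if "S \<in> insert (-\<Omega>) \<T>" for S
  proof (cases "S = -\<Omega>")
    case True
    then show ?thesis using zero L0 by (intro lipschitz_onI) auto
  next
    case False
    then have S: "S \<in> \<T>" using that by simp
    have "l S \<le> L" unfolding L_def using l0 S finite_tiles by (intro member_le_sum) auto
    with l[OF S] show ?thesis by (rule lipschitz_on_le)
  qed
  have "L-lipschitz_on UNIV f"
  proof (rule lipschitz_onI)
    fix x y :: 'a
    define \<gamma> where "\<gamma> t = x + t *\<^sub>R (y - x)" for t :: real
    have "(L * dist x y)-lipschitz_on {0..1} (\<lambda>t. f (\<gamma> t))"
    proof (rule lipschitz_on_closed_Union[where I="insert (-\<Omega>) \<T>" and U="\<lambda>S. \<gamma> -` S"])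
      fix S assume S: "S \<in> insert (-\<Omega>) \<T>"
      show "(L * dist x y)-lipschitz_on (\<gamma> -` S) (\<lambda>t. f (\<gamma> t))"
      proof (rule lipschitz_onI)
        fix s t assume "s \<in> \<gamma> -` S" "t \<in> \<gamma> -` S"
        then have "dist (f (\<gamma> s)) (f (\<gamma> t)) \<le> L * dist (\<gamma> s) (\<gamma> t)"
          using lipschitz_onD[OF L[OF S]] by simp
        also have "dist (\<gamma> s) (\<gamma> t) = dist x y * dist s t"
        proof -
          have "\<gamma> s - \<gamma> t = (s - t) *\<^sub>R (y - x)" by (simp add: \<gamma>_def algebra_simps)
          then show ?thesis by (simp add: dist_norm norm_minus_commute)
        qed
        finally show "dist (f (\<gamma> s)) (f (\<gamma> t)) \<le> L * dist x y * dist s t" by simp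
      qed (use L0 in simp)
      have "closed S" using S open_domain compact_tile by (auto intro: compact_imp_closed)
      then show "closed (\<gamma> -` S)"
        by (rule closed_vimage) (auto simp: \<gamma>_def intro!: continuous_intros)
    next
      show "{0..1} \<subseteq> (\<Union>S\<in>insert (-\<Omega>) \<T>. \<gamma> -` S)"
        using domain_subset by auto
    qed (use finite_tiles L0 in auto)
    then have "dist (f (\<gamma> 0)) (f (\<gamma> 1)) \<le> L * dist x y * dist (0::real) 1"
      by (rule lipschitz_onD) auto
    then show "dist (f x) (f y) \<le> L * dist x y" by (simp add: \<gamma>_def)
  qed (rule L0)
  then show ?thesis by blast
qed

lemma piecewise_gradient_outside:
  assumes "\<And>x. x \<notin> \<Omega> \<Longrightarrow> f x = 0" "x \<notin> closure \<Omega>"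
  shows "GDERIV f x :> 0" "piecewise_gradient f x = 0"
proof -
  show "GDERIV f x :> 0"
    by (rule GDERIV_transform_open[OF GDERIV_const[of 0], of "- closure \<Omega>"])
       (use assms closure_subset[of \<Omega>] in auto)
  then show "piecewise_gradient f x = 0"
    by (simp add: piecewise_gradient_def gradient_eq)
qed

lemma piecewise_C1_lipschitz_C1_off:
  assumes f: "piecewise_C1 f"
    and supp: "compact S" "S \<subseteq> \<Omega>" "\<And>x. x \<notin> S \<Longrightarrow> f x = 0"
  shows "lipschitz_C1_off skeleton f (piecewise_gradient f)"
  unfolding lipschitz_C1_off_def
proof (intro conjI allI impI ballI)
  have zero: "f x = 0" if "x \<notin> \<Omega>" for x using supp(2,3) that by blast
  show "\<exists>L. L-lipschitz_on UNIV f" by (rule piecewise_C1_lipschitz[OF f zero])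
  show G: "GDERIV f x :> piecewise_gradient f x" if "x \<notin> skeleton" for x
    using piecewise_C1_GDERIV[OF f _ that] piecewise_gradient_outside[OF zero]
    by (cases "x \<in> closure \<Omega>") auto
  have "continuous_on (- S - skeleton) (piecewise_gradient f)"
  proof -
    have "piecewise_gradient f x = 0" if "x \<in> - S - skeleton" for x
      by (rule GDERIV_eq_0_open[OF G, of _ "-S"]) (use that supp in \<open>auto simp: compact_imp_closed\<close>)
    then show ?thesis by (intro continuous_on_eq[OF continuous_on_const[of _ 0]]) simp
  qed
  then have "continuous_on ((- S - skeleton) \<union> (\<Omega> - skeleton)) (piecewise_gradient f)"
    using continuous_on_piecewise_gradient[OF f] skeleton(1) open_domain supp(1)
    by (intro continuous_on_open_Un) (auto intro!: open_Diff open_Compl compact_imp_closed)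
  moreover have "(- S - skeleton) \<union> (\<Omega> - skeleton) = - skeleton" using supp(2) by auto
  ultimately show "continuous_on (- skeleton) (piecewise_gradient f)" by simp
qed (use skeleton in \<open>auto simp: piecewise_gradient_def\<close>)

lemma piecewise_C1_mult: "piecewise_C1 f \<Longrightarrow> piecewise_C1 g \<Longrightarrow> piecewise_C1 (\<lambda>x. f x * g x)"
  unfolding piecewise_C1_def by (blast intro: C1_piece_mult)

lemma test_function_piecewise_C1: "\<phi> \<in> test_functions U \<Longrightarrow> piecewise_C1 \<phi>"
  unfolding piecewise_C1_def using test_function_props(2)[of \<phi> U]
  by (metis C1_pieceI continuous_on_subset subset_UNIV)

end

section \<open>Weak gradients of localized functions\<close>

text \<open>A continuously differentiable cut-off near zero: it vanishes for \<open>t \<le> \<epsilon>\<close>, and for \<open>t > 0\<close> it tends to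
\<open>t\<close>, and its derivative to \<open>1\<close>, as \<open>\<epsilon>\<close> tends to zero, with bounds independent of \<open>\<epsilon>\<close>. The plain
truncation \<open>max 0 (t - \<epsilon>)\<close> would have a kink on a level set of \<open>\<psi>\<close>, which is not part of the
skeleton.\<close>

definition soft_cut :: "real \<Rightarrow> real \<Rightarrow> real" where
  "soft_cut \<epsilon> t = (max 0 (t - \<epsilon>))\<^sup>2 / (t + \<epsilon>)"

definition soft_cut_deriv :: "real \<Rightarrow> real \<Rightarrow> real" where
  "soft_cut_deriv \<epsilon> t = 2 * (max 0 (t - \<epsilon>) / (t + \<epsilon>)) - (max 0 (t - \<epsilon>) / (t + \<epsilon>))\<^sup>2"

lemma DERIV_max_0_squared: "DERIV (\<lambda>t::real. (max 0 t)\<^sup>2) t :> 2 * max 0 t"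
proof -
  consider "t < 0" | "t > 0" | "t = 0" by linarith
  then show ?thesis
  proof cases
    case 1
    have "((\<lambda>t::real. 0) has_field_derivative 0) (at t)" by simp
    then have "((\<lambda>t::real. (max 0 t)\<^sup>2) has_field_derivative 0) (at t)"
      by (rule has_field_derivative_transform_within_open[of _ _ _ "{..<0}"]) (use 1 in auto)
    then show ?thesis using 1 by simp
  next
    case 2
    have "((\<lambda>t::real. t\<^sup>2) has_field_derivative 2 * t) (at t)"
      by (auto intro!: derivative_eq_intros)
    then have "((\<lambda>t::real. (max 0 t)\<^sup>2) has_field_derivative 2 * t) (at t)"
      by (rule has_field_derivative_transform_within_open[of _ _ _ "{0<..}"]) (use 2 in auto)
    then show ?thesis using 2 by simp
  next
    case 3
    have "((\<lambda>h::real. (max 0 h)\<^sup>2 / h) \<longlongrightarrow> 0) (at 0)"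
    proof (rule Lim_null_comparison)
      show "\<forall>\<^sub>F h in at 0. norm ((max 0 h)\<^sup>2 / h) \<le> \<bar>h\<bar>" for h :: real
        by (rule always_eventually) (auto simp: max_def power2_eq_square)
      show "((\<lambda>h::real. \<bar>h\<bar>) \<longlongrightarrow> 0) (at 0)"
        by (auto intro!: tendsto_eq_intros)
    qed
    then show ?thesis using 3 by (simp add: DERIV_def)
  qed
qed

lemma DERIV_soft_cut:
  assumes "\<epsilon> > 0" "t \<ge> 0"
  shows "DERIV (soft_cut \<epsilon>) t :> soft_cut_deriv \<epsilon> t"
proof -
  have "DERIV (\<lambda>t. (max 0 (t - \<epsilon>))\<^sup>2) t :> 2 * max 0 (t - \<epsilon>)"
    using DERIV_max_0_squared[of "t - \<epsilon>"] DERIV_shift[of "\<lambda>t. (max 0 t)\<^sup>2" _ t "- \<epsilon>"] by simp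
  moreover have "DERIV (\<lambda>t. t + \<epsilon>) t :> 1" by (auto intro!: derivative_eq_intros)
  ultimately have "DERIV (\<lambda>t. (max 0 (t - \<epsilon>))\<^sup>2 / (t + \<epsilon>)) t :>
      (2 * max 0 (t - \<epsilon>) * (t + \<epsilon>) - (max 0 (t - \<epsilon>))\<^sup>2 * 1) / ((t + \<epsilon>) * (t + \<epsilon>))"
    by (rule DERIV_divide) (use assms in auto)
  moreover have "(2 * max 0 (t - \<epsilon>) * (t + \<epsilon>) - (max 0 (t - \<epsilon>))\<^sup>2 * 1) / ((t + \<epsilon>) * (t + \<epsilon>)) = soft_cut_deriv \<epsilon> t"
    using assms by (simp add: soft_cut_deriv_def diff_divide_distrib power2_eq_square)
  ultimately show ?thesis by (simp add: soft_cut_def[abs_def])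
qed

text \<open>Everything is expressed by \<open>r = max 0 (t - \<epsilon>) / (t + \<epsilon>)\<close>, which lies between \<open>0\<close> and \<open>1\<close>; the
derivative is \<open>1 - (1 - r)\<^sup>2\<close>.\<close>

lemma soft_cut_bounds:
  assumes "\<epsilon> > 0" "t \<ge> 0"
  shows "0 \<le> soft_cut \<epsilon> t" "soft_cut \<epsilon> t \<le> t" "\<bar>soft_cut_deriv \<epsilon> t\<bar> \<le> 1"
proof -
  define r where "r = max 0 (t - \<epsilon>) / (t + \<epsilon>)"
  have r: "0 \<le> r" "r \<le> 1" using assms by (auto simp: r_def)
  have s: "soft_cut \<epsilon> t = r * max 0 (t - \<epsilon>)" by (simp add: soft_cut_def r_def power2_eq_square)
  show "0 \<le> soft_cut \<epsilon> t" using r by (simp add: s)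
  show "soft_cut \<epsilon> t \<le> t"
    unfolding s using mult_mono[OF r(2), of "max 0 (t - \<epsilon>)" t] assms by auto
  have "soft_cut_deriv \<epsilon> t = 2 * r - r\<^sup>2"
    by (simp add: soft_cut_deriv_def r_def)
  then have d: "soft_cut_deriv \<epsilon> t = 1 - (1 - r)\<^sup>2"
    by (simp add: power2_eq_square algebra_simps)
  have "(1 - r)\<^sup>2 \<le> 1" using r by (simp add: power_le_one)
  then show "\<bar>soft_cut_deriv \<epsilon> t\<bar> \<le> 1" unfolding d by simp
qed

lemma soft_cut_limits:
  assumes "t \<ge> 0"
  shows "(\<lambda>n. soft_cut (inverse (real (Suc n))) t) \<longlonglongrightarrow> t"
    and "t > 0 \<Longrightarrow> (\<lambda>n. soft_cut_deriv (inverse (real (Suc n))) t) \<longlonglongrightarrow> 1"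
proof -
  have m: "(\<lambda>n. max 0 (t - inverse (real (Suc n)))) \<longlonglongrightarrow> t"
    using tendsto_max[OF tendsto_const[of 0] tendsto_diff[OF tendsto_const[of t] LIMSEQ_inverse_real_of_nat]] assms by simp
  have d: "(\<lambda>n. t + inverse (real (Suc n))) \<longlonglongrightarrow> t"
    using tendsto_add[OF tendsto_const[of t] LIMSEQ_inverse_real_of_nat] by simp
  show "(\<lambda>n. soft_cut (inverse (real (Suc n))) t) \<longlonglongrightarrow> t"
  proof (cases "t = 0")
    case False
    then have "(\<lambda>n. soft_cut (inverse (real (Suc n))) t) \<longlonglongrightarrow> t\<^sup>2 / t"
      unfolding soft_cut_def by (intro tendsto_intros m d)
    then show ?thesis using False by (simp add: power2_eq_square)
  qed (simp add: soft_cut_def)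
  assume "t > 0"
  then have r: "(\<lambda>n. max 0 (t - inverse (real (Suc n))) / (t + inverse (real (Suc n)))) \<longlonglongrightarrow> t / t"
    by (intro tendsto_divide m d) simp
  have "(\<lambda>n. soft_cut_deriv (inverse (real (Suc n))) t) \<longlonglongrightarrow> 2 * (t / t) - (t / t)\<^sup>2"
    unfolding soft_cut_deriv_def by (intro tendsto_diff tendsto_mult tendsto_const tendsto_power r)
  then show "(\<lambda>n. soft_cut_deriv (inverse (real (Suc n))) t) \<longlonglongrightarrow> 1"
    using \<open>t > 0\<close> by simp
qed

lemma integrable_bounded_compact_support:
  fixes h :: "'a::euclidean_space \<Rightarrow> 'b::euclidean_space"
  assumes "h \<in> borel_measurable lebesgue" "\<And>x. norm (h x) \<le> B" "compact S" "\<And>x. x \<notin> S \<Longrightarrow> h x = 0"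
  shows "integrable lebesgue h"
proof (rule Bochner_Integration.integrable_bound[OF _ assms(1)])
  show "integrable lebesgue (\<lambda>x. B * indicator S x)"
    using assms(3) emeasure_compact_finite[OF assms(3)] by (intro integrable_mult_right integrable_real_indicator)
      (auto simp: borel_compact less_top)
  show "AE x in lebesgue. norm (h x) \<le> norm (B * indicator S x)"
    using assms(2,4) order_trans[OF norm_ge_zero assms(2)] by (auto simp: indicator_def)
qed

lemma integrable_bounded_mult:
  fixes F :: "'a::euclidean_space \<Rightarrow> 'b::euclidean_space"
  assumes "integrable lebesgue F" "d \<in> borel_measurable lebesgue" "\<And>x. \<bar>d x\<bar> \<le> B"
  shows "integrable lebesgue (\<lambda>x. d x *\<^sub>R F x)"
proof (rule Bochner_Integration.integrable_bound)
  show "integrable lebesgue (\<lambda>x. B * norm (F x))" using assms(1) by auto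
  show "AE x in lebesgue. norm (d x *\<^sub>R F x) \<le> norm (B * norm (F x))"
    using assms(3) order_trans[OF assms(3) abs_ge_self] by (auto simp: abs_mult intro!: mult_right_mono)
qed (use assms in auto)

lemma integrable_bounded_mult_right:
  fixes F :: "'a::euclidean_space \<Rightarrow> real" and d :: "'a \<Rightarrow> 'b::euclidean_space"
  assumes "integrable lebesgue F" "d \<in> borel_measurable lebesgue" "\<And>x. norm (d x) \<le> B"
  shows "integrable lebesgue (\<lambda>x. F x *\<^sub>R d x)"
proof (rule Bochner_Integration.integrable_bound)
  show "integrable lebesgue (\<lambda>x. B * norm (F x))" using assms(1) by auto
  show "AE x in lebesgue. norm (F x *\<^sub>R d x) \<le> norm (B * norm (F x))"
    using order_trans[OF assms(3) abs_ge_self] by (auto simp: abs_mult mult.commute[of "\<bar>B\<bar>"] intro!: mult_left_mono)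
qed (use assms in auto)

lemma absolutely_integrable_on_compact:
  fixes h k :: "'a::euclidean_space \<Rightarrow> 'b::euclidean_space"
  assumes "integrable lebesgue k" "compact K" "\<And>x. x \<in> K \<Longrightarrow> h x = k x"
  shows "h absolutely_integrable_on K"
proof -
  have "integrable lebesgue (\<lambda>x. indicator K x *\<^sub>R k x)"
    using assms by (intro integrable_mult_indicator) (auto simp: borel_compact)
  moreover have "(\<lambda>x. indicator K x *\<^sub>R k x) = (\<lambda>x. indicator K x *\<^sub>R h x)"
    using assms(3) by (intro ext) (simp split: split_indicator)
  ultimately show ?thesis by (simp add: set_integrable_def)
qed

lemma test_function_gradient:
  fixes \<phi> :: "'a::euclidean_space \<Rightarrow> real"
  assumes "\<phi> \<in> test_functions U" "\<forall>x. GDERIV \<phi> x :> D x"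
  shows "continuous_on UNIV D" "\<And>x. x \<notin> support \<phi> \<Longrightarrow> D x = 0"
    "\<exists>B\<ge>0. \<forall>x. \<bar>\<phi> x\<bar> \<le> B" "\<exists>B\<ge>0. \<forall>x. norm (D x) \<le> B"
    "\<phi> \<in> borel_measurable lebesgue" "D \<in> borel_measurable lebesgue"
proof -
  note tp = test_function_props[OF assms(1)]
  obtain D' where D': "\<forall>x. GDERIV \<phi> x :> D' x" "continuous_on UNIV D'" using tp(2) by blast
  have eq: "D x = D' x" for x by (rule GDERIV_unique[OF assms(2)[rule_format] D'(1)[rule_format]])
  show c: "continuous_on UNIV D"
    by (rule continuous_on_eq[OF D'(2)]) (rule eq[symmetric])
  have z: "\<And>x. x \<notin> support \<phi> \<Longrightarrow> D x = 0"
    by (rule GDERIV_eq_0_open[OF assms(2)[rule_format], of "- support \<phi>"])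
       (use compact_imp_closed[OF tp(3)] in \<open>auto intro: tp(5)\<close>)
  then show "\<And>x. x \<notin> support \<phi> \<Longrightarrow> D x = 0" .
  show "\<exists>B\<ge>0. \<forall>x. \<bar>\<phi> x\<bar> \<le> B"
    by (rule continuous_zero_outside_compact_bounded[OF tp(1,3,5)]) auto
  show "\<exists>B\<ge>0. \<forall>x. norm (D x) \<le> B"
    by (rule continuous_zero_outside_compact_bounded[OF c tp(3) z]) auto
  show "\<phi> \<in> borel_measurable lebesgue" "D \<in> borel_measurable lebesgue"
    using borel_measurable_continuous_onI[OF tp(1)] borel_measurable_continuous_onI[OF c]
    by (auto simp: measurable_completion)
qed

context tiling
begin

lemma piecewise_C1_measurable:
  assumes "piecewise_C1 f"
  shows "(\<lambda>x. indicator \<Omega> x * f x) \<in> borel_measurable borel"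
  using borel_measurable_continuous_on_indicator[of \<Omega> f] open_domain
    continuous_on_subset[OF piecewise_C1_continuous[OF assms] closure_subset]
  by (simp add: borel_open)

lemma piecewise_gradient_measurable:
  assumes "piecewise_C1 f"
  shows "(\<lambda>x. indicator \<Omega> x *\<^sub>R piecewise_gradient f x) \<in> borel_measurable borel"
proof -
  have "(\<lambda>x. indicator (\<Omega> - skeleton) x *\<^sub>R piecewise_gradient f x) \<in> borel_measurable borel"
    using open_domain skeleton
    by (intro borel_measurable_continuous_on_indicator continuous_on_piecewise_gradient assms) (auto simp: borel_open)
  moreover have "(\<lambda>x. indicator (\<Omega> - skeleton) x *\<^sub>R piecewise_gradient f x) = (\<lambda>x. indicator \<Omega> x *\<^sub>R piecewise_gradient f x)"
    by (auto simp: indicator_def piecewise_gradient_def)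
  ultimately show ?thesis by simp
qed

lemma piecewise_C1_cut_off:
  assumes \<psi>: "piecewise_C1 \<psi>"
  shows "(\<lambda>x. indicator \<Omega> x * \<psi> x) \<in> borel_measurable lebesgue"
    and "(\<lambda>x. indicator \<Omega> x *\<^sub>R piecewise_gradient \<psi> x) \<in> borel_measurable lebesgue"
    and "\<exists>B. \<forall>x. \<bar>indicator \<Omega> x * \<psi> x\<bar> \<le> B"
    and "\<exists>B. \<forall>x. norm (indicator \<Omega> x *\<^sub>R piecewise_gradient \<psi> x) \<le> B"
proof -
  show "(\<lambda>x. indicator \<Omega> x * \<psi> x) \<in> borel_measurable lebesgue"
    "(\<lambda>x. indicator \<Omega> x *\<^sub>R piecewise_gradient \<psi> x) \<in> borel_measurable lebesgue"
    using piecewise_C1_measurable[OF \<psi>] piecewise_gradient_measurable[OF \<psi>]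
    by (auto simp: measurable_completion)
  obtain B B' where B: "B \<ge> 0" "\<forall>x\<in>closure \<Omega>. \<bar>\<psi> x\<bar> \<le> B"
    "B' \<ge> 0" "\<forall>x\<in>closure \<Omega>. norm (piecewise_gradient \<psi> x) \<le> B'"
    using piecewise_C1_bounded[OF \<psi>] piecewise_gradient_bounded[OF \<psi>] by blast
  have "\<bar>indicator \<Omega> x * \<psi> x\<bar> \<le> B" "norm (indicator \<Omega> x *\<^sub>R piecewise_gradient \<psi> x) \<le> B'" for x
    using B closure_subset[of \<Omega>] by (auto simp: indicator_def)
  then show "\<exists>B. \<forall>x. \<bar>indicator \<Omega> x * \<psi> x\<bar> \<le> B"
    "\<exists>B. \<forall>x. norm (indicator \<Omega> x *\<^sub>R piecewise_gradient \<psi> x) \<le> B" by blast+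
qed

lemma domain_lebesgue: "\<Omega> \<in> sets lebesgue"
  using open_domain by (simp add: borel_open)

lemma AE_not_skeleton: "AE x in lebesgue. x \<notin> skeleton"
  using skeleton(2) by (metis AE_not_in negligible_iff_null_sets)

lemma piecewise_C1_test_product:
  assumes "piecewise_C1 \<psi>" "\<phi> \<in> test_functions \<Omega>"
  shows "lipschitz_C1_off skeleton (\<lambda>x. \<psi> x * \<phi> x) (piecewise_gradient (\<lambda>x. \<psi> x * \<phi> x))"
  using test_function_props[OF assms(2)]
  by (intro piecewise_C1_lipschitz_C1_off[where S="support \<phi>"] piecewise_C1_mult assms(1)
      test_function_piecewise_C1[OF assms(2)]) auto

text \<open>Multiplying by the indicator of \<open>\<Omega>\<close> makes the right-hand side bounded and Borel measurable on the
whole space.\<close>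

lemma piecewise_gradient_product:
  assumes "piecewise_C1 \<psi>" "\<phi> \<in> test_functions \<Omega>" "\<forall>x. GDERIV \<phi> x :> D x" "x \<notin> skeleton"
  shows "piecewise_gradient (\<lambda>x. \<psi> x * \<phi> x) x =
    (indicator \<Omega> x * \<psi> x) *\<^sub>R D x + \<phi> x *\<^sub>R (indicator \<Omega> x *\<^sub>R piecewise_gradient \<psi> x)"
proof (cases "x \<in> \<Omega>")
  case True
  have "GDERIV \<psi> x :> piecewise_gradient \<psi> x"
    using True closure_subset by (intro piecewise_C1_GDERIV assms) auto
  then have "GDERIV (\<lambda>x. \<psi> x * \<phi> x) x :> \<psi> x *\<^sub>R D x + \<phi> x *\<^sub>R piecewise_gradient \<psi> x"
    using assms(3) by (intro GDERIV_mult) auto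
  then show ?thesis using True assms(4) gradient_eq by (simp add: piecewise_gradient_def)
next
  case False
  note tp = test_function_props[OF assms(2)]
  have "x \<notin> support \<phi>" using False tp(4) by blast
  then have "piecewise_gradient (\<lambda>x. \<psi> x * \<phi> x) x = 0"
    by (intro lipschitz_C1_off_eq_0[OF piecewise_C1_test_product[OF assms(1,2)], of "support \<phi>"])
       (use tp in \<open>auto simp: compact_imp_closed\<close>)
  then show ?thesis using False by simp
qed

text \<open>For a test function \<open>\<phi>\<close>, the product \<open>\<psi> * \<phi>\<close> is globally Lipschitz with compact support, so its
gradient \<open>\<psi> * \<nabla>\<phi> + \<phi> * \<nabla>\<psi>\<close> has integral zero.\<close>

theorem has_weak_gradient_piecewise:
  assumes \<psi>: "piecewise_C1 \<psi>"
  shows "has_weak_gradient \<Omega> \<psi> (piecewise_gradient \<psi>)"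
proof -
  define p where "p x = indicator \<Omega> x * \<psi> x" for x
  define q where "q x = indicator \<Omega> x *\<^sub>R piecewise_gradient \<psi> x" for x
  note cut = piecewise_C1_cut_off[OF \<psi>, folded p_def q_def]
  note pm = cut(1) and qm = cut(2)
  obtain B B' where pb: "\<And>x. \<bar>p x\<bar> \<le> B" and qb: "\<And>x. norm (q x) \<le> B'"
    using cut(3,4) by blast
  have z: "p x = 0" "q x = 0" if "x \<notin> closure \<Omega>" for x
    using that closure_subset[of \<Omega>] by (auto simp: p_def q_def indicator_def)
  have pi: "integrable lebesgue p" and qi: "integrable lebesgue q"
    using pm qm pb qb z compact_closure_domain
    by (auto intro!: integrable_bounded_compact_support[where S="closure \<Omega>"])
  show ?thesis
    unfolding has_weak_gradient_def
  proof (intro conjI allI ballI impI)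
    fix K assume K: "compact K \<and> K \<subseteq> \<Omega>"
    show "\<psi> absolutely_integrable_on K"
      by (rule absolutely_integrable_on_compact[OF pi]) (use K in \<open>auto simp: p_def\<close>)
    show "piecewise_gradient \<psi> absolutely_integrable_on K"
      by (rule absolutely_integrable_on_compact[OF qi]) (use K in \<open>auto simp: q_def\<close>)
  next
    fix \<phi> D assume \<phi>: "\<phi> \<in> test_functions \<Omega>" and D: "\<forall>x. GDERIV \<phi> x :> D x"
    note tp = test_function_props[OF \<phi>] and tg = test_function_gradient[OF \<phi> D]
    obtain C C' where C: "\<And>x. \<bar>\<phi> x\<bar> \<le> C" "\<And>x. norm (D x) \<le> C'" using tg(3,4) by blast
    note \<phi>m = tg(5) and Dm = tg(6)
    have i1: "integrable lebesgue (\<lambda>x. p x *\<^sub>R D x)"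
      by (rule integrable_bounded_mult_right[OF pi Dm C(2)])
    have i2: "integrable lebesgue (\<lambda>x. \<phi> x *\<^sub>R q x)"
      by (rule integrable_bounded_mult[OF qi \<phi>m C(1)])
    have l: "lipschitz_C1_off skeleton (\<lambda>x. \<psi> x * \<phi> x) (piecewise_gradient (\<lambda>x. \<psi> x * \<phi> x))"
      by (rule piecewise_C1_test_product[OF \<psi> \<phi>])
    obtain L where L: "L-lipschitz_on UNIV (\<lambda>x. \<psi> x * \<phi> x)" using l by (auto simp: lipschitz_C1_off_def)
    have m: "piecewise_gradient (\<lambda>x. \<psi> x * \<phi> x) \<in> borel_measurable borel"
      by (rule lipschitz_C1_off_measurable[OF l])
    have "AE x in lborel. GDERIV (\<lambda>x. \<psi> x * \<phi> x) x :> piecewise_gradient (\<lambda>x. \<psi> x * \<phi> x) x"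
      using lipschitz_C1_off_null[OF l] by eventually_elim (use l in \<open>auto simp: lipschitz_C1_off_def\<close>)
    then have "(LINT x|lborel. piecewise_gradient (\<lambda>x. \<psi> x * \<phi> x) x) = 0"
      by (intro integral_gradient_eq_0(2)[OF L tp(3) _ _ m]) (simp add: tp(5))
    then have "(LINT x|lebesgue. piecewise_gradient (\<lambda>x. \<psi> x * \<phi> x) x) = 0"
      using m by (simp add: integral_completion)
    moreover have "(LINT x|lebesgue. piecewise_gradient (\<lambda>x. \<psi> x * \<phi> x) x) =
        (LINT x|lebesgue. p x *\<^sub>R D x + \<phi> x *\<^sub>R q x)"
    proof (rule integral_cong_AE)
      show "AE x in lebesgue. piecewise_gradient (\<lambda>x. \<psi> x * \<phi> x) x = p x *\<^sub>R D x + \<phi> x *\<^sub>R q x"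
        using AE_not_skeleton unfolding p_def q_def
        by eventually_elim (rule piecewise_gradient_product[OF \<psi> \<phi> D])
    qed (use m pm qm \<phi>m Dm in \<open>auto simp: measurable_completion\<close>)
    ultimately have 0: "(LINT x|lebesgue. p x *\<^sub>R D x) + (LINT x|lebesgue. \<phi> x *\<^sub>R q x) = 0"
      using i1 i2 by simp
    have "(LINT x|lebesgue_on \<Omega>. \<psi> x *\<^sub>R D x) = (LINT x|lebesgue. p x *\<^sub>R D x)"
      by (rule integral_lebesgue_on_local[OF domain_lebesgue]) (auto simp: p_def)
    moreover have "(LINT x|lebesgue_on \<Omega>. \<phi> x *\<^sub>R piecewise_gradient \<psi> x) = (LINT x|lebesgue. \<phi> x *\<^sub>R q x)"
      by (rule integral_lebesgue_on_local[OF domain_lebesgue]) (auto simp: q_def)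
    ultimately show "(LINT x|lebesgue_on \<Omega>. \<psi> x *\<^sub>R D x) = - (LINT x|lebesgue_on \<Omega>. \<phi> x *\<^sub>R piecewise_gradient \<psi> x)"
      using 0 by (simp add: eq_neg_iff_add_eq_0)
  qed
qed

text \<open>A test function \<open>\<phi>\<close> on \<open>\<Omega>\<close> is in general no test function on \<open>U\<close>, and the support of \<open>\<psi> * \<phi>\<close> may
reach the boundary of \<open>U\<close>. With \<open>soft_cut\<close> in place of \<open>\<psi>\<close> the support is contained in the compact
set \<open>{x \<in> support \<phi>. \<psi> x \<ge> \<epsilon>}\<close>, a subset of \<open>U\<close>, and one lets \<open>\<epsilon>\<close> tend to zero.\<close>

lemma weak_gradient_vanishing_test:
  fixes f :: "'a \<Rightarrow> real"
  assumes \<psi>: "piecewise_C1 \<psi>" and nonneg: "\<And>x. x \<in> closure \<Omega> \<Longrightarrow> \<psi> x \<ge> 0"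
    and U: "open U" "U \<subseteq> \<Omega>" and pos: "\<And>x. x \<in> \<Omega> \<Longrightarrow> \<psi> x \<noteq> 0 \<Longrightarrow> x \<in> U"
    and g: "has_weak_gradient U f g" and fi: "integrable (lebesgue_on U) f" and gi: "integrable (lebesgue_on U) g"
    and \<phi>: "\<phi> \<in> test_functions \<Omega>"
  shows "(LINT x|lebesgue_on U. f x *\<^sub>R piecewise_gradient (\<lambda>x. \<psi> x * \<phi> x) x) =
    - (LINT x|lebesgue_on U. (\<psi> x * \<phi> x) *\<^sub>R g x)"
proof -
  note tp = test_function_props[OF \<phi>]
  obtain D where D: "\<forall>x. GDERIV \<phi> x :> D x" using tp(2) by blast
  note tg = test_function_gradient[OF \<phi> D]
  have Ul: "U \<in> sets lebesgue" using U by (simp add: borel_open)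
  define F where "F x = indicator U x *\<^sub>R f x" for x
  define H where "H x = indicator U x *\<^sub>R g x" for x
  have Fi: "integrable lebesgue F" using fi Ul unfolding F_def[abs_def] by (subst (asm) integrable_restrict_space) auto
  have Hi: "integrable lebesgue H" using gi Ul unfolding H_def[abs_def] by (subst (asm) integrable_restrict_space) auto
  define \<epsilon> where "\<epsilon> n = inverse (real (Suc n))" for n
  have \<epsilon>: "\<epsilon> n > 0" for n by (simp add: \<epsilon>_def)
  define w where "w n x = soft_cut (\<epsilon> n) (\<psi> x)" for n x
  have wC: "piecewise_C1 (w n)" for n
    unfolding piecewise_C1_def
  proof
    fix K assume K: "K \<in> \<T>"
    then have "K \<subseteq> closure \<Omega>" using covering by blast
    then have nn: "\<psi> x \<ge> 0" if "x \<in> K" for x using nonneg that by blast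
    show "C1_piece K (w n)"
      unfolding w_def
    proof (rule C1_piece_compose[where h="soft_cut (\<epsilon> n)" and h'="soft_cut_deriv (\<epsilon> n)"])
      show "C1_piece K \<psi>" using \<psi> K by (simp add: piecewise_C1_def)
      show "continuous_on (\<psi> ` K) (soft_cut_deriv (\<epsilon> n))"
        unfolding soft_cut_deriv_def
        using nn \<epsilon>[of n] by (intro continuous_intros) (auto simp: add_nonneg_eq_0_iff)
    qed (rule DERIV_soft_cut[OF \<epsilon> nn])
  qed
  define \<eta> where "\<eta> n x = w n x * \<phi> x" for n x
  have l: "lipschitz_C1_off skeleton (\<eta> n) (piecewise_gradient (\<eta> n))" for n
    unfolding \<eta>_def[abs_def] by (rule piecewise_C1_test_product[OF wC \<phi>])
  have eq: "(LINT x|lebesgue_on U. f x *\<^sub>R piecewise_gradient (\<eta> n) x) = - (LINT x|lebesgue_on U. \<eta> n x *\<^sub>R g x)" for n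
  proof (rule weak_gradient_lipschitz_test[OF U(1) g l])
    define S where "S = support \<phi> \<inter> {x \<in> closure \<Omega>. \<psi> x \<ge> \<epsilon> n}"
    have "closed {x \<in> closure \<Omega>. \<psi> x \<ge> \<epsilon> n}"
      using continuous_closed_preimage[OF piecewise_C1_continuous[OF \<psi>] closed_closure closed_atLeast[of "\<epsilon> n"]]
      by (simp add: vimage_def Int_def)
    then show "compact S" unfolding S_def using tp(3) by (rule compact_Int_closed[rotated])
    show "S \<subseteq> U"
    proof
      fix x assume x: "x \<in> S"
      then have "x \<in> \<Omega>" "\<psi> x \<noteq> 0" using tp(4) \<epsilon>[of n] by (auto simp: S_def)
      then show "x \<in> U" by (rule pos)
    qed
    show "\<eta> n x = 0" if "x \<notin> S" for x
    proof (cases "x \<in> support \<phi>")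
      case True
      then have "x \<in> closure \<Omega>" using tp(4) closure_subset by blast
      then have "\<psi> x < \<epsilon> n" using that True by (auto simp: S_def)
      then show ?thesis by (simp add: \<eta>_def w_def soft_cut_def)
    qed (simp add: \<eta>_def tp(5))
  qed
  obtain C C' where C: "C \<ge> 0" "C' \<ge> 0" "\<And>x. \<bar>\<phi> x\<bar> \<le> C" "\<And>x. norm (D x) \<le> C'" using tg(3,4) by blast
  obtain B where B: "B \<ge> 0" "\<And>x. x \<in> closure \<Omega> \<Longrightarrow> \<bar>\<psi> x\<bar> \<le> B" using piecewise_C1_bounded[OF \<psi>] by blast
  obtain B' where B': "B' \<ge> 0" "\<And>x. x \<in> closure \<Omega> \<Longrightarrow> norm (piecewise_gradient \<psi> x) \<le> B'"
    using piecewise_gradient_bounded[OF \<psi>] by blast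
  have w: "0 \<le> w n x" "w n x \<le> \<psi> x" if "x \<in> \<Omega>" for n x
    using soft_cut_bounds[OF \<epsilon> nonneg] that closure_subset[of \<Omega>] unfolding w_def by blast+
  have gw: "piecewise_gradient (w n) x = soft_cut_deriv (\<epsilon> n) (\<psi> x) *\<^sub>R piecewise_gradient \<psi> x"
    if "x \<in> \<Omega>" "x \<notin> skeleton" for n x
  proof -
    have x: "x \<in> closure \<Omega>" using that closure_subset by blast
    have "GDERIV (w n) x :> soft_cut_deriv (\<epsilon> n) (\<psi> x) *\<^sub>R piecewise_gradient \<psi> x"
      unfolding w_def
      by (rule GDERIV_DERIV_compose[OF piecewise_C1_GDERIV[OF \<psi> x that(2)] DERIV_soft_cut[OF \<epsilon> nonneg[OF x]]])
    then show ?thesis using GDERIV_unique piecewise_C1_GDERIV[OF wC x that(2)] by blast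
  qed
  have g\<eta>: "piecewise_gradient (\<eta> n) x = w n x *\<^sub>R D x + \<phi> x *\<^sub>R (soft_cut_deriv (\<epsilon> n) (\<psi> x) *\<^sub>R piecewise_gradient \<psi> x)"
    if "x \<in> \<Omega>" "x \<notin> skeleton" for n x
    using piecewise_gradient_product[OF wC \<phi> D that(2), of n] gw[OF that] that(1) by (simp add: \<eta>_def[abs_def])
  have out: "piecewise_gradient (\<lambda>x. h x * \<phi> x) x = 0" if "x \<notin> \<Omega>" "piecewise_C1 h" for h x
    by (rule lipschitz_C1_off_eq_0[OF piecewise_C1_test_product[OF that(2) \<phi>], of "support \<phi>"])
       (use tp that in \<open>auto simp: compact_imp_closed\<close>)
  have b1: "norm (piecewise_gradient (\<eta> n) x) \<le> B * C' + C * B'" for n x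
  proof -
    consider "x \<in> skeleton" | "x \<notin> \<Omega>" | "x \<in> \<Omega>" "x \<notin> skeleton" by blast
    then show ?thesis
    proof cases
      case 1
      then show ?thesis using B B' C by (simp add: piecewise_gradient_def)
    next
      case 2
      then show ?thesis using B B' C out[OF _ wC, of x n] by (simp add: \<eta>_def[abs_def])
    next
      case 3
      then have x: "x \<in> closure \<Omega>" using closure_subset by blast
      have "\<bar>w n x\<bar> \<le> B" using w[OF 3(1), of n] B(2)[OF x] by linarith
      moreover have "norm (soft_cut_deriv (\<epsilon> n) (\<psi> x) *\<^sub>R piecewise_gradient \<psi> x) \<le> 1 * B'"
        unfolding norm_scaleR using soft_cut_bounds(3)[OF \<epsilon> nonneg[OF x], of n] B'(2)[OF x] by (intro mult_mono) auto
      ultimately have "norm (w n x *\<^sub>R D x) \<le> B * C'"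
        "norm (\<phi> x *\<^sub>R (soft_cut_deriv (\<epsilon> n) (\<psi> x) *\<^sub>R piecewise_gradient \<psi> x)) \<le> C * B'"
        unfolding norm_scaleR[of "w n x"] norm_scaleR[of "\<phi> x"] real_norm_def using C B B'
        by (auto intro!: mult_mono simp del: norm_scaleR)
      then show ?thesis
        unfolding g\<eta>[OF 3] by (intro order_trans[OF norm_triangle_ineq] add_mono)
    qed
  qed
  have b2: "\<bar>\<eta> n x\<bar> \<le> B * C" for n x
  proof (cases "x \<in> \<Omega>")
    case True
    then have x: "x \<in> closure \<Omega>" using closure_subset by blast
    have "\<bar>w n x\<bar> \<le> B" using w[OF True, of n] B(2)[OF x] by linarith
    then show ?thesis unfolding \<eta>_def abs_mult using B C by (intro mult_mono) auto
  next
    case False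
    then have "\<phi> x = 0" using tp by blast
    then show ?thesis using B C by (simp add: \<eta>_def)
  qed
  define \<eta>0 where "\<eta>0 x = \<psi> x * \<phi> x" for x
  have l0: "lipschitz_C1_off skeleton \<eta>0 (piecewise_gradient \<eta>0)"
    unfolding \<eta>0_def[abs_def] by (rule piecewise_C1_test_product[OF \<psi> \<phi>])
  have lim2: "(\<lambda>n. \<eta> n x) \<longlonglongrightarrow> \<eta>0 x" for x
  proof (cases "x \<in> \<Omega>")
    case True
    then have x: "x \<in> closure \<Omega>" using closure_subset by blast
    show ?thesis unfolding \<eta>_def \<eta>0_def w_def \<epsilon>_def
      by (intro tendsto_intros soft_cut_limits(1) nonneg x)
  next
    case False
    then have "\<phi> x = 0" using tp by blast
    then show ?thesis by (simp add: \<eta>_def \<eta>0_def)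
  qed
  have lim1: "(\<lambda>n. piecewise_gradient (\<eta> n) x) \<longlonglongrightarrow> piecewise_gradient \<eta>0 x" if ns: "x \<notin> skeleton" for x
  proof (cases "x \<in> \<Omega>")
    case True
    then have x: "x \<in> closure \<Omega>" using closure_subset by blast
    have lw: "(\<lambda>n. w n x) \<longlonglongrightarrow> \<psi> x"
      unfolding w_def \<epsilon>_def by (intro soft_cut_limits(1) nonneg x)
    have "(\<lambda>n. soft_cut_deriv (\<epsilon> n) (\<psi> x) *\<^sub>R piecewise_gradient \<psi> x) \<longlonglongrightarrow> piecewise_gradient \<psi> x"
    proof (cases "\<psi> x = 0")
      \<comment> \<open>A zero of the nonnegative function is a minimum, so its gradient vanishes and both sides are zero.\<close>
      case zero: True
      obtain r where r: "r > 0" "ball x r \<subseteq> \<Omega>" using open_domain True openE by blast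
      have "(\<psi> has_derivative (\<lambda>h. h \<bullet> piecewise_gradient \<psi> x)) (at x)"
        using piecewise_C1_GDERIV[OF \<psi> x ns] by (simp add: gderiv_def)
      moreover have "\<forall>y\<in>ball x r. \<psi> x \<le> \<psi> y"
        using r nonneg zero closure_subset[of \<Omega>] by auto
      ultimately have "(\<lambda>h. h \<bullet> piecewise_gradient \<psi> x) = (\<lambda>h. 0)"
        using differential_zero_maxmin[of x "ball x r" \<psi>] r(1) by auto
      then have "piecewise_gradient \<psi> x \<bullet> piecewise_gradient \<psi> x = 0" by (rule fun_cong)
      then show ?thesis by simp
    next
      case False
      then have "\<psi> x > 0" using nonneg[OF x] by simp
      then have "(\<lambda>n. soft_cut_deriv (\<epsilon> n) (\<psi> x)) \<longlonglongrightarrow> 1"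
        unfolding \<epsilon>_def by (intro soft_cut_limits(2)) auto
      then have "(\<lambda>n. soft_cut_deriv (\<epsilon> n) (\<psi> x) *\<^sub>R piecewise_gradient \<psi> x) \<longlonglongrightarrow> 1 *\<^sub>R piecewise_gradient \<psi> x"
        by (intro tendsto_scaleR tendsto_const)
      then show ?thesis by simp
    qed
    then have "(\<lambda>n. piecewise_gradient (\<eta> n) x) \<longlonglongrightarrow> \<psi> x *\<^sub>R D x + \<phi> x *\<^sub>R piecewise_gradient \<psi> x"
      unfolding g\<eta>[OF True ns] by (intro tendsto_add tendsto_scaleR lw tendsto_const)
    then show ?thesis
      using piecewise_gradient_product[OF \<psi> \<phi> D ns] True by (simp add: \<eta>0_def[abs_def])
  next
    case False
    then show ?thesis using out[OF False wC] out[OF False \<psi>] by (simp add: \<eta>_def[abs_def] \<eta>0_def[abs_def])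
  qed
  have pgm: "piecewise_gradient (\<eta> n) \<in> borel_measurable lebesgue" for n
    using lipschitz_C1_off_measurable[OF l] by (simp add: measurable_completion)
  have pgm0: "piecewise_gradient \<eta>0 \<in> borel_measurable lebesgue"
    using lipschitz_C1_off_measurable[OF l0] by (simp add: measurable_completion)
  have lipm: "h \<in> borel_measurable lebesgue" if lh: "lipschitz_C1_off skeleton h h'" for h h'
  proof -
    obtain L where "L-lipschitz_on UNIV h" using lh by (auto simp: lipschitz_C1_off_def)
    then have "h \<in> borel_measurable borel"
      by (rule borel_measurable_continuous_onI[OF lipschitz_on_continuous_on])
    then show ?thesis by (simp add: measurable_completion)
  qed
  have L1: "(\<lambda>n. LINT x|lebesgue. F x *\<^sub>R piecewise_gradient (\<eta> n) x) \<longlonglongrightarrow> (LINT x|lebesgue. F x *\<^sub>R piecewise_gradient \<eta>0 x)"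
  proof (rule tendsto_integral_bounded_convergence_scaleR_right[OF Fi pgm pgm0 b1])
    show "AE x in lebesgue. (\<lambda>n. piecewise_gradient (\<eta> n) x) \<longlonglongrightarrow> piecewise_gradient \<eta>0 x"
      using AE_not_skeleton by eventually_elim (rule lim1)
  qed
  have L2: "(\<lambda>n. LINT x|lebesgue. \<eta> n x *\<^sub>R H x) \<longlonglongrightarrow> (LINT x|lebesgue. \<eta>0 x *\<^sub>R H x)"
    by (rule tendsto_integral_bounded_convergence_scaleR[OF Hi lipm[OF l] lipm[OF l0] b2 AE_I2[OF lim2]])
  have locf: "(LINT x|lebesgue_on U. f x *\<^sub>R h x) = (LINT x|lebesgue. F x *\<^sub>R h x)" for h :: "'a \<Rightarrow> 'a"
    by (rule integral_lebesgue_on_local[OF Ul]) (auto simp: F_def)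
  have locg: "(LINT x|lebesgue_on U. h x *\<^sub>R g x) = (LINT x|lebesgue. h x *\<^sub>R H x)" for h :: "'a \<Rightarrow> real"
    by (rule integral_lebesgue_on_local[OF Ul]) (auto simp: H_def)
  have "(\<lambda>n. LINT x|lebesgue. F x *\<^sub>R piecewise_gradient (\<eta> n) x) \<longlonglongrightarrow> - (LINT x|lebesgue. \<eta>0 x *\<^sub>R H x)"
    using tendsto_minus[OF L2] eq unfolding locf locg by simp
  with L1 have "(LINT x|lebesgue. F x *\<^sub>R piecewise_gradient \<eta>0 x) = - (LINT x|lebesgue. \<eta>0 x *\<^sub>R H x)"
    by (rule LIMSEQ_unique)
  then show ?thesis unfolding locf locg by (simp add: \<eta>0_def[abs_def])
qed

text \<open>The product rule for the extension by zero of \<open>\<psi> * f\<close>: inserting the product rule for \<open>\<psi> * \<phi>\<close> into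
\<open>weak_gradient_vanishing_test\<close> and sorting the terms by \<open>\<phi>\<close> and its gradient.\<close>

theorem has_weak_gradient_localized:
  fixes f :: "'a \<Rightarrow> real"
  assumes \<psi>: "piecewise_C1 \<psi>" and nonneg: "\<And>x. x \<in> closure \<Omega> \<Longrightarrow> \<psi> x \<ge> 0"
    and U: "open U" "U \<subseteq> \<Omega>" and pos: "\<And>x. x \<in> \<Omega> \<Longrightarrow> \<psi> x \<noteq> 0 \<Longrightarrow> x \<in> U"
    and g: "has_weak_gradient U f g" and fi: "integrable (lebesgue_on U) f" and gi: "integrable (lebesgue_on U) g"
  shows "has_weak_gradient \<Omega> (\<lambda>x. if x \<in> U then \<psi> x * f x else 0)
    (\<lambda>x. if x \<in> U then \<psi> x *\<^sub>R g x + f x *\<^sub>R piecewise_gradient \<psi> x else 0)"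
proof -
  have Ul: "U \<in> sets lebesgue" using U by (simp add: borel_open)
  define F where "F x = indicator U x *\<^sub>R f x" for x
  define H where "H x = indicator U x *\<^sub>R g x" for x
  have Fi: "integrable lebesgue F" using fi Ul unfolding F_def[abs_def] by (subst (asm) integrable_restrict_space) auto
  have Hi: "integrable lebesgue H" using gi Ul unfolding H_def[abs_def] by (subst (asm) integrable_restrict_space) auto
  define p where "p x = indicator \<Omega> x * \<psi> x" for x
  define q where "q x = indicator \<Omega> x *\<^sub>R piecewise_gradient \<psi> x" for x
  note cut = piecewise_C1_cut_off[OF \<psi>, folded p_def q_def]
  note pm = cut(1) and qm = cut(2)
  obtain B B' where pb: "\<And>x. \<bar>p x\<bar> \<le> B" and qb: "\<And>x. norm (q x) \<le> B'"
    using cut(3,4) by blast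
  have pF: "integrable lebesgue (\<lambda>x. p x *\<^sub>R F x)" by (rule integrable_bounded_mult[OF Fi pm pb])
  have pH: "integrable lebesgue (\<lambda>x. p x *\<^sub>R H x)" by (rule integrable_bounded_mult[OF Hi pm pb])
  have qF: "integrable lebesgue (\<lambda>x. F x *\<^sub>R q x)" by (rule integrable_bounded_mult_right[OF Fi qm qb])
  have e1: "(if x \<in> U then \<psi> x * f x else 0) = p x *\<^sub>R F x" for x
    using U(2) by (auto simp: p_def F_def)
  have e2: "(if x \<in> U then \<psi> x *\<^sub>R g x + f x *\<^sub>R piecewise_gradient \<psi> x else 0) = p x *\<^sub>R H x + F x *\<^sub>R q x" for x
    using U(2) by (auto simp: p_def F_def H_def q_def)
  show ?thesis
    unfolding has_weak_gradient_def e1 e2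
  proof (intro conjI allI ballI impI)
    fix K assume K: "compact K \<and> K \<subseteq> \<Omega>"
    show "(\<lambda>x. p x *\<^sub>R F x) absolutely_integrable_on K"
      by (rule absolutely_integrable_on_compact[OF pF]) (use K in auto)
    show "(\<lambda>x. p x *\<^sub>R H x + F x *\<^sub>R q x) absolutely_integrable_on K"
      by (rule absolutely_integrable_on_compact[OF Bochner_Integration.integrable_add[OF pH qF]]) (use K in auto)
  next
    fix \<phi> D assume \<phi>: "\<phi> \<in> test_functions \<Omega>" and D: "\<forall>x. GDERIV \<phi> x :> D x"
    note tp = test_function_props[OF \<phi>] and tg = test_function_gradient[OF \<phi> D]
    obtain C C' where C: "\<And>x. \<bar>\<phi> x\<bar> \<le> C" "\<And>x. norm (D x) \<le> C'" using tg(3,4) by blast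
    note \<phi>m = tg(5) and Dm = tg(6)
    have i1: "integrable lebesgue (\<lambda>x. (p x *\<^sub>R F x) *\<^sub>R D x)"
      by (rule integrable_bounded_mult_right[OF pF Dm C(2)])
    have i2: "integrable lebesgue (\<lambda>x. \<phi> x *\<^sub>R (p x *\<^sub>R H x))"
      by (rule integrable_bounded_mult[OF pH \<phi>m C(1)])
    have i3: "integrable lebesgue (\<lambda>x. \<phi> x *\<^sub>R (F x *\<^sub>R q x))"
      by (rule integrable_bounded_mult[OF qF \<phi>m C(1)])
    have l: "lipschitz_C1_off skeleton (\<lambda>x. \<psi> x * \<phi> x) (piecewise_gradient (\<lambda>x. \<psi> x * \<phi> x))"
      by (rule piecewise_C1_test_product[OF \<psi> \<phi>])
    have m: "piecewise_gradient (\<lambda>x. \<psi> x * \<phi> x) \<in> borel_measurable lebesgue"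
      using lipschitz_C1_off_measurable[OF l] by (simp add: measurable_completion)
    have "(LINT x|lebesgue_on U. f x *\<^sub>R piecewise_gradient (\<lambda>x. \<psi> x * \<phi> x) x) =
        (LINT x|lebesgue. F x *\<^sub>R piecewise_gradient (\<lambda>x. \<psi> x * \<phi> x) x)"
      by (rule integral_lebesgue_on_local[OF Ul]) (auto simp: F_def)
    also have "\<dots> = (LINT x|lebesgue. (p x *\<^sub>R F x) *\<^sub>R D x + \<phi> x *\<^sub>R (F x *\<^sub>R q x))"
    proof (rule integral_cong_AE)
      show "AE x in lebesgue. F x *\<^sub>R piecewise_gradient (\<lambda>x. \<psi> x * \<phi> x) x =
          (p x *\<^sub>R F x) *\<^sub>R D x + \<phi> x *\<^sub>R (F x *\<^sub>R q x)"
        using AE_not_skeleton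
        by eventually_elim
           (subst piecewise_gradient_product[OF \<psi> \<phi> D], assumption,
            simp add: p_def q_def scaleR_add_right mult_ac)
    qed (use m pm qm \<phi>m Dm Fi in \<open>auto intro!: borel_measurable_scaleR borel_measurable_add borel_measurable_times\<close>)
    also have "\<dots> = (LINT x|lebesgue. (p x *\<^sub>R F x) *\<^sub>R D x) + (LINT x|lebesgue. \<phi> x *\<^sub>R (F x *\<^sub>R q x))"
      by (rule Bochner_Integration.integral_add[OF i1 i3])
    finally have 1: "(LINT x|lebesgue_on U. f x *\<^sub>R piecewise_gradient (\<lambda>x. \<psi> x * \<phi> x) x) =
        (LINT x|lebesgue. (p x *\<^sub>R F x) *\<^sub>R D x) + (LINT x|lebesgue. \<phi> x *\<^sub>R (F x *\<^sub>R q x))" .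
    have 2: "(LINT x|lebesgue_on U. (\<psi> x * \<phi> x) *\<^sub>R g x) = (LINT x|lebesgue. \<phi> x *\<^sub>R (p x *\<^sub>R H x))"
      using U(2) by (intro integral_lebesgue_on_local[OF Ul]) (auto simp: H_def p_def)
    have 3: "(LINT x|lebesgue_on \<Omega>. (p x *\<^sub>R F x) *\<^sub>R D x) = (LINT x|lebesgue. (p x *\<^sub>R F x) *\<^sub>R D x)"
      by (rule integral_lebesgue_on_local[OF domain_lebesgue]) (auto simp: p_def)
    have 4: "(LINT x|lebesgue_on \<Omega>. \<phi> x *\<^sub>R (p x *\<^sub>R H x + F x *\<^sub>R q x)) =
        (LINT x|lebesgue. \<phi> x *\<^sub>R (p x *\<^sub>R H x) + \<phi> x *\<^sub>R (F x *\<^sub>R q x))"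
      by (rule integral_lebesgue_on_local[OF domain_lebesgue]) (auto simp: p_def q_def scaleR_add_right)
    have 5: "(LINT x|lebesgue. \<phi> x *\<^sub>R (p x *\<^sub>R H x) + \<phi> x *\<^sub>R (F x *\<^sub>R q x)) =
        (LINT x|lebesgue. \<phi> x *\<^sub>R (p x *\<^sub>R H x)) + (LINT x|lebesgue. \<phi> x *\<^sub>R (F x *\<^sub>R q x))"
      by (rule Bochner_Integration.integral_add[OF i2 i3])
    show "(LINT x|lebesgue_on \<Omega>. (p x *\<^sub>R F x) *\<^sub>R D x) =
        - (LINT x|lebesgue_on \<Omega>. \<phi> x *\<^sub>R (p x *\<^sub>R H x + F x *\<^sub>R q x))"
      using weak_gradient_vanishing_test[OF \<psi> nonneg U pos g fi gi \<phi>] unfolding 1 2 3 4 5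
      by (simp add: algebra_simps eq_neg_iff_add_eq_0)
  qed
qed

end

section \<open>Barycentric coordinates and envelop functions on a triangular mesh\<close>

abbreviation corners :: "point set \<Rightarrow> point set" where
  "corners K \<equiv> {z. z extreme_point_of K}"

lemma triangle_corners:
  assumes "2 simplex K"
  shows "finite (corners K)" "\<not> affine_dependent (corners K)" "K = convex hull (corners K)"
    "affine hull (corners K) = UNIV" "corners K \<noteq> {}"
proof -
  obtain C where C: "\<not> affine_dependent C" "int (card C) = 2 + 1" "K = convex hull C"
    using assms by (auto simp: simplex_def)
  have eq: "corners K = C" using extreme_point_of_convex_hull_affine_independent[OF C(1)] C(3) by auto
  show "finite (corners K)" "\<not> affine_dependent (corners K)" "K = convex hull (corners K)"
    unfolding eq using C aff_independent_finite by auto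
  have "aff_dim C = 2" using aff_dim_affine_independent[OF C(1)] C(2) by simp
  then show "affine hull (corners K) = UNIV" unfolding eq using aff_dim_eq_full[of C] by simp
  show "corners K \<noteq> {}" unfolding eq using C(2) by auto
qed

text \<open>Two affine functions agree on an affine subspace.\<close>

lemma affine_eq_on_hull:
  fixes a b :: "'a::euclidean_space"
  assumes "\<And>w. w \<in> S \<Longrightarrow> a \<bullet> w + c = b \<bullet> w + d" "x \<in> affine hull S"
  shows "a \<bullet> x + c = b \<bullet> x + d"
proof -
  have "affine hull S \<subseteq> {x. (a - b) \<bullet> x = d - c}"
    using assms(1) by (intro hull_minimal affine_hyperplane) (force simp: inner_diff_left algebra_simps)
  then show ?thesis using assms(2) by (auto simp: inner_diff_left algebra_simps)
qed

text \<open>The differences to \<open>z\<close> are linearly independent, so a linear functional can be prescribed on them; the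
value \<open>- 1\<close> on all of them produces the zeros at the other corners.\<close>

lemma affine_function_with_corner_value:
  fixes C :: "'a::euclidean_space set"
  assumes "\<not> affine_dependent C" "z \<in> C"
  shows "\<exists>a c. \<forall>w\<in>C. a \<bullet> w + c = (if w = z then 1 else 0)"
proof -
  define B where "B = (\<lambda>x. - z + x) ` (C - {z})"
  have "independent B" using assms affine_dependent_iff_dependent2[of z C] by (simp add: B_def)
  then obtain g :: "'a \<Rightarrow> real" where g: "linear g" "\<forall>x\<in>B. g x = - 1"
    using linear_independent_extend[of B "\<lambda>_. - 1"] by blast
  \<comment> \<open>The adjoint represents the functional g as an inner product with a fixed vector.\<close>
  define a where "a = adjoint g 1"
  have ga: "g x = a \<bullet> x" for x using adjoint_works[OF g(1), of x 1] by (simp add: a_def inner_commute)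
  have "a \<bullet> w + (1 - a \<bullet> z) = (if w = z then 1 else 0)" if "w \<in> C" for w
  proof (cases "w = z")
    case False
    then have "g (- z + w) = - 1" using g(2) that by (auto simp: B_def)
    then show ?thesis using False by (simp add: ga inner_add_right inner_diff_right)
  qed simp
  then show ?thesis by blast
qed

lemma barycentric_eqI:
  assumes "2 simplex K" "\<And>w. w \<in> corners K \<Longrightarrow> a \<bullet> w + c = (if w = z then 1 else 0)"
  shows "barycentric K z = (\<lambda>x. a \<bullet> x + c)"
  unfolding barycentric_def
proof (rule the_equality)
  show "(\<exists>a' c'. (\<lambda>x. a \<bullet> x + c) = (\<lambda>x. a' \<bullet> x + c')) \<and>
      (\<forall>w. w extreme_point_of K \<longrightarrow> a \<bullet> w + c = (if w = z then 1 else 0))"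
    using assms(2) by blast
next
  fix l assume l: "(\<exists>a c. l = (\<lambda>x. a \<bullet> x + c)) \<and> (\<forall>w. w extreme_point_of K \<longrightarrow> l w = (if w = z then 1 else 0))"
  then obtain b d where bd: "l = (\<lambda>x. b \<bullet> x + d)" by blast
  have "b \<bullet> x + d = a \<bullet> x + c" for x
    by (rule affine_eq_on_hull[of "corners K"])
       (use l bd assms(2) triangle_corners(4)[OF assms(1)] in auto)
  then show "l = (\<lambda>x. a \<bullet> x + c)" unfolding bd by (rule ext)
qed

text \<open>The definition of \<open>barycentric\<close> makes sense for all points \<open>z\<close>, and at points that are no corners it
yields the zero function. This convention is what makes the statements below uniform in \<open>z\<close>.\<close>

lemma barycentric_affine:
  assumes "2 simplex K"
  obtains a c where "barycentric K z = (\<lambda>x. a \<bullet> x + c)" "\<forall>w\<in>corners K. a \<bullet> w + c = (if w = z then 1 else 0)"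
proof (cases "z \<in> corners K")
  case True
  obtain a c where ac: "\<forall>w\<in>corners K. a \<bullet> w + c = (if w = z then 1 else 0)"
    using affine_function_with_corner_value[OF triangle_corners(2)[OF assms] True] by blast
  show ?thesis by (rule that[OF barycentric_eqI[OF assms] ac]) (use ac in blast)
next
  case False
  have *: "\<forall>w\<in>corners K. (0::point) \<bullet> w + 0 = (if w = z then 1 else 0::real)" using False by auto
  show ?thesis by (rule that[OF barycentric_eqI[OF assms] *]) (use * in blast)
qed

lemma barycentric_non_corner: "2 simplex K \<Longrightarrow> z \<notin> corners K \<Longrightarrow> barycentric K z x = 0"
proof -
  assume K: "2 simplex K" and z: "z \<notin> corners K"
  have "barycentric K z = (\<lambda>x. 0 \<bullet> x + 0)"
    by (rule barycentric_eqI[OF K]) (use z in auto)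
  then show ?thesis by simp
qed

lemma barycentric_nonneg:
  assumes "2 simplex K" "x \<in> K"
  shows "barycentric K z x \<ge> 0"
proof -
  obtain a c where ac: "barycentric K z = (\<lambda>x. a \<bullet> x + c)" "\<forall>w\<in>corners K. a \<bullet> w + c = (if w = z then 1 else 0)"
    by (rule barycentric_affine[OF assms(1)])
  have "corners K \<subseteq> {x. a \<bullet> x \<ge> - c}"
  proof
    fix w assume "w \<in> corners K"
    then have "a \<bullet> w + c \<ge> 0" using ac(2) by auto
    then show "w \<in> {x. a \<bullet> x \<ge> - c}" by simp
  qed
  then have "convex hull corners K \<subseteq> {x. a \<bullet> x \<ge> - c}"
    by (intro hull_minimal convex_halfspace_ge)
  then have "a \<bullet> x \<ge> - c" using assms(2) triangle_corners(3)[OF assms(1)] by blast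
  then show ?thesis by (simp add: ac(1))
qed

text \<open>An affine function that is nonnegative on a neighbourhood of \<open>x\<close> and not constant is positive at \<open>x\<close>:
moving against its gradient decreases it further.\<close>

lemma barycentric_pos_interior:
  assumes K: "2 simplex K" and "z \<in> corners K" "x \<in> interior K"
  shows "barycentric K z x > 0"
proof -
  obtain a c where ac: "barycentric K z = (\<lambda>x. a \<bullet> x + c)" "\<forall>w\<in>corners K. a \<bullet> w + c = (if w = z then 1 else 0)"
    by (rule barycentric_affine[OF K])
  obtain e where e: "e > 0" "cball x e \<subseteq> K"
    using assms(3) by (meson mem_interior_cball)
  show ?thesis
  proof (cases "a = 0")
    case True
    then show ?thesis using ac assms(2) by auto
  next
    case False
    \<comment> \<open>The step has length e, so the point stays in the ball around x.\<close>
    define y where "y = x - (e / norm a) *\<^sub>R a"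
    have "y \<in> K" using e False by (intro subsetD[OF e(2)]) (auto simp: y_def dist_norm)
    then have "a \<bullet> y + c \<ge> 0" using barycentric_nonneg[OF K, of y z] by (simp add: ac(1))
    moreover have "a \<bullet> y = a \<bullet> x - e * norm a"
      using False by (simp add: y_def inner_diff_right dot_square_norm power2_eq_square)
    moreover have "e * norm a > 0" using e False by simp
    ultimately show ?thesis by (simp add: ac(1))
  qed
qed

text \<open>The barycentric coordinates at the corners sum to one, as an affine function is determined by its
values at the corners.\<close>

lemma barycentric_exists_pos:
  assumes K: "2 simplex K" and "x \<in> K"
  shows "\<exists>z\<in>corners K. barycentric K z x > 0"
proof (rule ccontr)
  assume "\<not> ?thesis"
  then have zero: "barycentric K z x = 0" if "z \<in> corners K" for z
    using barycentric_nonneg[OF assms, of z] that by force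
  have "\<forall>z. \<exists>a c. barycentric K z = (\<lambda>x. a \<bullet> x + c) \<and> (\<forall>w\<in>corners K. a \<bullet> w + c = (if w = z then 1 else 0))"
    using barycentric_affine[OF K] by metis
  then obtain a c where ac: "\<And>z. barycentric K z = (\<lambda>x. a z \<bullet> x + c z)"
      "\<And>z w. w \<in> corners K \<Longrightarrow> a z \<bullet> w + c z = (if w = z then 1 else 0)" by metis
  have "(\<Sum>z\<in>corners K. a z) \<bullet> x + (\<Sum>z\<in>corners K. c z) = 0 \<bullet> x + 1"
  proof (rule affine_eq_on_hull[of "corners K"])
    fix w assume w: "w \<in> corners K"
    have "(\<Sum>z\<in>corners K. a z) \<bullet> w + (\<Sum>z\<in>corners K. c z) = (\<Sum>z\<in>corners K. a z \<bullet> w + c z)"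
      by (simp only: inner_sum_left sum.distrib)
    also have "\<dots> = (\<Sum>z\<in>corners K. if w = z then 1 else 0)"
      by (intro sum.cong refl ac(2) w)
    also have "\<dots> = 1" using w triangle_corners(1)[OF K] by simp
    finally show "(\<Sum>z\<in>corners K. a z) \<bullet> w + (\<Sum>z\<in>corners K. c z) = 0 \<bullet> w + 1" by simp
  qed (simp add: triangle_corners(4)[OF K])
  moreover have "(\<Sum>z\<in>corners K. a z) \<bullet> x + (\<Sum>z\<in>corners K. c z) = (\<Sum>z\<in>corners K. barycentric K z x)"
    by (simp only: inner_sum_left sum.distrib ac(1))
  ultimately show False using zero by simp
qed

lemma barycentric_C1_piece:
  assumes "2 simplex K"
  shows "C1_piece S (barycentric K z)"
proof -
  obtain a c where ac: "barycentric K z = (\<lambda>x. a \<bullet> x + c)" by (rule barycentric_affine[OF assms])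
  show ?thesis
    by (rule C1_pieceI[where P="barycentric K z" and Q="\<lambda>x. a"])
       (auto simp: ac gderiv_def inner_commute intro!: derivative_eq_intros)
qed

lemma triangulation_face:
  assumes "triangulation \<T>" "K \<in> \<T>" "K' \<in> \<T>"
  shows "(K \<inter> K') face_of K" "(K \<inter> K') face_of K'"
proof -
  show "(K \<inter> K') face_of K" using assms unfolding triangulation_def by blast
  have "(K' \<inter> K) face_of K'" using assms unfolding triangulation_def by blast
  then show "(K \<inter> K') face_of K'" by (simp only: Int_commute)
qed

lemma glue_singleton: "glue {K} f x = (if x \<in> K then f K x else 0)"
proof -
  have "(SOME K'. K' \<in> {K} \<and> x \<in> K') = K" if "x \<in> K"
    by (rule some_equality) (use that in auto)
  then show ?thesis by (simp add: glue_def)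
qed

locale triangular_mesh =
  fixes \<T> :: "point set set"
  assumes triangulation: "triangulation \<T>" and triangle: "K \<in> \<T> \<Longrightarrow> 2 simplex K"
begin

lemma finite_mesh: "finite \<T>"
  using triangulation by (simp add: triangulation_def)

lemma corner_of_face: "F face_of K \<Longrightarrow> z \<in> corners F \<longleftrightarrow> z \<in> corners K \<and> z \<in> F"
  using extreme_point_of_face by blast

lemma face_hull_corners:
  assumes "K \<in> \<T>" "F face_of K"
  shows "F = convex hull corners F" "finite (corners F)"
proof -
  have "compact F" using face_of_imp_compact compact_simplex[OF triangle[OF assms(1)]] convex_simplex[OF triangle[OF assms(1)]] assms(2) by blast
  moreover have "convex F" using assms(2) by (rule face_of_imp_convex)
  ultimately show "F = convex hull corners F" by (rule Krein_Milman_Minkowski)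
  show "finite (corners F)"
    by (rule finite_subset[OF _ triangle_corners(1)[OF triangle[OF assms(1)]]])
       (use corner_of_face[OF assms(2)] in blast)
qed

text \<open>By conformity the intersection is a common face, hence the convex hull of corners common to both
triangles, and there the two affine functions have the same values. For \<open>z\<close> a corner of \<open>K\<close> outside
the common face both vanish on the face.\<close>

lemma barycentric_consistent:
  assumes K: "K \<in> \<T>" "K' \<in> \<T>" and x: "x \<in> K" "x \<in> K'"
  shows "barycentric K z x = barycentric K' z x"
proof -
  note f = triangulation_face[OF triangulation K]
  obtain a c where ac: "barycentric K z = (\<lambda>x. a \<bullet> x + c)" "\<forall>w\<in>corners K. a \<bullet> w + c = (if w = z then 1 else 0)"
    by (rule barycentric_affine[OF triangle[OF K(1)]])
  obtain b d where bd: "barycentric K' z = (\<lambda>x. b \<bullet> x + d)" "\<forall>w\<in>corners K'. b \<bullet> w + d = (if w = z then 1 else 0)"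
    by (rule barycentric_affine[OF triangle[OF K(2)]])
  have "a \<bullet> x + c = b \<bullet> x + d"
  proof (rule affine_eq_on_hull[of "corners (K \<inter> K')"])
    fix w assume "w \<in> corners (K \<inter> K')"
    then show "a \<bullet> w + c = b \<bullet> w + d"
      using corner_of_face[OF f(1), of w] corner_of_face[OF f(2), of w] ac(2) bd(2) by simp
  next
    have "x \<in> convex hull corners (K \<inter> K')"
      using face_hull_corners(1)[OF K(1) f(1)] x by blast
    then show "x \<in> affine hull corners (K \<inter> K')"
      using convex_hull_subset_affine_hull by blast
  qed
  then show ?thesis by (simp add: ac bd)
qed

text \<open>If all corners of a face \<open>F\<close> of \<open>K0\<close> are corners of \<open>K\<close>, then \<open>F\<close> lies in \<open>K \<inter> K0\<close>, which is a face
of \<open>K\<close> by conformity.\<close>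

lemma face_of_if_corners:
  assumes K: "K0 \<in> \<T>" "K \<in> \<T>" and F: "F face_of K0" "corners F \<subseteq> corners K"
  shows "F face_of K"
proof -
  have "F = convex hull corners F" by (rule face_hull_corners(1)[OF K(1) F(1)])
  also have "\<dots> \<subseteq> convex hull corners K" by (rule hull_mono[OF F(2)])
  also have "\<dots> = K" using triangle_corners(3)[OF triangle[OF K(2)]] by simp
  finally have "F \<subseteq> K \<inter> K0" using face_of_imp_subset[OF F(1)] by blast
  then have "F face_of (K \<inter> K0)" by (intro face_of_subset[OF F(1)]) auto
  then show ?thesis using triangulation_face(1)[OF triangulation K(2,1)] by (rule face_of_trans)
qed

text \<open>On triangles that do not have \<open>F\<close> as a face, some corner of \<open>F\<close> is no corner of the triangle. The
corresponding factor vanishes there, in accordance with the extension by zero.\<close>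

lemma glue_face:
  assumes K0: "K0 \<in> \<T>" "F face_of K0" and x: "K \<in> \<T>" "x \<in> K"
  shows "glue {K \<in> \<T>. F face_of K} (\<lambda>K x. \<Prod>z\<in>corners F. barycentric K z x) x =
    (\<Prod>z\<in>corners F. barycentric K z x)"
proof (cases "x \<in> \<Union>{K \<in> \<T>. F face_of K}")
  case True
  define K' where "K' = (SOME K. K \<in> {K \<in> \<T>. F face_of K} \<and> x \<in> K)"
  have K': "K' \<in> {K \<in> \<T>. F face_of K} \<and> x \<in> K'"
    unfolding K'_def by (rule someI_ex) (use True in blast)
  have "barycentric K' z x = barycentric K z x" for z
    using K' x by (intro barycentric_consistent) auto
  then show ?thesis using True by (simp add: glue_def K'_def)
next
  case False
  then have "\<not> F face_of K" using x by blast
  then obtain z where z: "z \<in> corners F" "z \<notin> corners K"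
    using face_of_if_corners[OF K0(1) x(1) K0(2)] by blast
  have "(\<Prod>z\<in>corners F. barycentric K z x) = 0"
    using z barycentric_non_corner[OF triangle[OF x(1)] z(2)] face_hull_corners(2)[OF K0]
    by (intro prod_zero) auto
  then show ?thesis using False by (simp add: glue_def)
qed

text \<open>Vertices, edges and triangles are all faces, and the three kinds of envelop functions
are instances of one construction. For a triangle as a face, dimension leaves only
the triangle itself.\<close>

lemma envelop_eq_glue:
  assumes "f \<in> envelop_functions \<T>"
  obtains F K0 where "K0 \<in> \<T>" "F face_of K0"
    "f = glue {K \<in> \<T>. F face_of K} (\<lambda>K x. \<Prod>z\<in>corners F. barycentric K z x)"
proof -
  consider (V) Z where "Z \<in> vertices \<T>" "f = vertex_envelop \<T> Z"
    | (E) E where "E \<in> edges \<T>" "f = edge_envelop \<T> E" | (T) K where "K \<in> \<T>" "f = triangle_envelop K"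
    using assms unfolding envelop_functions_def by blast
  then show thesis
  proof cases
    case V
    then obtain K0 where K0: "K0 \<in> \<T>" "{Z} face_of K0" by (auto simp: vertices_def face_of_singleton)
    show ?thesis
      by (rule that[OF K0]) (simp add: V(2) vertex_envelop_def face_of_singleton)
  next
    case E
    then obtain K0 where K0: "K0 \<in> \<T>" "E face_of K0" "aff_dim E = 1" by (auto simp: edges_def edge_of_def)
    show ?thesis
      by (rule that[OF K0(1,2)]) (simp add: E(2) edge_envelop_def edge_of_def K0(3))
  next
    case T
    have "K face_of K" using convex_simplex[OF triangle[OF T(1)]] by (rule face_of_refl)
    have "K' = K" if "K' \<in> \<T>" "K face_of K'" for K'
    proof (rule ccontr)
      assume "K' \<noteq> K"
      then have "aff_dim K < aff_dim K'"
        using face_of_aff_dim_lt[OF convex_simplex[OF triangle[OF that(1)]] that(2)] by simp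
      then show False
        using triangle[OF that(1)] triangle[OF T(1)] by (simp add: aff_dim_simplex)
    qed
    then have "{K' \<in> \<T>. K face_of K'} = {K}" using T(1) \<open>K face_of K\<close> by blast
    then show ?thesis
      by (intro that[OF T(1) \<open>K face_of K\<close>]) (simp add: T(2) triangle_envelop_def fun_eq_iff glue_singleton)
  qed
qed

text \<open>The set \<open>Z\<close> does not depend on the triangle: this gives continuity across
the edges and smoothness on each closed triangle at once.\<close>

lemma envelop_on_tiles:
  assumes "f \<in> envelop_functions \<T>"
  obtains Z where "finite Z" "\<forall>K\<in>\<T>. \<forall>x\<in>K. f x = (\<Prod>z\<in>Z. barycentric K z x)"
    "\<forall>x. x \<notin> \<Union>\<T> \<longrightarrow> f x = 0"
proof -
  obtain F K0 where F: "K0 \<in> \<T>" "F face_of K0"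
    "f = glue {K \<in> \<T>. F face_of K} (\<lambda>K x. \<Prod>z\<in>corners F. barycentric K z x)"
    by (rule envelop_eq_glue[OF assms])
  show thesis
  proof (rule that[OF face_hull_corners(2)[OF F(1,2)]])
    show "\<forall>K\<in>\<T>. \<forall>x\<in>K. f x = (\<Prod>z\<in>corners F. barycentric K z x)"
      unfolding F(3) using glue_face[OF F(1,2)] by blast
    show "\<forall>x. x \<notin> \<Union>\<T> \<longrightarrow> f x = 0"
      unfolding F(3) glue_def by auto
  qed
qed

lemma envelop_C1_piece:
  assumes "f \<in> envelop_functions \<T>" "K \<in> \<T>"
  shows "C1_piece K f"
proof -
  obtain Z where "\<forall>K\<in>\<T>. \<forall>x\<in>K. f x = (\<Prod>z\<in>Z. barycentric K z x)"
    by (rule envelop_on_tiles[OF assms(1)])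
  moreover have "C1_piece K (\<lambda>x. \<Prod>z\<in>Z. barycentric K z x)"
    by (intro C1_piece_prod barycentric_C1_piece triangle assms(2))
  ultimately show ?thesis using assms(2) by (metis (no_types, lifting) C1_piece_cong)
qed

lemma envelop_nonneg:
  assumes "f \<in> envelop_functions \<T>"
  shows "f x \<ge> 0"
proof -
  obtain Z where Z: "\<forall>K\<in>\<T>. \<forall>x\<in>K. f x = (\<Prod>z\<in>Z. barycentric K z x)" "\<forall>x. x \<notin> \<Union>\<T> \<longrightarrow> f x = 0"
    by (rule envelop_on_tiles[OF assms(1)])
  show ?thesis
  proof (cases "x \<in> \<Union>\<T>")
    case True
    then obtain K where K: "K \<in> \<T>" "x \<in> K" by blast
    then have "f x = (\<Prod>z\<in>Z. barycentric K z x)" using Z(1) by blast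
    also have "\<dots> \<ge> 0" by (intro prod_nonneg ballI barycentric_nonneg triangle K)
    finally show ?thesis .
  qed (use Z in auto)
qed

text \<open>Either every factor belongs to a corner of \<open>K\<close>, or one of the factors vanishes
identically on \<open>K\<close>.\<close>

lemma envelop_dichotomy:
  assumes "f \<in> envelop_functions \<T>" "K \<in> \<T>"
  shows "(\<forall>x\<in>K. f x = 0) \<or> (\<forall>x\<in>interior K. f x > 0)"
proof -
  obtain Z where Z: "finite Z" "\<forall>K\<in>\<T>. \<forall>x\<in>K. f x = (\<Prod>z\<in>Z. barycentric K z x)"
    by (rule envelop_on_tiles[OF assms(1)])
  have fK: "f x = (\<Prod>z\<in>Z. barycentric K z x)" if "x \<in> K" for x using Z(2) assms(2) that by blast
  show ?thesis
  proof (cases "Z \<subseteq> corners K")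
    case True
    have "f x > 0" if "x \<in> interior K" for x
    proof -
      have "x \<in> K" using that interior_subset by blast
      then have "f x = (\<Prod>z\<in>Z. barycentric K z x)" by (rule fK)
      also have "\<dots> > 0"
        using True by (intro prod_pos ballI barycentric_pos_interior[OF triangle[OF assms(2)] _ that]) auto
      finally show ?thesis .
    qed
    then show ?thesis by blast
  next
    case False
    then obtain z where z: "z \<in> Z" "z \<notin> corners K" by blast
    have "f x = 0" if "x \<in> K" for x
      unfolding fK[OF that]
      using Z(1) z barycentric_non_corner[OF triangle[OF assms(2)] z(2)] by (intro prod_zero) auto
    then show ?thesis by blast
  qed
qed

lemma vertex_envelop_on_tile:
  assumes "Z \<in> vertices \<T>" "K \<in> \<T>" "x \<in> K"
  shows "vertex_envelop \<T> Z x = barycentric K Z x"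
proof -
  obtain K0 where K0: "K0 \<in> \<T>" "{Z} face_of K0" using assms(1) by (auto simp: vertices_def face_of_singleton)
  show ?thesis
    using glue_face[OF K0 assms(2,3)] by (simp add: vertex_envelop_def face_of_singleton)
qed

lemma finite_envelop: "finite (envelop_functions \<T>)"
proof -
  have "vertices \<T> = (\<Union>K\<in>\<T>. corners K)" by (auto simp: vertices_def)
  then have "finite (vertices \<T>)"
    using finite_mesh triangle_corners(1)[OF triangle] by simp
  moreover have "edges \<T> \<subseteq> (\<Union>K\<in>\<T>. {F. F face_of K})" by (auto simp: edges_def edge_of_def)
  then have "finite (edges \<T>)"
    by (rule finite_subset) (use finite_mesh finite_polytope_faces simplex_imp_polytope triangle in auto)
  ultimately show ?thesis using finite_mesh by (simp add: envelop_functions_def)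
qed

lemma envelop_sum_pos:
  assumes "x \<in> \<Union>\<T>"
  shows "(\<Sum>f\<in>envelop_functions \<T>. f x) > 0"
proof -
  obtain K where K: "K \<in> \<T>" "x \<in> K" using assms by blast
  obtain z where z: "z \<in> corners K" "barycentric K z x > 0"
    using barycentric_exists_pos[OF triangle[OF K(1)] K(2)] by blast
  have zv: "z \<in> vertices \<T>" using z(1) K(1) by (auto simp: vertices_def)
  have "vertex_envelop \<T> z x > 0" using vertex_envelop_on_tile[OF zv K] z(2) by simp
  moreover have "vertex_envelop \<T> z \<in> envelop_functions \<T>" using zv by (simp add: envelop_functions_def)
  ultimately show ?thesis
    using envelop_nonneg by (intro sum_pos2[OF finite_envelop]) auto
qed

end

section \<open>Calculus of weak gradients and square integrable functions\<close>

text \<open>Only local integrability of \<open>f\<close> and \<open>g\<close> is known, but test functions have compact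
support. Integrability is what allows splitting the integrals in the defining identity.\<close>

lemma weak_gradient_test_integrable:
  fixes f :: "'a::euclidean_space \<Rightarrow> real"
  assumes U: "open U" and g: "has_weak_gradient U f g" and \<phi>: "\<phi> \<in> test_functions U" "\<forall>x. GDERIV \<phi> x :> D x"
  shows "integrable (lebesgue_on U) (\<lambda>x. f x *\<^sub>R D x)" "integrable (lebesgue_on U) (\<lambda>x. \<phi> x *\<^sub>R g x)"
proof -
  note tp = test_function_props[OF \<phi>(1)] and tg = test_function_gradient[OF \<phi>]
  define S where "S = support \<phi>"
  have S: "compact S" "S \<subseteq> U" using tp by (auto simp: S_def)
  have zD: "D x = 0" if "x \<notin> S" for x using tg(2)[of x] that by (simp add: S_def)
  have z\<phi>: "\<phi> x = 0" if "x \<notin> S" for x using tp(5)[of x] that by (simp add: S_def)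
  have Ul: "U \<in> sets lebesgue" using U by (simp add: borel_open)
  have a: "f absolutely_integrable_on S" "g absolutely_integrable_on S"
    using g S unfolding has_weak_gradient_def by blast+
  obtain C C' where C: "\<And>x. \<bar>\<phi> x\<bar> \<le> C" "\<And>x. norm (D x) \<le> C'" using tg(3,4) by blast
  note \<phi>m = tg(5) and Dm = tg(6)
  have "integrable lebesgue (\<lambda>x. (indicator S x *\<^sub>R f x) *\<^sub>R D x)"
    by (rule integrable_bounded_mult_right[OF integrable_indicator_scaleR_compact[OF a(1)] Dm C(2)])
  moreover have "integrable (lebesgue_on U) (\<lambda>x. f x *\<^sub>R D x) \<longleftrightarrow> integrable lebesgue (\<lambda>x. (indicator S x *\<^sub>R f x) *\<^sub>R D x)"
    by (rule integrable_lebesgue_on_local[OF Ul]) (use S(2) zD in \<open>auto simp: indicator_def\<close>)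
  ultimately show "integrable (lebesgue_on U) (\<lambda>x. f x *\<^sub>R D x)" by blast
  have "integrable lebesgue (\<lambda>x. \<phi> x *\<^sub>R (indicator S x *\<^sub>R g x))"
    by (rule integrable_bounded_mult[OF integrable_indicator_scaleR_compact[OF a(2)] \<phi>m C(1)])
  moreover have "integrable (lebesgue_on U) (\<lambda>x. \<phi> x *\<^sub>R g x) \<longleftrightarrow> integrable lebesgue (\<lambda>x. \<phi> x *\<^sub>R (indicator S x *\<^sub>R g x))"
    by (rule integrable_lebesgue_on_local[OF Ul]) (use S(2) z\<phi> in \<open>auto simp: indicator_def\<close>)
  ultimately show "integrable (lebesgue_on U) (\<lambda>x. \<phi> x *\<^sub>R g x)" by blast
qed

lemma has_weak_gradient_add:
  fixes f f' :: "'a::euclidean_space \<Rightarrow> real"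
  assumes U: "open U" and g: "has_weak_gradient U f g" "has_weak_gradient U f' g'"
  shows "has_weak_gradient U (\<lambda>x. f x + f' x) (\<lambda>x. g x + g' x)"
  unfolding has_weak_gradient_def
proof (intro conjI allI ballI impI)
  fix K assume K: "compact K \<and> K \<subseteq> U"
  show "(\<lambda>x. f x + f' x) absolutely_integrable_on K"
    using K g unfolding has_weak_gradient_def by (intro set_integral_add) auto
  show "(\<lambda>x. g x + g' x) absolutely_integrable_on K"
    using K g unfolding has_weak_gradient_def by (intro set_integral_add) auto
next
  fix \<phi> D assume \<phi>: "\<phi> \<in> test_functions U" "\<forall>x. GDERIV \<phi> x :> D x"
  note i = weak_gradient_test_integrable[OF U g(1) \<phi>] and i' = weak_gradient_test_integrable[OF U g(2) \<phi>]
  have "(LINT x|lebesgue_on U. f x *\<^sub>R D x) = - (LINT x|lebesgue_on U. \<phi> x *\<^sub>R g x)"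
      "(LINT x|lebesgue_on U. f' x *\<^sub>R D x) = - (LINT x|lebesgue_on U. \<phi> x *\<^sub>R g' x)"
    using g \<phi> unfolding has_weak_gradient_def by blast+
  then show "(LINT x|lebesgue_on U. (f x + f' x) *\<^sub>R D x) = - (LINT x|lebesgue_on U. \<phi> x *\<^sub>R (g x + g' x))"
    unfolding scaleR_add_left scaleR_add_right using i i' by simp
qed

lemma has_weak_gradient_uminus:
  fixes f :: "'a::euclidean_space \<Rightarrow> real"
  assumes "has_weak_gradient U f g"
  shows "has_weak_gradient U (\<lambda>x. - f x) (\<lambda>x. - g x)"
  using assms unfolding has_weak_gradient_def by (auto simp: set_integrable_def)

lemma has_weak_gradient_diff:
  fixes f f' :: "'a::euclidean_space \<Rightarrow> real"
  assumes "open U" "has_weak_gradient U f g" "has_weak_gradient U f' g'"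
  shows "has_weak_gradient U (\<lambda>x. f x - f' x) (\<lambda>x. g x - g' x)"
  using has_weak_gradient_add[OF assms(1,2) has_weak_gradient_uminus[OF assms(3)]] by simp

lemma has_weak_gradient_zero: "has_weak_gradient U (\<lambda>x. 0) (\<lambda>x. 0)"
  unfolding has_weak_gradient_def by (auto simp: set_integrable_def)

lemma has_weak_gradient_sum:
  fixes f :: "'i \<Rightarrow> 'a::euclidean_space \<Rightarrow> real"
  assumes "open U" "finite I" "\<And>i. i \<in> I \<Longrightarrow> has_weak_gradient U (f i) (g i)"
  shows "has_weak_gradient U (\<lambda>x. \<Sum>i\<in>I. f i x) (\<lambda>x. \<Sum>i\<in>I. g i x)"
  using assms(2,3)
  by (induction I rule: finite_induct) (auto intro: has_weak_gradient_zero has_weak_gradient_add[OF assms(1)])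

lemma has_weak_gradient_cong:
  fixes f :: "'a::euclidean_space \<Rightarrow> real"
  assumes "open U" "has_weak_gradient U f g" "\<And>x. x \<in> U \<Longrightarrow> f x = f' x"
  shows "has_weak_gradient U f' g"
  unfolding has_weak_gradient_def
proof (intro conjI allI ballI impI)
  fix K assume K: "compact K \<and> K \<subseteq> U"
  then have "f absolutely_integrable_on K" using assms(2) unfolding has_weak_gradient_def by blast
  moreover have "(\<lambda>x. indicator K x *\<^sub>R f x) = (\<lambda>x. indicator K x *\<^sub>R f' x)"
    using K assms(3) by (intro ext) (auto split: split_indicator)
  ultimately show "f' absolutely_integrable_on K" by (simp add: set_integrable_def)
  show "g absolutely_integrable_on K" using K assms(2) unfolding has_weak_gradient_def by blast
next
  fix \<phi> D assume \<phi>: "\<phi> \<in> test_functions U" "\<forall>x. GDERIV \<phi> x :> D x"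
  have "(LINT x|lebesgue_on U. f' x *\<^sub>R D x) = (LINT x|lebesgue_on U. f x *\<^sub>R D x)"
    by (rule Bochner_Integration.integral_cong) (use assms(3) in auto)
  also have "\<dots> = - (LINT x|lebesgue_on U. \<phi> x *\<^sub>R g x)"
    using assms(2) \<phi> unfolding has_weak_gradient_def by blast
  finally show "(LINT x|lebesgue_on U. f' x *\<^sub>R D x) = - (LINT x|lebesgue_on U. \<phi> x *\<^sub>R g x)" .
qed

lemma has_weak_gradient_subset:
  fixes f :: "'a::euclidean_space \<Rightarrow> real"
  assumes U: "open U" and V: "open V" "V \<subseteq> U" and g: "has_weak_gradient U f g"
  shows "has_weak_gradient V f g"
  unfolding has_weak_gradient_def
proof (intro conjI allI ballI impI)
  fix K assume "compact K \<and> K \<subseteq> V"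
  then have "compact K \<and> K \<subseteq> U" using V by blast
  then show "f absolutely_integrable_on K" "g absolutely_integrable_on K"
    using g unfolding has_weak_gradient_def by blast+
next
  fix \<phi> D assume \<phi>: "\<phi> \<in> test_functions V" and D: "\<forall>x. GDERIV \<phi> x :> D x"
  note tp = test_function_props[OF \<phi>] and tg = test_function_gradient[OF \<phi> D]
  have \<phi>U: "\<phi> \<in> test_functions U" using \<phi> V(2) by (auto simp: test_functions_def)
  have l: "U \<in> sets lebesgue" "V \<in> sets lebesgue" using U V by (auto simp: borel_open)
  have zD: "D x = 0" if "x \<notin> V" for x using that tp(4) tg(2) by blast
  have z\<phi>: "\<phi> x = 0" if "x \<notin> V" for x using that tp(4,5) by blast
  have "(LINT x|lebesgue_on V. f x *\<^sub>R D x) = (LINT x|lebesgue. f x *\<^sub>R D x)"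
    by (rule integral_lebesgue_on_local[OF l(2)]) (auto simp: zD)
  also have "\<dots> = (LINT x|lebesgue_on U. f x *\<^sub>R D x)"
    by (rule integral_lebesgue_on_local[OF l(1), symmetric]) (use V(2) zD in auto)
  also have "\<dots> = - (LINT x|lebesgue_on U. \<phi> x *\<^sub>R g x)"
    using g \<phi>U D unfolding has_weak_gradient_def by blast
  also have "(LINT x|lebesgue_on U. \<phi> x *\<^sub>R g x) = (LINT x|lebesgue. \<phi> x *\<^sub>R g x)"
    by (rule integral_lebesgue_on_local[OF l(1)]) (use V(2) z\<phi> in auto)
  also have "\<dots> = (LINT x|lebesgue_on V. \<phi> x *\<^sub>R g x)"
    by (rule integral_lebesgue_on_local[OF l(2), symmetric]) (auto simp: z\<phi>)
  finally show "(LINT x|lebesgue_on V. f x *\<^sub>R D x) = - (LINT x|lebesgue_on V. \<phi> x *\<^sub>R g x)" .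
qed

lemma has_weak_gradient_weak_gradient:
  "has_weak_gradient U f g \<Longrightarrow> has_weak_gradient U f (weak_gradient U f)"
  unfolding weak_gradient_def by (rule someI[of "has_weak_gradient U f"])

text \<open>This rests on completeness of Lebesgue measure. It is needed since a weak
gradient picked by choice is only known up to null sets.\<close>

lemma borel_measurable_lebesgue_AE:
  fixes F G :: "'a::euclidean_space \<Rightarrow> 'b::euclidean_space"
  assumes "F \<in> borel_measurable lebesgue" "AE x in lebesgue. F x = G x"
  shows "G \<in> borel_measurable lebesgue"
proof (rule measurableI)
  fix A :: "'b set" assume A: "A \<in> sets borel"
  show "G -` A \<inter> space lebesgue \<in> sets lebesgue"
  proof (rule completion.in_sets_AE)
    show "F -` A \<inter> space lebesgue \<in> sets lebesgue" using assms(1) A by (rule measurable_sets)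
    show "AE x in lebesgue. (x \<in> F -` A \<inter> space lebesgue) = (x \<in> G -` A \<inter> space lebesgue)"
      using assms(2) by eventually_elim simp
  qed simp
qed simp

text \<open>Elements of \<open>L2 U\<close> correspond to functions on the whole space that vanish outside \<open>U\<close>.\<close>

definition square_integrable :: "('a::euclidean_space \<Rightarrow> 'b::euclidean_space) \<Rightarrow> bool" where
  "square_integrable F \<longleftrightarrow> F \<in> borel_measurable lebesgue \<and> integrable lebesgue (\<lambda>x. (norm (F x))\<^sup>2)"

lemma L2_iff:
  assumes "U \<in> sets lebesgue"
  shows "f \<in> L2 U \<longleftrightarrow> square_integrable (\<lambda>x. indicator U x *\<^sub>R f x)"
proof -
  have "(norm (indicator U x *\<^sub>R f x))\<^sup>2 = indicator U x *\<^sub>R (norm (f x))\<^sup>2" for x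
    by (simp split: split_indicator)
  then show ?thesis
    using assms by (simp add: L2_def square_integrable_def borel_measurable_restrict_space_iff integrable_restrict_space)
qed

lemma L2_norm_squared:
  assumes "U \<in> sets lebesgue"
  shows "(L2_norm U f)\<^sup>2 = (LINT x|lebesgue. (norm (indicator U x *\<^sub>R f x))\<^sup>2)"
proof -
  have "(norm (indicator U x *\<^sub>R f x))\<^sup>2 = indicator U x *\<^sub>R (norm (f x))\<^sup>2" for x
    by (simp split: split_indicator)
  then show ?thesis
    using assms by (simp add: L2_norm_def integral_restrict_space)
qed

lemma norm_add_squared_le:
  fixes a b :: "'b::real_normed_vector"
  shows "(norm (a + b))\<^sup>2 \<le> 2 * (norm a)\<^sup>2 + 2 * (norm b)\<^sup>2"
proof -
  have "(norm (a + b))\<^sup>2 \<le> (norm a + norm b)\<^sup>2"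
    by (intro power_mono norm_triangle_ineq) simp
  also have "\<dots> \<le> 2 * (norm a)\<^sup>2 + 2 * (norm b)\<^sup>2"
    using zero_le_power2[of "norm a - norm b"] by (simp add: power2_eq_square algebra_simps)
  finally show ?thesis .
qed

lemma square_integrable_bound:
  assumes "F \<in> borel_measurable lebesgue" "integrable lebesgue h" "AE x in lebesgue. (norm (F x))\<^sup>2 \<le> h x"
  shows "square_integrable F"
  unfolding square_integrable_def
proof
  show "integrable lebesgue (\<lambda>x. (norm (F x))\<^sup>2)"
  proof (rule Bochner_Integration.integrable_bound[OF assms(2)])
    show "AE x in lebesgue. norm ((norm (F x))\<^sup>2) \<le> norm (h x)"
      using assms(3) by eventually_elim auto
  qed (use assms(1) in measurable)
qed (rule assms(1))

lemma square_integrable_add: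
  assumes "square_integrable F" "square_integrable G"
  shows "square_integrable (\<lambda>x. F x + G x)"
proof (rule square_integrable_bound)
  show "(\<lambda>x. F x + G x) \<in> borel_measurable lebesgue"
    using assms by (auto simp: square_integrable_def)
  show "integrable lebesgue (\<lambda>x. 2 * (norm (F x))\<^sup>2 + 2 * (norm (G x))\<^sup>2)"
    using assms by (auto simp: square_integrable_def)
qed (simp add: norm_add_squared_le)

lemma square_integrable_zero: "square_integrable (\<lambda>x. 0)"
  by (simp add: square_integrable_def)

lemma square_integrable_sum:
  "finite I \<Longrightarrow> (\<And>i. i \<in> I \<Longrightarrow> square_integrable (F i)) \<Longrightarrow> square_integrable (\<lambda>x. \<Sum>i\<in>I. F i x)"
  by (induction I rule: finite_induct) (auto intro: square_integrable_add square_integrable_zero)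

lemma square_integrable_mult:
  assumes F: "square_integrable F" and d: "d \<in> borel_measurable lebesgue" "\<And>x. \<bar>d x\<bar> \<le> B"
  shows "square_integrable (\<lambda>x. d x *\<^sub>R F x)"
proof (rule square_integrable_bound)
  show "(\<lambda>x. d x *\<^sub>R F x) \<in> borel_measurable lebesgue"
    using F d by (auto simp: square_integrable_def intro: borel_measurable_scaleR)
  show "integrable lebesgue (\<lambda>x. B\<^sup>2 * (norm (F x))\<^sup>2)"
    using F by (auto simp: square_integrable_def)
  have "\<bar>d x\<bar>\<^sup>2 \<le> B\<^sup>2" for x using d(2)[of x] by (intro power_mono) auto
  then show "AE x in lebesgue. (norm (d x *\<^sub>R F x))\<^sup>2 \<le> B\<^sup>2 * (norm (F x))\<^sup>2"
    by (auto simp: power_mult_distrib intro!: mult_right_mono)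
qed

lemma square_integrable_mult_right:
  fixes F :: "'a::euclidean_space \<Rightarrow> real"
  assumes F: "square_integrable F" and d: "d \<in> borel_measurable lebesgue" "\<And>x. norm (d x) \<le> B"
  shows "square_integrable (\<lambda>x. F x *\<^sub>R d x)"
proof (rule square_integrable_bound)
  show "(\<lambda>x. F x *\<^sub>R d x) \<in> borel_measurable lebesgue"
    using F d by (auto simp: square_integrable_def intro: borel_measurable_scaleR)
  show "integrable lebesgue (\<lambda>x. (norm (F x))\<^sup>2 * B\<^sup>2)"
    using F by (auto simp: square_integrable_def)
  have "(norm (d x))\<^sup>2 \<le> B\<^sup>2" for x using d(2)[of x] by (intro power_mono) auto
  then show "AE x in lebesgue. (norm (F x *\<^sub>R d x))\<^sup>2 \<le> (norm (F x))\<^sup>2 * B\<^sup>2"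
    by (auto simp: power_mult_distrib intro!: mult_left_mono)
qed

lemma square_integrable_cong_AE:
  assumes "square_integrable F" "AE x in lebesgue. F x = G x"
  shows "square_integrable G" "(LINT x|lebesgue. (norm (G x))\<^sup>2) = (LINT x|lebesgue. (norm (F x))\<^sup>2)"
proof -
  have F: "F \<in> borel_measurable lebesgue" using assms(1) by (simp add: square_integrable_def)
  have G: "G \<in> borel_measurable lebesgue" by (rule borel_measurable_lebesgue_AE[OF F assms(2)])
  show "square_integrable G"
    by (rule square_integrable_bound[OF G, where h="\<lambda>x. (norm (F x))\<^sup>2"])
       (use assms in \<open>auto simp: square_integrable_def\<close>)
  show "(LINT x|lebesgue. (norm (G x))\<^sup>2) = (LINT x|lebesgue. (norm (F x))\<^sup>2)"
    by (rule integral_cong_AE) (use F G assms(2) in \<open>auto elim: eventually_mono\<close>)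
qed

lemma square_integrable_imp_integrable:
  assumes "square_integrable F" "bounded S" "\<And>x. x \<notin> S \<Longrightarrow> F x = 0"
  shows "integrable lebesgue F"
proof -
  obtain a where ab: "S \<subseteq> cbox (- a) a" using bounded_subset_cbox_symmetric[OF assms(2)] by metis
  define b where "b = - a"
  have "norm (F x) \<le> indicator (cbox b a) x + (norm (F x))\<^sup>2" for x
  proof (cases "x \<in> S")
    case True
    then have "x \<in> cbox b a" using ab b_def by blast
    moreover have "norm (F x) \<le> 1 + (norm (F x))\<^sup>2"
    proof -
      have "2 * norm (F x) \<le> 1 + (norm (F x))\<^sup>2"
        using zero_le_power2[of "norm (F x) - 1"] by (simp add: power2_eq_square algebra_simps)
      then show ?thesis using norm_ge_zero[of "F x"] by linarith
    qed
    ultimately show ?thesis by simp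
  qed (simp add: assms(3))
  then have "AE x in lebesgue. norm (F x) \<le> norm (indicator (cbox b a) x + (norm (F x))\<^sup>2)"
    by auto
  moreover have "integrable lebesgue (\<lambda>x. indicator (cbox b a) x + (norm (F x))\<^sup>2)"
    using assms(1) emeasure_lborel_cbox_finite[of b a]
    by (intro Bochner_Integration.integrable_add integrable_real_indicator) (auto simp: square_integrable_def)
  moreover have "F \<in> borel_measurable lebesgue" using assms(1) by (simp add: square_integrable_def)
  ultimately show ?thesis using Bochner_Integration.integrable_bound by blast
qed

text \<open>The Cauchy-Schwarz inequality for the nonzero summands.\<close>

lemma norm_sum_squared_le_overlap:
  fixes a :: "'i \<Rightarrow> 'b::real_normed_vector"
  assumes "finite I" "card {i \<in> I. a i \<noteq> 0} \<le> M"
  shows "(norm (\<Sum>i\<in>I. a i))\<^sup>2 \<le> real M * (\<Sum>i\<in>I. (norm (a i))\<^sup>2)"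
proof -
  define J where "J = {i \<in> I. a i \<noteq> 0}"
  have "(\<Sum>i\<in>I. a i) = (\<Sum>i\<in>J. a i)"
    unfolding J_def by (rule sum.mono_neutral_right[OF assms(1)]) auto
  then have "(norm (\<Sum>i\<in>I. a i))\<^sup>2 \<le> (\<Sum>i\<in>J. norm (a i))\<^sup>2"
    by (simp add: power_mono norm_sum)
  also have "\<dots> \<le> (\<Sum>i\<in>J. (norm (a i))\<^sup>2) * real (card J)"
    by (rule sum_squared_le_sum_of_squares)
  also have "\<dots> \<le> (\<Sum>i\<in>I. (norm (a i))\<^sup>2) * real M"
    using assms by (intro mult_mono sum_mono2) (auto simp: J_def sum_nonneg)
  finally show ?thesis by (simp add: mult.commute)
qed

section \<open>Square integrability on open sets and Sobolev functions\<close>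

lemma L2_subset:
  assumes "U \<in> sets lebesgue" "V \<in> sets lebesgue" "V \<subseteq> U" "f \<in> L2 U"
  shows "f \<in> L2 V"
proof -
  have "square_integrable (\<lambda>x. indicator U x *\<^sub>R f x)" using assms by (simp add: L2_iff)
  then have "square_integrable (\<lambda>x. indicator V x *\<^sub>R (indicator U x *\<^sub>R f x))"
    by (rule square_integrable_mult[where B=1]) (use assms(2) in \<open>auto simp: indicator_def\<close>)
  moreover have "(\<lambda>x. indicator V x *\<^sub>R (indicator U x *\<^sub>R f x)) = (\<lambda>x. indicator V x *\<^sub>R f x)"
    using assms(3) by (intro ext) (auto split: split_indicator)
  ultimately show ?thesis using assms(2) by (simp add: L2_iff)
qed

lemma L2_diff:
  assumes "U \<in> sets lebesgue" "f \<in> L2 U" "g \<in> L2 U"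
  shows "(\<lambda>x. f x - g x) \<in> L2 U"
proof -
  have "square_integrable (\<lambda>x. indicator U x *\<^sub>R g x)" using assms by (simp add: L2_iff)
  then have "square_integrable (\<lambda>x. (-1) *\<^sub>R (indicator U x *\<^sub>R g x))"
    by (rule square_integrable_mult[where B=1]) auto
  then have "square_integrable (\<lambda>x. indicator U x *\<^sub>R f x + (-1) *\<^sub>R (indicator U x *\<^sub>R g x))"
    using assms by (intro square_integrable_add) (auto simp: L2_iff)
  then show ?thesis using assms(1) by (simp add: L2_iff scaleR_diff_right)
qed

lemma L2_cong_AE:
  assumes U: "U \<in> sets lebesgue" and "f \<in> L2 U" "AE x in lebesgue_on U. f x = g x"
  shows "g \<in> L2 U"
proof -
  have "AE x in lebesgue. x \<in> U \<longrightarrow> f x = g x"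
    using assms(3) U by (subst (asm) AE_restrict_space_iff) auto
  then have "AE x in lebesgue. indicator U x *\<^sub>R f x = indicator U x *\<^sub>R g x"
    by eventually_elim (simp split: split_indicator)
  moreover have "square_integrable (\<lambda>x. indicator U x *\<^sub>R f x)" using assms by (simp add: L2_iff)
  ultimately have "square_integrable (\<lambda>x. indicator U x *\<^sub>R g x)" by (rule square_integrable_cong_AE(1)[rotated])
  then show ?thesis using U by (simp add: L2_iff)
qed

lemma L2_imp_integrable:
  assumes U: "U \<in> sets lebesgue" "bounded U" and f: "f \<in> L2 U"
  shows "integrable (lebesgue_on U) f"
proof -
  have "integrable lebesgue (\<lambda>x. indicator U x *\<^sub>R f x)"
    by (rule square_integrable_imp_integrable[OF _ U(2)]) (use f U in \<open>auto simp: L2_iff\<close>)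
  then show ?thesis using U by (simp add: integrable_restrict_space)
qed

lemma H1_subset:
  assumes "open U" "open V" "V \<subseteq> U" "f \<in> H1 U"
  shows "f \<in> H1 V"
proof -
  have l: "U \<in> sets lebesgue" "V \<in> sets lebesgue" using assms by (auto simp: borel_open)
  obtain g where g: "g \<in> L2 U" "has_weak_gradient U f g" "f \<in> L2 U" using assms(4) by (auto simp: H1_def)
  have "f \<in> L2 V" "g \<in> L2 V" using g by (auto intro: L2_subset[OF l assms(3)])
  moreover have "has_weak_gradient V f g" by (rule has_weak_gradient_subset[OF assms(1-3) g(2)])
  ultimately show ?thesis unfolding H1_def by auto
qed

lemma H1_diff:
  assumes "open U" "f \<in> H1 U" "f' \<in> H1 U"
  shows "(\<lambda>x. f x - f' x) \<in> H1 U"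
proof -
  have l: "U \<in> sets lebesgue" using assms by (auto simp: borel_open)
  obtain g g' where g: "g \<in> L2 U" "has_weak_gradient U f g" "f \<in> L2 U"
      "g' \<in> L2 U" "has_weak_gradient U f' g'" "f' \<in> L2 U" using assms by (auto simp: H1_def)
  have "(\<lambda>x. f x - f' x) \<in> L2 U" "(\<lambda>x. g x - g' x) \<in> L2 U"
    using g by (auto intro: L2_diff[OF l])
  moreover have "has_weak_gradient U (\<lambda>x. f x - f' x) (\<lambda>x. g x - g' x)"
    by (rule has_weak_gradient_diff[OF assms(1) g(2,5)])
  ultimately show ?thesis unfolding H1_def by auto
qed

lemma H1_weak_gradient:
  assumes "open U" "f \<in> H1 U"
  shows "has_weak_gradient U f (weak_gradient U f)" "weak_gradient U f \<in> L2 U"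
proof -
  obtain g where g: "g \<in> L2 U" "has_weak_gradient U f g" using assms(2) by (auto simp: H1_def)
  show w: "has_weak_gradient U f (weak_gradient U f)" by (rule has_weak_gradient_weak_gradient[OF g(2)])
  show "weak_gradient U f \<in> L2 U"
    by (rule L2_cong_AE[OF _ g(1) weak_gradient_unique[OF assms(1) g(2) w]])
       (use assms(1) in \<open>simp add: borel_open\<close>)
qed

lemma integral_overlap_bound:
  fixes F :: "'i \<Rightarrow> 'a::euclidean_space \<Rightarrow> 'b::euclidean_space"
  assumes I: "finite I" and F: "\<And>i. i \<in> I \<Longrightarrow> square_integrable (F i)"
    and h: "\<And>i. i \<in> I \<Longrightarrow> integrable lebesgue (h i)"
    and le: "\<And>i. i \<in> I \<Longrightarrow> AE x in lebesgue. (norm (F i x))\<^sup>2 \<le> h i x"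
    and overlap: "\<And>x. card {i \<in> I. F i x \<noteq> 0} \<le> M"
  shows "(LINT x|lebesgue. (norm (\<Sum>i\<in>I. F i x))\<^sup>2) \<le> real M * (\<Sum>i\<in>I. LINT x|lebesgue. h i x)"
proof -
  have "(LINT x|lebesgue. (norm (\<Sum>i\<in>I. F i x))\<^sup>2) \<le> (LINT x|lebesgue. real M * (\<Sum>i\<in>I. h i x))"
  proof (rule integral_mono_AE)
    show "integrable lebesgue (\<lambda>x. (norm (\<Sum>i\<in>I. F i x))\<^sup>2)"
      using square_integrable_sum[OF I F] by (simp add: square_integrable_def)
    show "integrable lebesgue (\<lambda>x. real M * (\<Sum>i\<in>I. h i x))"
      using h by auto
    have "AE x in lebesgue. \<forall>i\<in>I. (norm (F i x))\<^sup>2 \<le> h i x"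
      by (rule AE_finite_allI[OF I le])
    then show "AE x in lebesgue. (norm (\<Sum>i\<in>I. F i x))\<^sup>2 \<le> real M * (\<Sum>i\<in>I. h i x)"
    proof eventually_elim
      fix x assume "\<forall>i\<in>I. (norm (F i x))\<^sup>2 \<le> h i x"
      then have "real M * (\<Sum>i\<in>I. (norm (F i x))\<^sup>2) \<le> real M * (\<Sum>i\<in>I. h i x)"
        by (intro mult_left_mono sum_mono) auto
      with norm_sum_squared_le_overlap[OF I overlap] show "(norm (\<Sum>i\<in>I. F i x))\<^sup>2 \<le> real M * (\<Sum>i\<in>I. h i x)"
        by (rule order_trans)
    qed
  qed
  also have "\<dots> = real M * (\<Sum>i\<in>I. LINT x|lebesgue. h i x)"
    using h by simp
  finally show ?thesis .
qed

lemma Linf_norm_AE: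
  assumes "U \<in> sets lebesgue" "Linf_norm U f \<le> ereal C"
  shows "AE x in lebesgue. x \<in> U \<longrightarrow> norm (f x) \<le> C"
proof -
  have "AE x in lebesgue_on U. ereal (norm (f x)) \<le> Linf_norm U f"
    unfolding Linf_norm_def by (rule esssup_AE)
  then have "AE x in lebesgue_on U. norm (f x) \<le> C"
  proof eventually_elim
    fix x assume "ereal (norm (f x)) \<le> Linf_norm U f"
    then have "ereal (norm (f x)) \<le> ereal C" using assms(2) by (rule order_trans)
    then show "norm (f x) \<le> C" by simp
  qed
  then show ?thesis using assms(1) by (subst (asm) AE_restrict_space_iff) auto
qed

section \<open>The partition of unity and the error estimates\<close>

locale envelop_partition = tiling \<Omega> \<T> + triangular_mesh \<T>
  for \<Omega> :: "point set" and \<T> :: "point set set" +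
  fixes N :: nat and \<phi> :: "nat \<Rightarrow> point \<Rightarrow> real"
  assumes enum: "bij_betw \<phi> {1..N} (envelop_functions \<T>)"
begin

abbreviation \<psi> :: "nat \<Rightarrow> point \<Rightarrow> real" where
  "\<psi> i \<equiv> partition_fun N \<phi> i"

text \<open>The open part of the patch inside the domain. Here both \<open>u\<close> and the local trial functions are
Sobolev functions.\<close>

definition patch :: "nat \<Rightarrow> point set" where
  "patch i = interior (support (\<phi> i) \<inter> \<Omega>)"

lemma envelop: "i \<in> {1..N} \<Longrightarrow> \<phi> i \<in> envelop_functions \<T>"
  using enum by (auto simp: bij_betw_def)

lemma envelop_sum: "x \<in> closure \<Omega> \<Longrightarrow> (\<Sum>j=1..N. \<phi> j x) > 0"
  using envelop_sum_pos[of x] covering sum.reindex_bij_betw[OF enum, of "\<lambda>f. f x"] by simp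

lemma partition_piecewise_C1: "i \<in> {1..N} \<Longrightarrow> piecewise_C1 (\<psi> i)"
  unfolding piecewise_C1_def partition_fun_def
proof
  fix K assume i: "i \<in> {1..N}" and K: "K \<in> \<T>"
  have "(\<Sum>j=1..N. \<phi> j x) \<noteq> 0" if "x \<in> K" for x
    using envelop_sum[of x] that K covering by force
  then show "C1_piece K (\<lambda>x. \<phi> i x / (\<Sum>j=1..N. \<phi> j x))"
    using i K by (intro C1_piece_divide C1_piece_sum envelop_C1_piece envelop) auto
qed

lemma partition_nonneg: "i \<in> {1..N} \<Longrightarrow> \<psi> i x \<ge> 0"
  unfolding partition_fun_def by (intro divide_nonneg_nonneg sum_nonneg envelop_nonneg envelop)

lemma partition_sum: "x \<in> closure \<Omega> \<Longrightarrow> (\<Sum>i=1..N. \<psi> i x) = 1"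
  using envelop_sum[of x] by (simp add: partition_fun_def sum_divide_distrib[symmetric])

lemma open_patch: "open (patch i)" and patch_subset: "patch i \<subseteq> \<Omega>" "patch i \<subseteq> support (\<phi> i)"
  and patch_subset_interior: "patch i \<subseteq> interior (support (\<phi> i))"
  and patch_lebesgue: "patch i \<in> sets lebesgue"
proof -
  have "patch i \<subseteq> support (\<phi> i) \<inter> \<Omega>" unfolding patch_def by (rule interior_subset)
  then show "patch i \<subseteq> \<Omega>" "patch i \<subseteq> support (\<phi> i)" by auto
  show "patch i \<subseteq> interior (support (\<phi> i))" unfolding patch_def by (rule interior_mono) auto
  show "open (patch i)" unfolding patch_def by (rule open_interior)
  then show "patch i \<in> sets lebesgue" by (simp add: borel_open)
qed

text \<open>By continuity the set where an envelop function does not vanish is open in \<open>\<Omega>\<close>.\<close>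

lemma envelop_nonzero_in_patch:
  assumes "i \<in> {1..N}" "x \<in> \<Omega>" "\<phi> i x \<noteq> 0"
  shows "x \<in> patch i"
proof -
  have "piecewise_C1 (\<phi> i)" using envelop_C1_piece[OF envelop[OF assms(1)]] by (simp add: piecewise_C1_def)
  then have "continuous_on \<Omega> (\<phi> i)"
    using piecewise_C1_continuous continuous_on_subset closure_subset by blast
  then have "open (\<Omega> \<inter> \<phi> i -` (- {0}))"
    using open_domain by (intro continuous_open_preimage) auto
  moreover have "\<Omega> \<inter> \<phi> i -` (- {0}) \<subseteq> support (\<phi> i) \<inter> \<Omega>"
    using closure_subset[of "{x. \<phi> i x \<noteq> 0}"] by (auto simp: support_def)
  ultimately have "\<Omega> \<inter> \<phi> i -` (- {0}) \<subseteq> patch i"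
    unfolding patch_def by (rule interior_maximal[rotated])
  then show ?thesis using assms by auto
qed

lemma partition_nonzero_in_patch: "i \<in> {1..N} \<Longrightarrow> x \<in> \<Omega> \<Longrightarrow> \<psi> i x \<noteq> 0 \<Longrightarrow> x \<in> patch i"
  using envelop_nonzero_in_patch by (auto simp: partition_fun_def)

text \<open>A closed patch differs from its interior only on the skeleton: an envelop function that is somewhere
nonzero on a triangle is positive in the whole interior of that triangle.\<close>

lemma patch_AE: "i \<in> {1..N} \<Longrightarrow> AE x in lebesgue. x \<in> support (\<phi> i) \<inter> \<Omega> \<longleftrightarrow> x \<in> patch i"
  using AE_not_skeleton
proof eventually_elim
  fix x assume i: "i \<in> {1..N}" and x: "x \<notin> skeleton"
  have "x \<in> patch i" if s: "x \<in> support (\<phi> i)" "x \<in> \<Omega>"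
  proof -
    have "x \<in> closure \<Omega>" using s closure_subset by blast
    then obtain K where K: "K \<in> \<T>" "x \<in> interior K" using in_interior_tile x by blast
    have "interior K \<inter> {y. \<phi> i y \<noteq> 0} \<noteq> {}"
      using s(1) K(2) open_Int_closure_eq_empty[OF open_interior, of K "{y. \<phi> i y \<noteq> 0}"]
      unfolding support_def by blast
    then have "\<not> (\<forall>y\<in>K. \<phi> i y = 0)" using interior_subset by blast
    then have "\<phi> i x > 0" using envelop_dichotomy[OF envelop[OF i] K(1)] K(2) by blast
    then show ?thesis using envelop_nonzero_in_patch[OF i s(2)] by simp
  qed
  then show "x \<in> support (\<phi> i) \<inter> \<Omega> \<longleftrightarrow> x \<in> patch i" using patch_subset by blast
qed

lemma L2_norm_patch:
  fixes h :: "point \<Rightarrow> 'b::euclidean_space"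
  assumes "i \<in> {1..N}" "h \<in> L2 (patch i)"
  shows "(LINT x|lebesgue. (norm (indicator (patch i) x *\<^sub>R h x))\<^sup>2) = (L2_norm (support (\<phi> i) \<inter> \<Omega>) h)\<^sup>2"
proof -
  have "support (\<phi> i) \<inter> \<Omega> \<in> sets borel"
    using open_domain by (auto simp: support_def borel_open borel_closed)
  then have l: "support (\<phi> i) \<inter> \<Omega> \<in> sets lebesgue" by simp
  have "AE x in lebesgue. indicator (patch i) x *\<^sub>R h x = indicator (support (\<phi> i) \<inter> \<Omega>) x *\<^sub>R h x"
    using patch_AE[OF assms(1)] by eventually_elim (simp add: indicator_def)
  from square_integrable_cong_AE(2)[OF _ this] show ?thesis
    using assms(2) patch_lebesgue by (simp add: L2_norm_squared[OF l] L2_iff)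
qed

text \<open>The extension of \<open>\<psi> i * f\<close> by zero from the patch; \<open>localized_gradient\<close> is the vector field that the product
rule assigns to it.\<close>

definition localized :: "nat \<Rightarrow> (point \<Rightarrow> real) \<Rightarrow> point \<Rightarrow> real" where
  "localized i f x = (if x \<in> patch i then \<psi> i x * f x else 0)"

definition localized_gradient :: "nat \<Rightarrow> (point \<Rightarrow> real) \<Rightarrow> (point \<Rightarrow> point) \<Rightarrow> point \<Rightarrow> point" where
  "localized_gradient i f g x =
     (if x \<in> patch i then \<psi> i x *\<^sub>R g x + f x *\<^sub>R piecewise_gradient (\<psi> i) x else 0)"

lemma localized_outside: "x \<notin> \<Omega> \<Longrightarrow> localized i f x = 0" "x \<notin> \<Omega> \<Longrightarrow> localized_gradient i f g x = 0"
  using patch_subset by (auto simp: localized_def localized_gradient_def)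

lemma bounded_patch: "bounded (patch i)"
  by (rule bounded_subset[OF compact_imp_bounded[OF compact_closure_domain]])
     (use patch_subset(1)[of i] closure_subset in blast)

text \<open>Both functions are sums of products of bounded measurable functions with square integrable
ones.\<close>

lemma localized_weak_gradient:
  assumes i: "i \<in> {1..N}" and f: "f \<in> L2 (patch i)" and g: "g \<in> L2 (patch i)" "has_weak_gradient (patch i) f g"
  shows "has_weak_gradient \<Omega> (localized i f) (localized_gradient i f g)"
    and "square_integrable (localized i f)" and "square_integrable (localized_gradient i f g)"
proof -
  note C1 = partition_piecewise_C1[OF i]
  show "has_weak_gradient \<Omega> (localized i f) (localized_gradient i f g)"
    unfolding localized_def[abs_def] localized_gradient_def[abs_def]
    by (rule has_weak_gradient_localized[OF C1 partition_nonneg[OF i] open_patch patch_subset(1)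
          partition_nonzero_in_patch[OF i] g(2)])
       (use f g(1) L2_imp_integrable[OF patch_lebesgue bounded_patch] in auto)
  define p where "p x = indicator \<Omega> x * \<psi> i x" for x
  define q where "q x = indicator \<Omega> x *\<^sub>R piecewise_gradient (\<psi> i) x" for x
  define F where "F x = indicator (patch i) x *\<^sub>R f x" for x
  define H where "H x = indicator (patch i) x *\<^sub>R g x" for x
  have F: "square_integrable F" and H: "square_integrable H"
    using f g(1) unfolding L2_iff[OF patch_lebesgue] F_def[abs_def] H_def[abs_def] .
  note cut = piecewise_C1_cut_off[OF C1, folded p_def q_def]
  note pm = cut(1) and qm = cut(2)
  obtain B B' where pb: "\<And>x. \<bar>p x\<bar> \<le> B" and qb: "\<And>x. norm (q x) \<le> B'"
    using cut(3,4) by blast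
  have "localized i f = (\<lambda>x. p x *\<^sub>R F x)"
    using patch_subset(1)[of i] by (auto simp: fun_eq_iff localized_def p_def F_def)
  with square_integrable_mult[OF F pm pb] show "square_integrable (localized i f)"
    by (simp only:)
  have "localized_gradient i f g = (\<lambda>x. p x *\<^sub>R H x + F x *\<^sub>R q x)"
    using patch_subset(1)[of i] by (auto simp: fun_eq_iff localized_gradient_def p_def F_def H_def q_def)
  with square_integrable_add[OF square_integrable_mult[OF H pm pb] square_integrable_mult_right[OF F qm qb]]
  show "square_integrable (localized_gradient i f g)"
    by (simp only:)
qed

text \<open>The sum in \<open>local_sum\<close> extends over the closed patches, but on their boundary inside \<open>\<Omega>\<close> the partition
functions vanish.\<close>

lemma local_sum_eq_localized: "x \<in> \<Omega> \<Longrightarrow> local_sum N \<phi> v x = (\<Sum>i=1..N. localized i (v i) x)"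
  unfolding local_sum_def localized_def
  using patch_subset(2) partition_nonzero_in_patch by (intro sum.cong) auto

text \<open>The function \<open>u\<close> itself is distributed by the partition of unity.\<close>

lemma error_eq_localized: "x \<in> \<Omega> \<Longrightarrow> u x - local_sum N \<phi> v x = (\<Sum>i=1..N. localized i (\<lambda>x. u x - v i x) x)"
proof -
  assume x: "x \<in> \<Omega>"
  then have "u x = (\<Sum>i=1..N. \<psi> i x * u x)"
    using partition_sum[of x] closure_subset[of \<Omega>] by (auto simp: sum_distrib_right[symmetric])
  also have "\<dots> = (\<Sum>i=1..N. localized i u x)"
    using partition_nonzero_in_patch x by (intro sum.cong) (auto simp: localized_def)
  finally have "u x - local_sum N \<phi> v x = (\<Sum>i=1..N. localized i u x - localized i (v i) x)"
    using local_sum_eq_localized[OF x, of v] by (simp add: sum_subtractf)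
  also have "\<dots> = (\<Sum>i=1..N. localized i (\<lambda>x. u x - v i x) x)"
    by (intro sum.cong) (auto simp: localized_def algebra_simps)
  finally show ?thesis .
qed

lemma local_sum_in_H1:
  assumes v: "\<And>i. i \<in> {1..N} \<Longrightarrow> v i \<in> H1 (patch i)"
  shows "local_sum N \<phi> v \<in> H1 \<Omega>"
proof -
  define g where "g i = weak_gradient (patch i) (v i)" for i
  define L where "L x = (\<Sum>i=1..N. localized i (v i) x)" for x
  define G where "G x = (\<Sum>i=1..N. localized_gradient i (v i) (g i) x)" for x
  have vg: "v i \<in> L2 (patch i)" "g i \<in> L2 (patch i)" "has_weak_gradient (patch i) (v i) (g i)" if "i \<in> {1..N}" for i
    using v[OF that] H1_weak_gradient[OF open_patch v[OF that]] by (auto simp: g_def H1_def)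
  note lw = localized_weak_gradient[OF _ vg]
  have "has_weak_gradient \<Omega> L G"
    unfolding L_def[abs_def] G_def[abs_def]
    by (rule has_weak_gradient_sum[OF open_domain]) (auto intro: lw(1))
  then have 1: "has_weak_gradient \<Omega> (local_sum N \<phi> v) G"
    by (rule has_weak_gradient_cong[OF open_domain]) (simp add: L_def local_sum_eq_localized)
  have "square_integrable L" "square_integrable G"
    unfolding L_def[abs_def] G_def[abs_def] by (auto intro!: square_integrable_sum lw(2,3))
  moreover have "(\<lambda>x. indicator \<Omega> x *\<^sub>R local_sum N \<phi> v x) = L" "(\<lambda>x. indicator \<Omega> x *\<^sub>R G x) = G"
    by (auto simp: fun_eq_iff L_def G_def local_sum_eq_localized localized_outside split: split_indicator)
  ultimately have "local_sum N \<phi> v \<in> L2 \<Omega>" "G \<in> L2 \<Omega>"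
    using L2_iff[OF domain_lebesgue, of "local_sum N \<phi> v"] L2_iff[OF domain_lebesgue, of G] by auto
  with 1 show ?thesis unfolding H1_def by blast
qed

lemma overlap_localized:
  assumes overlap: "\<And>x. x \<in> \<Omega> \<Longrightarrow> card {i \<in> {1..N}. x \<in> support (\<phi> i)} \<le> M"
    and F: "\<And>i. x \<notin> patch i \<Longrightarrow> F i x = 0"
  shows "card {i \<in> {1..N}. F i x \<noteq> 0} \<le> M"
proof (cases "x \<in> \<Omega>")
  case True
  have "card {i \<in> {1..N}. F i x \<noteq> 0} \<le> card {i \<in> {1..N}. x \<in> support (\<phi> i)}"
    using F patch_subset(2) by (intro card_mono) auto
  then show ?thesis using overlap[OF True] by simp
next
  case False
  then have "F i x = 0" for i using F patch_subset(1) by blast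
  then show ?thesis by simp
qed

text \<open>Both integrands are sums of pieces supported in the patches, so \<open>integral_overlap_bound\<close> applies. The
assumed bounds concern essential suprema and a chosen weak gradient of \<open>\<psi> i\<close>; by uniqueness the latter is
almost everywhere the piecewise gradient in the product rule, and the same argument identifies the chosen
weak gradient of \<open>e\<close>.\<close>

theorem localized_error_estimates:
  assumes overlap: "\<And>x. x \<in> \<Omega> \<Longrightarrow> card {i \<in> {1..N}. x \<in> support (\<phi> i)} \<le> M"
    and \<psi>_bound: "\<And>i. i \<in> {1..N} \<Longrightarrow> Linf_norm \<Omega> (\<psi> i) \<le> ereal C"
    and grad_bound: "\<And>i. i \<in> {1..N} \<Longrightarrow> Linf_norm \<Omega> (weak_gradient \<Omega> (\<psi> i)) \<le> ereal (c i)"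
    and w: "\<And>i. i \<in> {1..N} \<Longrightarrow> w i \<in> H1 (patch i)"
    and e: "\<And>x. x \<in> \<Omega> \<Longrightarrow> e x = (\<Sum>i=1..N. localized i (w i) x)"
  shows "(L2_norm \<Omega> e)\<^sup>2 \<le> real M * (\<Sum>i=1..N. C\<^sup>2 * (L2_norm (support (\<phi> i) \<inter> \<Omega>) (w i))\<^sup>2)"
    and "(L2_norm \<Omega> (weak_gradient \<Omega> e))\<^sup>2 \<le> real M * (\<Sum>i=1..N.
      2 * C\<^sup>2 * (L2_norm (support (\<phi> i) \<inter> \<Omega>) (weak_gradient (patch i) (w i)))\<^sup>2
      + 2 * (c i)\<^sup>2 * (L2_norm (support (\<phi> i) \<inter> \<Omega>) (w i))\<^sup>2)"
proof -
  define g where "g i = weak_gradient (patch i) (w i)" for i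
  have wg: "w i \<in> L2 (patch i)" "g i \<in> L2 (patch i)" "has_weak_gradient (patch i) (w i) (g i)" if "i \<in> {1..N}" for i
    using w[OF that] H1_weak_gradient[OF open_patch w[OF that]] by (auto simp: g_def H1_def)
  note lw = localized_weak_gradient[OF _ wg]
  define W where "W i x = indicator (patch i) x *\<^sub>R w i x" for i x
  define H where "H i x = indicator (patch i) x *\<^sub>R g i x" for i x
  have WH: "square_integrable (W i)" "square_integrable (H i)" if "i \<in> {1..N}" for i
    using wg(1,2)[OF that] unfolding L2_iff[OF patch_lebesgue] W_def[abs_def] H_def[abs_def] .
  have nW: "(LINT x|lebesgue. (norm (W i x))\<^sup>2) = (L2_norm (support (\<phi> i) \<inter> \<Omega>) (w i))\<^sup>2"
    and nH: "(LINT x|lebesgue. (norm (H i x))\<^sup>2) = (L2_norm (support (\<phi> i) \<inter> \<Omega>) (g i))\<^sup>2" if "i \<in> {1..N}" for i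
    unfolding W_def H_def by (rule L2_norm_patch[OF that wg(1)[OF that]], rule L2_norm_patch[OF that wg(2)[OF that]])
  have iW: "integrable lebesgue (\<lambda>x. (norm (W i x))\<^sup>2)" and iH: "integrable lebesgue (\<lambda>x. (norm (H i x))\<^sup>2)"
    if "i \<in> {1..N}" for i using WH[OF that] by (auto simp: square_integrable_def)
  have \<psi>C: "AE x in lebesgue. x \<in> patch i \<longrightarrow> (\<psi> i x)\<^sup>2 \<le> C\<^sup>2" if "i \<in> {1..N}" for i
    using Linf_norm_AE[OF domain_lebesgue \<psi>_bound[OF that]]
  proof eventually_elim
    fix x assume "x \<in> \<Omega> \<longrightarrow> norm (\<psi> i x) \<le> C"
    then show "x \<in> patch i \<longrightarrow> (\<psi> i x)\<^sup>2 \<le> C\<^sup>2"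
      using patch_subset(1)[of i] power_mono[of "norm (\<psi> i x)" C 2] by auto
  qed
  have gc: "AE x in lebesgue. x \<in> patch i \<longrightarrow> (norm (piecewise_gradient (\<psi> i) x))\<^sup>2 \<le> (c i)\<^sup>2" if i: "i \<in> {1..N}" for i
  proof -
    note hw = has_weak_gradient_piecewise[OF partition_piecewise_C1[OF i]]
    have "AE x in lebesgue_on \<Omega>. piecewise_gradient (\<psi> i) x = weak_gradient \<Omega> (\<psi> i) x"
      by (rule weak_gradient_unique[OF open_domain hw has_weak_gradient_weak_gradient[OF hw]])
    then have "AE x in lebesgue. x \<in> \<Omega> \<longrightarrow> piecewise_gradient (\<psi> i) x = weak_gradient \<Omega> (\<psi> i) x"
      using domain_lebesgue by (subst (asm) AE_restrict_space_iff) auto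
    with Linf_norm_AE[OF domain_lebesgue grad_bound[OF i]] show ?thesis
    proof eventually_elim
      fix x assume "x \<in> \<Omega> \<longrightarrow> norm (weak_gradient \<Omega> (\<psi> i) x) \<le> c i"
        "x \<in> \<Omega> \<longrightarrow> piecewise_gradient (\<psi> i) x = weak_gradient \<Omega> (\<psi> i) x"
      then show "x \<in> patch i \<longrightarrow> (norm (piecewise_gradient (\<psi> i) x))\<^sup>2 \<le> (c i)\<^sup>2"
        using patch_subset(1)[of i] power_mono[of "norm (weak_gradient \<Omega> (\<psi> i) x)" "c i" 2] by auto
    qed
  qed
  define E where "E x = (\<Sum>i=1..N. localized i (w i) x)" for x
  define G where "G x = (\<Sum>i=1..N. localized_gradient i (w i) (g i) x)" for x
  have sG: "square_integrable G"
    unfolding G_def[abs_def] by (auto intro!: square_integrable_sum lw(3))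
  have "has_weak_gradient \<Omega> E G"
    unfolding E_def[abs_def] G_def[abs_def]
    by (rule has_weak_gradient_sum[OF open_domain]) (auto intro: lw(1))
  then have eG: "has_weak_gradient \<Omega> e G"
    by (rule has_weak_gradient_cong[OF open_domain]) (simp add: E_def e)
  show "(L2_norm \<Omega> e)\<^sup>2 \<le> real M * (\<Sum>i=1..N. C\<^sup>2 * (L2_norm (support (\<phi> i) \<inter> \<Omega>) (w i))\<^sup>2)"
  proof -
    have "indicator \<Omega> x *\<^sub>R e x = E x" for x
      by (auto simp: E_def e localized_outside split: split_indicator)
    then have "(L2_norm \<Omega> e)\<^sup>2 = (LINT x|lebesgue. (norm (E x))\<^sup>2)"
      by (simp only: L2_norm_squared[OF domain_lebesgue])
    also have "\<dots> \<le> real M * (\<Sum>i=1..N. LINT x|lebesgue. C\<^sup>2 * (norm (W i x))\<^sup>2)"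
      unfolding E_def
    proof (rule integral_overlap_bound)
      fix i assume i: "i \<in> {1..N}"
      show "square_integrable (localized i (w i))" by (rule lw(2)[OF i i i i])
      show "integrable lebesgue (\<lambda>x. C\<^sup>2 * (norm (W i x))\<^sup>2)" using iW[OF i] by auto
      show "AE x in lebesgue. (norm (localized i (w i) x))\<^sup>2 \<le> C\<^sup>2 * (norm (W i x))\<^sup>2"
        using \<psi>C[OF i] by eventually_elim
          (auto simp: localized_def W_def power_mult_distrib intro!: mult_right_mono)
    next
      show "card {i \<in> {1..N}. localized i (w i) x \<noteq> 0} \<le> M" for x
        by (rule overlap_localized[OF overlap, where F="\<lambda>i. localized i (w i)"]) (auto simp: localized_def)
    qed simp
    also have "\<dots> = real M * (\<Sum>i=1..N. C\<^sup>2 * (L2_norm (support (\<phi> i) \<inter> \<Omega>) (w i))\<^sup>2)"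
      using nW by simp
    finally show ?thesis .
  qed
  show "(L2_norm \<Omega> (weak_gradient \<Omega> e))\<^sup>2 \<le> real M * (\<Sum>i=1..N.
      2 * C\<^sup>2 * (L2_norm (support (\<phi> i) \<inter> \<Omega>) (weak_gradient (patch i) (w i)))\<^sup>2
      + 2 * (c i)\<^sup>2 * (L2_norm (support (\<phi> i) \<inter> \<Omega>) (w i))\<^sup>2)"
  proof -
    have "AE x in lebesgue_on \<Omega>. G x = weak_gradient \<Omega> e x"
      by (rule weak_gradient_unique[OF open_domain eG has_weak_gradient_weak_gradient[OF eG]])
    then have "AE x in lebesgue. x \<in> \<Omega> \<longrightarrow> G x = weak_gradient \<Omega> e x"
      using domain_lebesgue by (subst (asm) AE_restrict_space_iff) auto
    then have "AE x in lebesgue. G x = indicator \<Omega> x *\<^sub>R weak_gradient \<Omega> e x"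
      by eventually_elim (auto simp: G_def localized_outside split: split_indicator)
    then have "(L2_norm \<Omega> (weak_gradient \<Omega> e))\<^sup>2 = (LINT x|lebesgue. (norm (G x))\<^sup>2)"
      unfolding L2_norm_squared[OF domain_lebesgue] by (rule square_integrable_cong_AE(2)[OF sG])
    also have "\<dots> \<le> real M * (\<Sum>i=1..N. LINT x|lebesgue. 2 * C\<^sup>2 * (norm (H i x))\<^sup>2 + 2 * (c i)\<^sup>2 * (norm (W i x))\<^sup>2)"
      unfolding G_def
    proof (rule integral_overlap_bound)
      fix i assume i: "i \<in> {1..N}"
      show "square_integrable (localized_gradient i (w i) (g i))" by (rule lw(3)[OF i i i i])
      show "integrable lebesgue (\<lambda>x. 2 * C\<^sup>2 * (norm (H i x))\<^sup>2 + 2 * (c i)\<^sup>2 * (norm (W i x))\<^sup>2)"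
        using iW[OF i] iH[OF i] by auto
      show "AE x in lebesgue. (norm (localized_gradient i (w i) (g i) x))\<^sup>2
          \<le> 2 * C\<^sup>2 * (norm (H i x))\<^sup>2 + 2 * (c i)\<^sup>2 * (norm (W i x))\<^sup>2"
        using \<psi>C[OF i] gc[OF i]
      proof eventually_elim
        fix x assume x: "x \<in> patch i \<longrightarrow> (\<psi> i x)\<^sup>2 \<le> C\<^sup>2"
          "x \<in> patch i \<longrightarrow> (norm (piecewise_gradient (\<psi> i) x))\<^sup>2 \<le> (c i)\<^sup>2"
        show "(norm (localized_gradient i (w i) (g i) x))\<^sup>2
          \<le> 2 * C\<^sup>2 * (norm (H i x))\<^sup>2 + 2 * (c i)\<^sup>2 * (norm (W i x))\<^sup>2"
        proof (cases "x \<in> patch i")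
          case True
          have "(norm (localized_gradient i (w i) (g i) x))\<^sup>2
              \<le> 2 * (norm (\<psi> i x *\<^sub>R g i x))\<^sup>2 + 2 * (norm (w i x *\<^sub>R piecewise_gradient (\<psi> i) x))\<^sup>2"
            using True norm_add_squared_le by (simp add: localized_gradient_def del: norm_scaleR)
          also have "\<dots> = 2 * ((\<psi> i x)\<^sup>2 * (norm (g i x))\<^sup>2) + 2 * ((norm (piecewise_gradient (\<psi> i) x))\<^sup>2 * (w i x)\<^sup>2)"
            by (simp add: power_mult_distrib mult.commute)
          also have "\<dots> \<le> 2 * (C\<^sup>2 * (norm (g i x))\<^sup>2) + 2 * ((c i)\<^sup>2 * (w i x)\<^sup>2)"
            using x True by (intro add_mono mult_left_mono mult_right_mono) auto
          finally show ?thesis using True by (simp add: H_def W_def)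
        qed (simp add: localized_gradient_def)
      qed
    next
      show "card {i \<in> {1..N}. localized_gradient i (w i) (g i) x \<noteq> 0} \<le> M" for x
        by (rule overlap_localized[OF overlap, where F="\<lambda>i. localized_gradient i (w i) (g i)"])
           (auto simp: localized_gradient_def)
    qed simp
    also have "\<dots> = real M * (\<Sum>i=1..N.
      2 * C\<^sup>2 * (L2_norm (support (\<phi> i) \<inter> \<Omega>) (g i))\<^sup>2 + 2 * (c i)\<^sup>2 * (L2_norm (support (\<phi> i) \<inter> \<Omega>) (w i))\<^sup>2)"
      using nW nH iW iH by simp
    finally show ?thesis unfolding g_def .
  qed
qed

end

lemma envelop_partition_regular_triangulation:
  assumes "polygonal_lipschitz_domain \<Omega>" "regular_triangulation \<kappa> \<Omega> \<T>" "bij_betw \<phi> {1..N} (envelop_functions \<T>)"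
  shows "envelop_partition \<Omega> \<T> N \<phi>"
proof
  show "open \<Omega>" using assms(1) by (simp add: polygonal_lipschitz_domain_def)
  show "finite \<T>" "triangulation \<T>" "\<Union>\<T> = closure \<Omega>"
    using assms(2) by (auto simp: regular_triangulation_def triangulation_def)
  show triangle: "2 simplex K" if "K \<in> \<T>" for K
    using assms(2) that by (auto simp: regular_triangulation_def)
  show "compact K" "convex K" if "K \<in> \<T>" for K
    using triangle[OF that] by (auto intro: compact_simplex convex_simplex)
qed (rule assms(3))

theorem theorem2p1:
  fixes \<Omega> :: "point set" and \<T> :: "point set set" and \<kappa> :: real
    and N M :: nat and \<phi> :: "nat \<Rightarrow> point \<Rightarrow> real"
    and net :: "nat \<Rightarrow> 'p \<Rightarrow> point \<Rightarrow> real" and \<Theta> :: "nat \<Rightarrow> 'p set"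
    and C_inf C_G :: real and u :: "point \<Rightarrow> real"
    and v :: "nat \<Rightarrow> point \<Rightarrow> real" and \<epsilon>\<^sub>1 \<epsilon>\<^sub>2 :: "nat \<Rightarrow> real"
  assumes domain: "polygonal_lipschitz_domain \<Omega>"
    and mesh: "regular_triangulation \<kappa> \<Omega> \<T>"
    and enum: "bij_betw \<phi> {1..N} (envelop_functions \<T>)"
    and trial: "\<And>i. i \<in> {1..N} \<Longrightarrow> trial_set net \<Theta> i \<subseteq> H1 (interior (support (\<phi> i)))"
    and consts_pos: "C_inf > 0" "C_G > 0"
    and overlap: "\<And>x. x \<in> \<Omega> \<Longrightarrow> card {i \<in> {1..N}. x \<in> support (\<phi> i)} \<le> M"
    and psi_bound: "\<And>i. i \<in> {1..N} \<Longrightarrow> Linf_norm \<Omega> (partition_fun N \<phi> i) \<le> ereal C_inf"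
    and grad_psi_bound: "\<And>i. i \<in> {1..N} \<Longrightarrow>
        Linf_norm \<Omega> (weak_gradient \<Omega> (partition_fun N \<phi> i))
          \<le> ereal (C_G / diameter (support (\<phi> i)))"
    and u: "u \<in> H1 \<Omega>"
    and v: "\<And>i. i \<in> {1..N} \<Longrightarrow> v i \<in> trial_set net \<Theta> i"
    and eps_nonneg: "\<And>i. i \<in> {1..N} \<Longrightarrow> \<epsilon>\<^sub>1 i \<ge> 0" "\<And>i. i \<in> {1..N} \<Longrightarrow> \<epsilon>\<^sub>2 i \<ge> 0"
    and approx: "\<And>i. i \<in> {1..N} \<Longrightarrow>
        L2_norm (support (\<phi> i) \<inter> \<Omega>) (\<lambda>x. u x - v i x) \<le> \<epsilon>\<^sub>1 i"
    and grad_approx: "\<And>i. i \<in> {1..N} \<Longrightarrow>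
        L2_norm (support (\<phi> i) \<inter> \<Omega>)
          (weak_gradient (interior (support (\<phi> i) \<inter> \<Omega>)) (\<lambda>x. u x - v i x)) \<le> \<epsilon>\<^sub>2 i"
  shows "local_sum N \<phi> v \<in> global_set N \<phi> (trial_set net \<Theta>)
    \<and> global_set N \<phi> (trial_set net \<Theta>) \<subseteq> H1 \<Omega>
    \<and> L2_norm \<Omega> (\<lambda>x. u x - local_sum N \<phi> v x)
        \<le> sqrt (real M) * C_inf * sqrt (\<Sum>i=1..N. (\<epsilon>\<^sub>1 i)\<^sup>2)
    \<and> L2_norm \<Omega> (weak_gradient \<Omega> (\<lambda>x. u x - local_sum N \<phi> v x))
        \<le> sqrt (2 * real M) * sqrt (\<Sum>i=1..N.
             (C_G / diameter (support (\<phi> i)))\<^sup>2 * (\<epsilon>\<^sub>1 i)\<^sup>2 + C_inf\<^sup>2 * (\<epsilon>\<^sub>2 i)\<^sup>2)"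
proof -
  interpret envelop_partition \<Omega> \<T> N \<phi>
    by (rule envelop_partition_regular_triangulation[OF domain mesh enum])
  have H1_trial: "f \<in> H1 (patch i)" if "i \<in> {1..N}" "f \<in> trial_set net \<Theta> i" for i f
    using H1_subset[OF open_interior open_patch patch_subset_interior] trial that by blast
  have H1_error: "(\<lambda>x. u x - v i x) \<in> H1 (patch i)" if "i \<in> {1..N}" for i
    using H1_diff[OF open_patch H1_subset[OF open_domain open_patch patch_subset(1) u] H1_trial[OF that v[OF that]]] .
  have L2_nonneg: "L2_norm U f \<ge> 0" for U :: "point set" and f :: "point \<Rightarrow> 'b::euclidean_space"
    by (simp add: L2_norm_def)
  have e1: "(L2_norm (support (\<phi> i) \<inter> \<Omega>) (\<lambda>x. u x - v i x))\<^sup>2 \<le> (\<epsilon>\<^sub>1 i)\<^sup>2" if "i \<in> {1..N}" for i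
    by (intro power_mono approx that L2_nonneg)
  have e2: "(L2_norm (support (\<phi> i) \<inter> \<Omega>) (weak_gradient (patch i) (\<lambda>x. u x - v i x)))\<^sup>2 \<le> (\<epsilon>\<^sub>2 i)\<^sup>2"
    if "i \<in> {1..N}" for i
    unfolding patch_def by (intro power_mono grad_approx that L2_nonneg)
  note est = localized_error_estimates[where w="\<lambda>i x. u x - v i x" and e="\<lambda>x. u x - local_sum N \<phi> v x",
      OF overlap psi_bound grad_psi_bound H1_error error_eq_localized]
  have "(L2_norm \<Omega> (\<lambda>x. u x - local_sum N \<phi> v x))\<^sup>2 \<le> real M * (\<Sum>i=1..N. C_inf\<^sup>2 * (\<epsilon>\<^sub>1 i)\<^sup>2)"
    by (rule order_trans[OF est(1)]) (auto intro!: mult_left_mono sum_mono e1)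
  then have "L2_norm \<Omega> (\<lambda>x. u x - local_sum N \<phi> v x) \<le> sqrt (real M * (\<Sum>i=1..N. C_inf\<^sup>2 * (\<epsilon>\<^sub>1 i)\<^sup>2))"
    by (rule real_le_rsqrt)
  also have "\<dots> = sqrt (real M) * C_inf * sqrt (\<Sum>i=1..N. (\<epsilon>\<^sub>1 i)\<^sup>2)"
    using consts_pos by (simp add: sum_distrib_left[symmetric] real_sqrt_mult)
  finally have 1: "L2_norm \<Omega> (\<lambda>x. u x - local_sum N \<phi> v x)
      \<le> sqrt (real M) * C_inf * sqrt (\<Sum>i=1..N. (\<epsilon>\<^sub>1 i)\<^sup>2)" .
  have "(L2_norm \<Omega> (weak_gradient \<Omega> (\<lambda>x. u x - local_sum N \<phi> v x)))\<^sup>2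
      \<le> real M * (\<Sum>i=1..N. 2 * C_inf\<^sup>2 * (\<epsilon>\<^sub>2 i)\<^sup>2 + 2 * (C_G / diameter (support (\<phi> i)))\<^sup>2 * (\<epsilon>\<^sub>1 i)\<^sup>2)"
    by (rule order_trans[OF est(2)]) (auto intro!: mult_left_mono sum_mono add_mono e1 e2)
  also have "\<dots> = 2 * real M * (\<Sum>i=1..N. (C_G / diameter (support (\<phi> i)))\<^sup>2 * (\<epsilon>\<^sub>1 i)\<^sup>2 + C_inf\<^sup>2 * (\<epsilon>\<^sub>2 i)\<^sup>2)"
    by (simp add: sum_distrib_left algebra_simps)
  finally have 2: "L2_norm \<Omega> (weak_gradient \<Omega> (\<lambda>x. u x - local_sum N \<phi> v x))
      \<le> sqrt (2 * real M) * sqrt (\<Sum>i=1..N.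
           (C_G / diameter (support (\<phi> i)))\<^sup>2 * (\<epsilon>\<^sub>1 i)\<^sup>2 + C_inf\<^sup>2 * (\<epsilon>\<^sub>2 i)\<^sup>2)"
    unfolding real_sqrt_mult[symmetric] by (rule real_le_rsqrt)
  have "global_set N \<phi> (trial_set net \<Theta>) \<subseteq> H1 \<Omega>"
    using local_sum_in_H1 H1_trial by (auto simp: global_set_def)
  moreover have "local_sum N \<phi> v \<in> global_set N \<phi> (trial_set net \<Theta>)"
    using v by (auto simp: global_set_def)
  ultimately show ?thesis using 1 2 by blast
qed

end
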